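(* Let $X$ be a Tychonoff space. (1) If $X$ is metrizable, then $X$ has the strong Skorohod property. (2) If $X$ is $k$-metrizable, then $X$ has the uniformly tight strong Skorohod property. (3) If $X$ is $k^*$-metrizable, then $X$ has the weak Skorohod property.
   Context: All topological spaces are Hausdorff; "map" means continuous function. A subset is precompact if its closure is compact. A map $f:X\to Y$ is proper if $f^{-1}(K)$ is precompact in $X$ for every precompact $K\subset Y$; it is subproper if there is $Z\subset X$ with $f(Z)=Y$ such that $Z\cap f^{-1}(K)$ is precompact in $X$ for every precompact $K\subset Y$. A space is $k$-metrizable (resp. $k^*$-metrizable) if it is the image of a metrizable space under a proper (resp. subproper) map. A Borel probability measure $\mu$ on $X$ is Radon if for every $\varepsilon>0$ and every Borel $B\subset X$ there is a compact $K\subset B$ with $\mu(B\setminus K)<\varepsilon$. $P_r(X)$ is the space of all Radon Borel probability measures on $X$ with the topology generated by the sub-basis of sets $\{\mu\in P_r(X):\mu(U)>a\}$, $a\in\mathbb R$, $U\subset X$ open. A family $\mathcal M\subset P_r(X)$ is uniformly tight if for every $\varepsilon>0$ there is a compact $K_\varepsilon\subset X$ with $\mu(X\setminus K_\varepsilon)<\varepsilon$ for all $\mu\in\mathcal M$. $X$ has the strong Skorohod property if to each $\mu\in P_r(X)$ one can assign a Borel function $\xi_\mu:[0,1]\to X$ such that $\mu$ is the image of Lebesgue measure under $\xi_\mu$ and for every sequence $(\mu_n)\subset P_r(X)$ convergent in $P_r(X)$ to a measure $\mu_0\in P_r(X)$ the sequence $(\xi_{\mu_n})$ converges to $\xi_{\mu_0}$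 almost surely on $[0,1]$. The uniformly tight strong Skorohod property requires the latter only for uniformly tight (weakly) convergent sequences $(\mu_n)$. $X$ has the weak Skorohod property if to each $\mu\in P_r(X)$ one can assign a Borel function $\xi_\mu:[0,1]\to X$ such that $\mu$ is the image of Lebesgue measure under $\xi_\mu$ and for every uniformly tight sequence $(\mu_n)\subset P_r(X)$ the sequence $(\xi_{\mu_n})$ contains a subsequence that converges in $X$ almost surely with respect to Lebesgue measure on $[0,1]$. *)

theory Defs
  imports "HOL-Probability.Probability"
begin

definition tychonoff_space :: "'a topology \<Rightarrow> bool" where
  "tychonoff_space X \<longleftrightarrow> completely_regular_space X \<and> Hausdorff_space X"

definition precompactin :: "'a topology \<Rightarrow> 'a set \<Rightarrow> bool" where
  "precompactin X S \<longleftrightarrow> S \<subseteq> topspace X \<and> compactin X (X closure_of S)"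

text \<open>Properness refers to precompact sets; this differs from the library's \<^const>\<open>proper_map\<close>
  (a closed map with compact fibres, not required to be continuous).\<close>

definition pc_proper_map :: "'a topology \<Rightarrow> 'b topology \<Rightarrow> ('a \<Rightarrow> 'b) \<Rightarrow> bool" where
  "pc_proper_map X Y f \<longleftrightarrow> continuous_map X Y f \<and>
    (\<forall>K. precompactin Y K \<longrightarrow> precompactin X (topspace X \<inter> f -` K))"

definition pc_subproper_map :: "'a topology \<Rightarrow> 'b topology \<Rightarrow> ('a \<Rightarrow> 'b) \<Rightarrow> bool" where
  "pc_subproper_map X Y f \<longleftrightarrow> continuous_map X Y f \<and>
    (\<exists>Z\<subseteq>topspace X. f ` Z = topspace Y \<and>
      (\<forall>K. precompactin Y K \<longrightarrow> precompactin X (Z \<inter> f -` K)))"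

text \<open>HOL cannot quantify existentially over types, so the type in which the metrizable preimage
  lives is a parameter. In a theorem it occurs only in the hypothesis and is a free type variable,
  hence the theorem covers metrizable preimages over every type.\<close>

definition k_metrizable :: "'m itself \<Rightarrow> 'a topology \<Rightarrow> bool" where
  "k_metrizable TYPE('m) X \<longleftrightarrow> (\<exists>(M :: 'm topology) f.
    metrizable_space M \<and> pc_proper_map M X f \<and> f ` topspace M = topspace X)"

definition k_star_metrizable :: "'m itself \<Rightarrow> 'a topology \<Rightarrow> bool" where
  "k_star_metrizable TYPE('m) X \<longleftrightarrow> (\<exists>(M :: 'm topology) f.
    metrizable_space M \<and> pc_subproper_map M X f \<and> f ` topspace M = topspace X)"

definition borel_of :: "'a topology \<Rightarrow> 'a measure" where
  "borel_of X = sigma (topspace X) {U. openin X U}"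

definition radon_probs :: "'a topology \<Rightarrow> 'a measure set" where
  "radon_probs X = {\<mu>. prob_space \<mu> \<and> sets \<mu> = sets (borel_of X) \<and>
    (\<forall>\<epsilon>>0. \<forall>B\<in>sets (borel_of X). \<exists>K\<subseteq>B. compactin X K \<and> measure \<mu> (B - K) < \<epsilon>)}"

definition radon_topology :: "'a topology \<Rightarrow> 'a measure topology" where
  "radon_topology X = topology_generated_by
    {{\<mu> \<in> radon_probs X. measure \<mu> U > a} | (a :: real) U. openin X U}"

lemma topspace_radon_topology: "topspace (radon_topology X) = radon_probs X"
proof
  show "topspace (radon_topology X) \<subseteq> radon_probs X"
    unfolding radon_topology_def topology_generated_by_topspace by blast
  show "radon_probs X \<subseteq> topspace (radon_topology X)"
  proof
    fix \<mu> assume "\<mu> \<in> radon_probs X"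
    then have "\<mu> \<in> {\<mu> \<in> radon_probs X. measure \<mu> {} > -1}"
      by simp
    then show "\<mu> \<in> topspace (radon_topology X)"
      unfolding radon_topology_def topology_generated_by_topspace
      using openin_empty by blast
  qed
qed

definition uniformly_tight :: "'a topology \<Rightarrow> 'a measure set \<Rightarrow> bool" where
  "uniformly_tight X \<M> \<longleftrightarrow>
    (\<forall>\<epsilon>>0. \<exists>K. compactin X K \<and> (\<forall>\<mu>\<in>\<M>. measure \<mu> (topspace X - K) < \<epsilon>))"

abbreviation unit_lebesgue :: "real measure" where
  "unit_lebesgue \<equiv> restrict_space lborel {0..1}"

definition skorohod_parametrization :: "'a topology \<Rightarrow> ('a measure \<Rightarrow> real \<Rightarrow> 'a) \<Rightarrow> bool" where
  "skorohod_parametrization X \<xi> \<longleftrightarrow> (\<forall>\<mu>\<in>radon_probs X.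
    \<xi> \<mu> \<in> measurable unit_lebesgue (borel_of X) \<and> distr unit_lebesgue (borel_of X) (\<xi> \<mu>) = \<mu>)"

definition strong_skorohod :: "'a topology \<Rightarrow> bool" where
  "strong_skorohod X \<longleftrightarrow> (\<exists>\<xi>. skorohod_parametrization X \<xi> \<and>
    (\<forall>\<mu> \<mu>\<^sub>0. range \<mu> \<subseteq> radon_probs X \<longrightarrow> limitin (radon_topology X) \<mu> \<mu>\<^sub>0 sequentially \<longrightarrow>
      (AE t in unit_lebesgue. limitin X (\<lambda>n. \<xi> (\<mu> n) t) (\<xi> \<mu>\<^sub>0 t) sequentially)))"

definition uniformly_tight_strong_skorohod :: "'a topology \<Rightarrow> bool" where
  "uniformly_tight_strong_skorohod X \<longleftrightarrow> (\<exists>\<xi>. skorohod_parametrization X \<xi> \<and>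
    (\<forall>\<mu> \<mu>\<^sub>0. range \<mu> \<subseteq> radon_probs X \<longrightarrow> uniformly_tight X (range \<mu>) \<longrightarrow>
      limitin (radon_topology X) \<mu> \<mu>\<^sub>0 sequentially \<longrightarrow>
      (AE t in unit_lebesgue. limitin X (\<lambda>n. \<xi> (\<mu> n) t) (\<xi> \<mu>\<^sub>0 t) sequentially)))"

definition weak_skorohod :: "'a topology \<Rightarrow> bool" where
  "weak_skorohod X \<longleftrightarrow> (\<exists>\<xi>. skorohod_parametrization X \<xi> \<and>
    (\<forall>\<mu>. range \<mu> \<subseteq> radon_probs X \<longrightarrow> uniformly_tight X (range \<mu>) \<longrightarrow>
      (\<exists>r :: nat \<Rightarrow> nat. strict_mono r \<and>
        (AE t in unit_lebesgue. \<exists>x. limitin X (\<lambda>k. \<xi> (\<mu> (r k)) t) x sequentially))))"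

end

theory Submission
  imports Defs "HOL-Complex_Analysis.Great_Picard"
begin

text \<open>
  The theorem rests on one construction in a metric space \<open>M\<close>. Well-order the points of \<open>M\<close>. At each scale
  \<open>(1 / 2) ^ j\<close> the tent functions around the points, added one after the other in this order, have
  increments that form a continuous partition of unity (\<open>weight_has_sum\<close>), and products of these over
  the scales give partitions of unity indexed by finite words of points. A measure \<open>\<nu>\<close> turns them into
  numbers, the masses of the words, which form a tree of total mass 1 when \<open>\<nu>\<close> is tight
  (\<open>mass_tree_mass\<close>). Subdivide the unit interval accordingly, in lexicographic order. Almost every \<open>t\<close>
  then spells an infinite word, whose letters converge to a point of \<open>M\<close>, the coded point \<open>code \<nu> t\<close>.
  Only countably many words carry mass, and the limits exist in the compact sets that nearly
  carry \<open>\<nu>\<close>. The coded point lies in a compact \<open>K\<close> with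
  probability at least \<open>\<nu> K\<close> (\<open>code_in_compact\<close>), which for a Radon measure forces its law to be \<open>\<nu>\<close>
  (\<open>radon_prob_eqI\<close>).

  The masses are integrals of continuous functions, so they converge when the measures converge. As no
  mass is lost, the end points of the intervals converge as well (\<open>left_end_tendsto\<close>). A number \<open>t\<close> that is
  not one of the countably many end points eventually spells the same prefix for \<open>\<nu>\<^sub>n\<close> as for the limit,
  hence the coded points converge (\<open>code_tendsto_if_weak_limit\<close>). This is the strong Skorohod property
  of metrizable spaces. For a uniformly tight sequence without a limit, the masses converge along a
  diagonal subsequence, and the same argument gives the convergence of the coded points
  along it (\<open>code_convergent_subsequence\<close>).

  If \<open>X\<close> is the image of a metric space under a proper map, the quotient topology on \<open>X\<close> is metrizable and has
  the same compact sets as the given one (\<open>metric_of_proper_image\<close>). Measures on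
  \<open>X\<close> extend to the finer Borel algebra, and for uniformly tight sequences convergence is the same
  for both topologies (\<open>refine_weak_limit\<close>), so that the metrizable case applies.

  If \<open>X\<close> is only the image of \<open>M\<close> under a subproper map \<open>f\<close>, a section of \<open>f\<close> is available that maps compact
  sets to precompact ones. It need not be measurable, but it has a measurable shadow with the same property
  (\<open>measurable_shadow\<close>). The shadow lifts uniformly tight families from \<open>X\<close> to \<open>M\<close>,
  where subsequences of coded points converge, and \<open>f\<close> carries them back to \<open>X\<close>.
\<close>

section \<open>Borel measures on abstract topological spaces\<close>

lemma sets_borel_of: "sets (borel_of X) = sigma_sets (topspace X) {U. openin X U}"
  unfolding borel_of_def by (rule sets_measure_of) (auto dest: openin_subset)

lemma space_borel_of [simp]: "space (borel_of X) = topspace X"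
  unfolding borel_of_def by (rule space_measure_of) (auto dest: openin_subset)

lemma openin_borel_of: "openin X U \<Longrightarrow> U \<in> sets (borel_of X)"
  by (simp add: sets_borel_of sigma_sets.Basic)

lemma closedin_borel_of: "closedin X C \<Longrightarrow> C \<in> sets (borel_of X)"
  by (metis closedin_def double_diff openin_borel_of sets.compl_sets space_borel_of subset_refl)

lemma compactin_borel_of: "Hausdorff_space X \<Longrightarrow> compactin X K \<Longrightarrow> K \<in> sets (borel_of X)"
  by (simp add: closedin_borel_of compactin_imp_closedin)

lemma measurable_borel_ofI:
  assumes "\<And>x. x \<in> space N \<Longrightarrow> f x \<in> topspace X"
    and "\<And>U. openin X U \<Longrightarrow> f -` U \<inter> space N \<in> sets N"
  shows "f \<in> measurable N (borel_of X)"
proof (rule measurable_sigma_sets[where \<Omega> = "topspace X" and A = "{U. openin X U}"])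
  show "sets (borel_of X) = sigma_sets (topspace X) {U. openin X U}" by (rule sets_borel_of)
  show "{U. openin X U} \<subseteq> Pow (topspace X)" by (auto dest: openin_subset)
qed (use assms in auto)

lemma continuous_map_borel_of:
  assumes "continuous_map X Y f"
  shows "f \<in> measurable (borel_of X) (borel_of Y)"
proof (rule measurable_borel_ofI)
  fix x assume "x \<in> space (borel_of X)"
  then show "f x \<in> topspace Y" using assms by (auto simp: continuous_map_def)
next
  fix U assume "openin Y U"
  then have "openin X {x \<in> topspace X. f x \<in> U}" using assms by (auto simp: continuous_map_def)
  moreover have "f -` U \<inter> space (borel_of X) = {x \<in> topspace X. f x \<in> U}" by auto
  ultimately show "f -` U \<inter> space (borel_of X) \<in> sets (borel_of X)"
    by (simp add: openin_borel_of)
qed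

lemma continuous_map_borel_measurable:
  assumes "continuous_map X euclideanreal g"
  shows "g \<in> borel_measurable (borel_of X)"
proof -
  have "sets (borel_of euclideanreal) = sets (borel :: real measure)"
    by (simp add: sets_borel_of borel_def)
  then show ?thesis
    using continuous_map_borel_of[OF assms] measurable_cong_sets by blast
qed

text \<open>Tightness is all that the construction of a coded point needs; the measures transported to
  auxiliary metric spaces below are tight by construction, whereas their Radon property would need
  a further regularity argument.\<close>

definition tight_probs :: "'a topology \<Rightarrow> 'a measure set" where
  "tight_probs X = {\<nu>. prob_space \<nu> \<and> sets \<nu> = sets (borel_of X) \<and> uniformly_tight X {\<nu>}}"

lemma tight_probsD:
  assumes "\<nu> \<in> tight_probs X"
  shows "prob_space \<nu>" "sets \<nu> = sets (borel_of X)" "space \<nu> = topspace X"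
  using assms sets_eq_imp_space_eq[of \<nu> "borel_of X"] unfolding tight_probs_def by auto

lemma tight_probs_compact:
  assumes "\<nu> \<in> tight_probs X" "\<epsilon> > 0"
  obtains K where "compactin X K" "measure \<nu> (topspace X - K) < \<epsilon>"
  using assms unfolding tight_probs_def uniformly_tight_def by auto

lemma radon_probsD:
  assumes "\<mu> \<in> radon_probs X"
  shows "prob_space \<mu>" "sets \<mu> = sets (borel_of X)" "space \<mu> = topspace X"
  using assms sets_eq_imp_space_eq[of \<mu> "borel_of X"] unfolding radon_probs_def by auto

lemma radon_probs_inner_compact:
  assumes "\<mu> \<in> radon_probs X" "\<epsilon> > 0" "B \<in> sets \<mu>"
  obtains K where "K \<subseteq> B" "compactin X K" "measure \<mu> (B - K) < \<epsilon>"
proof -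
  have "\<exists>K\<subseteq>B. compactin X K \<and> measure \<mu> (B - K) < \<epsilon>"
    using assms unfolding radon_probs_def by simp
  then show thesis using that by blast
qed

lemma radon_probs_subset_tight_probs: "radon_probs X \<subseteq> tight_probs X"
proof
  fix \<mu> assume mu: "\<mu> \<in> radon_probs X"
  have "topspace X \<in> sets \<mu>"
    using radon_probsD[OF mu] sets.top[of \<mu>] by simp
  then have "uniformly_tight X {\<mu>}"
    unfolding uniformly_tight_def using radon_probs_inner_compact[OF mu] by (metis singletonD)
  then show "\<mu> \<in> tight_probs X" using radon_probsD[OF mu] unfolding tight_probs_def by simp
qed

text \<open>One inequality on compact sets is enough: inner regularity of \<open>\<mu>\<close> extends it to all Borel sets,
  and applied to a set and to its complement it becomes an equality because both total masses
  are 1.\<close>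

lemma radon_prob_eqI:
  assumes H: "Hausdorff_space X" and mu: "\<mu> \<in> radon_probs X"
    and nu: "prob_space \<nu>" "sets \<nu> = sets (borel_of X)"
    and le: "\<And>K. compactin X K \<Longrightarrow> measure \<mu> K \<le> measure \<nu> K"
  shows "\<nu> = \<mu>"
proof -
  interpret m: prob_space \<mu> by (rule radon_probsD[OF mu])
  interpret n: prob_space \<nu> by (rule nu)
  have S: "sets \<nu> = sets \<mu>" using nu radon_probsD[OF mu] by simp
  then have sp: "space \<nu> = space \<mu>" by (rule sets_eq_imp_space_eq)
  have ge: "measure \<mu> B \<le> measure \<nu> B" if B: "B \<in> sets \<mu>" for B
  proof (rule field_le_epsilon)
    fix e :: real assume "e > 0"
    then obtain K where K: "K \<subseteq> B" "compactin X K" "measure \<mu> (B - K) < e"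
      by (rule radon_probs_inner_compact[OF mu _ B])
    have Ks: "K \<in> sets \<mu>" using compactin_borel_of[OF H K(2)] radon_probsD[OF mu] by simp
    have "measure \<mu> B = measure \<mu> K + measure \<mu> (B - K)"
      using m.finite_measure_Diff[OF B Ks K(1)] by simp
    also have "\<dots> \<le> measure \<nu> K + e" using le[OF K(2)] K(3) by simp
    also have "measure \<nu> K \<le> measure \<nu> B"
      using B S K(1) by (intro n.finite_measure_mono) auto
    finally show "measure \<mu> B \<le> measure \<nu> B + e" by simp
  qed
  have "measure \<nu> B = measure \<mu> B" if B: "B \<in> sets \<mu>" for B
  proof -
    have "measure \<mu> (space \<mu> - B) \<le> measure \<nu> (space \<mu> - B)" using B by (intro ge) auto
    then have "1 - measure \<mu> B \<le> 1 - measure \<nu> B"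
      using m.prob_compl[OF B] n.prob_compl[of B] B S sp by simp
    with ge[OF B] show ?thesis by simp
  qed
  then show ?thesis using S
    by (intro measure_eqI) (auto simp: m.emeasure_eq_measure n.emeasure_eq_measure)
qed

text \<open>The form in which tightness yields statements that hold almost everywhere: \<open>B\<close> is the part
  of the space that a compact set controls.\<close>

lemma AE_all_epsilonI:
  fixes P :: "'a \<Rightarrow> bool"
  assumes "finite_measure N"
    and "\<And>e. e > 0 \<Longrightarrow> \<exists>B\<in>sets N. measure N (space N - B) \<le> e \<and> (AE x in N. x \<in> B \<longrightarrow> P x)"
  shows "AE x in N. P x"
proof -
  interpret finite_measure N by fact
  have "\<exists>B\<in>sets N. measure N (space N - B) \<le> 1 / Suc n \<and> (AE x in N. x \<in> B \<longrightarrow> P x)" for n :: nat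
    by (rule assms(2)) simp
  then obtain B where B: "\<And>n. B n \<in> sets N" "\<And>n::nat. measure N (space N - B n) \<le> 1 / Suc n"
      "\<And>n. AE x in N. x \<in> B n \<longrightarrow> P x"
    by metis
  let ?D = "\<Inter>n. space N - B n"
  have D: "?D \<in> sets N" using B(1) by (intro sets.countable_INT image_subsetI) (auto intro: sets.compl_sets)
  have le: "measure N ?D \<le> 1 / real (Suc n)" for n
  proof -
    have "measure N ?D \<le> measure N (space N - B n)"
      by (rule finite_measure_mono) (use B(1) in auto)
    then show ?thesis using B(2)[of n] by simp
  qed
  have "(\<lambda>n. 1 / real (Suc n)) \<longlonglongrightarrow> 0" by (rule LIMSEQ_Suc[OF lim_1_over_n])
  then have "measure N ?D \<le> 0" using le by (intro LIMSEQ_le_const[of _ 0]) auto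
  then have "emeasure N ?D = 0" by (simp add: emeasure_eq_measure measure_nonneg order.antisym)
  then have "AE x in N. x \<notin> ?D"
    using D by (intro AE_not_in) (auto simp: null_sets_def)
  moreover have "AE x in N. \<forall>n. x \<in> B n \<longrightarrow> P x" by (rule AE_all_countable[THEN iffD2]) (use B(3) in blast)
  ultimately show ?thesis using AE_space by eventually_elim auto
qed

lemma emeasure_UN_le_finite:
  assumes "countable I" "\<And>i. i \<in> I \<Longrightarrow> Q i \<in> sets N"
    and "\<And>F. finite F \<Longrightarrow> F \<subseteq> I \<Longrightarrow> emeasure N (\<Union>i\<in>F. Q i) \<le> c"
  shows "emeasure N (\<Union>i\<in>I. Q i) \<le> c"
proof (cases "I = {}")
  case False
  define w where "w = from_nat_into I"
  have w: "range w = I" using assms(1) False by (simp add: w_def range_from_nat_into)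
  define A where "A n = (\<Union>i\<in>w ` {..<n}. Q i)" for n :: nat
  have A: "A n \<in> sets N" for n using assms(2) w unfolding A_def by (intro sets.finite_UN) auto
  have "(SUP n. emeasure N (A n)) = emeasure N (\<Union>n. A n)"
  proof (rule SUP_emeasure_incseq)
    show "range A \<subseteq> sets N" using A by blast
    show "incseq A" unfolding incseq_def A_def by (intro allI impI UN_mono image_mono) auto
  qed
  moreover have "(\<Union>n. A n) = (\<Union>i\<in>I. Q i)" unfolding A_def w[symmetric] by auto
  moreover have "emeasure N (A n) \<le> c" for n unfolding A_def using w by (intro assms(3)) auto
  ultimately show ?thesis by (metis SUP_least)
qed simp

section \<open>Points coded by shrinking balls\<close>

context Metric_space
begin

text \<open>This replaces completeness of the space: a sequence of balls that is compatible with \<open>K\<close> at every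
  finite stage shrinks to a point of \<open>K\<close>, by the finite intersection property.\<close>

lemma nested_balls_meet_compact:
  assumes K: "compactin mtopology K" and a: "\<And>j. a j \<in> M"
    and ex: "\<And>k. \<exists>x\<in>K. \<forall>j<k. d (a j) x \<le> e j"
  shows "\<exists>x\<in>K. \<forall>j::nat. d (a j) x \<le> e j"
proof -
  have KM: "K \<subseteq> M" using K compactin_subset_topspace by fastforce
  let ?\<U> = "range (\<lambda>j. mcball (a j) (e j))"
  have fin: "K \<inter> \<Inter>\<F> \<noteq> {}" if F: "finite \<F>" "\<F> \<subseteq> ?\<U>" for \<F>
  proof -
    obtain J where J: "finite J" "\<F> = (\<lambda>j. mcball (a j) (e j)) ` J"
      using finite_subset_image[OF F] by auto
    obtain k where k: "\<forall>j\<in>J. j < k" using J(1) finite_nat_set_iff_bounded by blast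
    obtain x where "x \<in> K" "\<forall>j<k. d (a j) x \<le> e j" using ex by blast
    then have "x \<in> K \<inter> \<Inter>\<F>" using J k KM a by auto
    then show ?thesis by blast
  qed
  have "K \<inter> \<Inter>?\<U> \<noteq> {}"
    by (rule K[unfolded compactin_fip, THEN conjunct2, THEN spec, THEN mp]) (use fin in simp)
  then obtain x where x: "x \<in> K" "x \<in> \<Inter>?\<U>" by (meson Int_iff ex_in_conv)
  have "d (a j) x \<le> e j" for j
  proof -
    have "x \<in> mcball (a j) (e j)" using x(2) by (rule InterD) simp
    then show ?thesis by simp
  qed
  then show ?thesis using x(1) by blast
qed

lemma points_equal_if_close:
  assumes "x \<in> M" "y \<in> M" and close: "\<And>\<epsilon>. \<epsilon> > 0 \<Longrightarrow> \<exists>c\<in>M. \<exists>e<\<epsilon>. d c x \<le> e \<and> d c y \<le> e"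
  shows "x = y"
proof (rule ccontr)
  assume "x \<noteq> y"
  then have "d x y / 2 > 0" using assms mdist_pos_less by simp
  then obtain c e where "c \<in> M" "e < d x y / 2" "d c x \<le> e" "d c y \<le> e" using close by blast
  then show False using triangle''[of x c y] assms by simp
qed

text \<open>A random point that is determined by countably many measurable events ``\<open>\<omega> \<in> Q i\<close>'', each of
  which confines it to a ball, is measurable: if \<open>U\<close> is open then the point lies in \<open>U\<close> exactly when
  one of the events occurs whose closed ball is contained in \<open>U\<close>. The exceptional null set is
  sent to a fixed point, so that the result is Borel and not merely measurable for the completion.\<close>

lemma measurable_coded_point:
  assumes I: "countable I" and Q: "\<And>i. i \<in> I \<Longrightarrow> Q i \<in> sets N" and c: "\<And>i. i \<in> I \<Longrightarrow> c i \<in> M"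
    and AE: "AE \<omega> in N. (\<forall>\<epsilon>>0. \<exists>i\<in>I. \<omega> \<in> Q i \<and> e i < \<epsilon>) \<and> (\<exists>x\<in>M. \<forall>i\<in>I. \<omega> \<in> Q i \<longrightarrow> d (c i) x \<le> e i)"
    and ne: "M \<noteq> {}"
  shows "\<exists>\<eta>\<in>measurable N (borel_of mtopology). AE \<omega> in N. \<forall>i\<in>I. \<omega> \<in> Q i \<longrightarrow> d (c i) (\<eta> \<omega>) \<le> e i"
proof -
  obtain x0 where x0: "x0 \<in> M" using ne by blast
  obtain Z where Z: "Z \<in> null_sets N"
    and good: "\<And>\<omega>. \<omega> \<in> space N \<Longrightarrow> \<omega> \<notin> Z \<Longrightarrow>
      (\<forall>\<epsilon>>0. \<exists>i\<in>I. \<omega> \<in> Q i \<and> e i < \<epsilon>) \<and> (\<exists>x\<in>M. \<forall>i\<in>I. \<omega> \<in> Q i \<longrightarrow> d (c i) x \<le> e i)"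
    using AE unfolding eventually_ae_filter by blast
  define pt where "pt \<omega> = (SOME x. x \<in> M \<and> (\<forall>i\<in>I. \<omega> \<in> Q i \<longrightarrow> d (c i) x \<le> e i))" for \<omega>
  have pt: "pt \<omega> \<in> M \<and> (\<forall>i\<in>I. \<omega> \<in> Q i \<longrightarrow> d (c i) (pt \<omega>) \<le> e i)"
    if "\<omega> \<in> space N" "\<omega> \<notin> Z" for \<omega>
    unfolding pt_def by (rule someI_ex) (use good[OF that] in blast)
  define \<eta> where "\<eta> \<omega> = (if \<omega> \<in> Z then x0 else pt \<omega>)" for \<omega>
  have "\<eta> \<in> measurable N (borel_of mtopology)"
  proof (rule measurable_borel_ofI)
    fix \<omega> assume "\<omega> \<in> space N"
    then show "\<eta> \<omega> \<in> topspace mtopology" using x0 pt unfolding \<eta>_def by auto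
  next
    fix U assume U: "openin mtopology U"
    let ?J = "{i\<in>I. mcball (c i) (e i) \<subseteq> U}"
    define S where "S = (\<Union>i\<in>?J. Q i)"
    have S: "S \<in> sets N"
      unfolding S_def using I Q by (intro sets.countable_UN') (auto intro: countable_subset)
    have iff: "pt \<omega> \<in> U \<longleftrightarrow> \<omega> \<in> S" if om: "\<omega> \<in> space N" "\<omega> \<notin> Z" for \<omega>
    proof
      assume "pt \<omega> \<in> U"
      then obtain r where r: "r > 0" "mball (pt \<omega>) r \<subseteq> U" using U unfolding openin_mtopology by metis
      obtain i where i: "i \<in> I" "\<omega> \<in> Q i" "e i < r / 2" using good[OF om] r(1) half_gt_zero by blast
      have "mcball (c i) (e i) \<subseteq> mball (pt \<omega>) r"
      proof
        fix y assume "y \<in> mcball (c i) (e i)"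
        then have y: "y \<in> M" "d (c i) y \<le> e i" by auto
        have "d (c i) (pt \<omega>) \<le> e i" "pt \<omega> \<in> M" using pt[OF om] i by auto
        then show "y \<in> mball (pt \<omega>) r" using triangle''[of "pt \<omega>" "c i" y] y c[OF i(1)] i(3) by auto
      qed
      then show "\<omega> \<in> S" using i r unfolding S_def by blast
    next
      assume "\<omega> \<in> S"
      then obtain i where "i \<in> I" "mcball (c i) (e i) \<subseteq> U" "\<omega> \<in> Q i" unfolding S_def by blast
      then show "pt \<omega> \<in> U" using pt[OF om] c by auto
    qed
    have "\<omega> \<in> \<eta> -` U \<inter> space N \<longleftrightarrow> \<omega> \<in> (if x0 \<in> U then Z else {}) \<union> (S - Z)" for \<omega>
      using iff[of \<omega>] sets.sets_into_space[OF S] sets.sets_into_space[of Z N] Z unfolding \<eta>_def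
      by (auto simp: null_sets_def)
    then have "\<eta> -` U \<inter> space N = (if x0 \<in> U then Z else {}) \<union> (S - Z)" by blast
    then show "\<eta> -` U \<inter> space N \<in> sets N" using Z S by (auto simp: null_sets_def)
  qed
  moreover have "AE \<omega> in N. \<forall>i\<in>I. \<omega> \<in> Q i \<longrightarrow> d (c i) (\<eta> \<omega>) \<le> e i"
    using AE_not_in[OF Z] AE_space by eventually_elim (use pt in \<open>auto simp: \<eta>_def\<close>)
  ultimately show ?thesis by blast
qed

end

section \<open>Mass trees and the intervals they cut out\<close>

text \<open>Scheffe's lemma for sums: when no mass is lost in the limit, pointwise convergence
  implies convergence of every partial mass. The lower bound holds on \<open>A\<close> and on its complement, and
  the convergence of the total turns the latter into the upper bound on \<open>A\<close>.\<close>

lemma tendsto_infsum_subset: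
  fixes f :: "nat \<Rightarrow> 'a \<Rightarrow> real"
  assumes f: "\<And>n. (f n has_sum c n) UNIV" and g: "(g has_sum c0) UNIV"
    and nn: "\<And>n a. 0 \<le> f n a" "\<And>a. 0 \<le> g a"
    and lim: "\<And>a. (\<lambda>n. f n a) \<longlonglongrightarrow> g a" "c \<longlonglongrightarrow> c0"
  shows "(\<lambda>n. infsum (f n) A) \<longlonglongrightarrow> infsum g A"
proof -
  have sf: "f n summable_on B" and sg: "g summable_on B" for n B
    using f g summable_on_subset_banach[of _ UNIV B] by (auto simp: summable_on_def)
  have low: "\<forall>\<^sub>F n in sequentially. infsum g B - e < infsum (f n) B" if e: "e > 0" for B e
  proof -
    obtain F where F: "finite F" "F \<subseteq> B" "dist (sum g F) (infsum g B) \<le> e / 3"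
      using infsum_finite_approximation[OF sg, of "e / 3"] e by auto
    have "(\<lambda>n. sum (f n) F) \<longlonglongrightarrow> sum g F" by (intro tendsto_sum lim)
    then have "\<forall>\<^sub>F n in sequentially. sum g F - e / 3 < sum (f n) F"
      using e by (intro order_tendstoD(1)) auto
    then show ?thesis
    proof eventually_elim
      case (elim n)
      have "sum (f n) F \<le> infsum (f n) B"
        using finite_sum_le_infsum[OF sf F(1,2)] nn by auto
      moreover have "infsum g B - e / 3 \<le> sum g F" using F(3) by (auto simp: dist_real_def abs_if split: if_splits)
      ultimately show ?case using elim e by linarith
    qed
  qed
  have split: "infsum h A + infsum h (- A) = s" if "(h has_sum s) UNIV" "\<And>B. h summable_on B" for h :: "'a \<Rightarrow> real" and s
    using infsum_Un_disjoint[of h A "- A"] that infsumI[OF that(1)] by (simp add: Compl_partition)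
  show ?thesis
  proof (rule LIMSEQ_I)
    fix e :: real assume e: "e > 0"
    have "\<forall>\<^sub>F n in sequentially. c n < c0 + e / 3" using lim(2) e by (intro order_tendstoD(2)) auto
    moreover have "e / 3 > 0" using e by simp
    note low[OF this, of A] low[OF this, of "- A"]
    ultimately have "\<forall>\<^sub>F n in sequentially. norm (infsum (f n) A - infsum g A) < e"
    proof eventually_elim
      case (elim n)
      show ?case using elim split[OF f[of n] sf] split[OF g sg] e by (auto simp: abs_less_iff)
    qed
    then show "\<exists>no. \<forall>n\<ge>no. norm (infsum (f n) A - infsum g A) < e"
      unfolding eventually_sequentially .
  qed
qed

text \<open>Words carry their most recent letter first, so that the children of \<open>w\<close> are the words \<open>a # w\<close>.
  The alphabet may be uncountable; only countably many words have positive mass.\<close>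

definition mass_tree :: "('a list \<Rightarrow> real) \<Rightarrow> bool" where
  "mass_tree \<Lambda> \<longleftrightarrow> \<Lambda> [] = 1 \<and> (\<forall>w. 0 \<le> \<Lambda> w) \<and> (\<forall>w. ((\<lambda>a. \<Lambda> (a # w)) has_sum \<Lambda> w) UNIV)"

lemma mass_treeD:
  assumes "mass_tree \<Lambda>"
  shows "\<Lambda> [] = 1" "0 \<le> \<Lambda> w" "((\<lambda>a. \<Lambda> (a # w)) has_sum \<Lambda> w) UNIV"
    "(\<lambda>a. \<Lambda> (a # w)) summable_on A"
proof -
  show 1: "\<Lambda> [] = 1" "0 \<le> \<Lambda> w" "((\<lambda>a. \<Lambda> (a # w)) has_sum \<Lambda> w) UNIV"
    using assms unfolding mass_tree_def by auto
  show "(\<lambda>a. \<Lambda> (a # w)) summable_on A"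
    using 1(3) summable_on_subset_banach[of _ UNIV A] by (auto simp: summable_on_def)
qed

lemma countable_mass_tree_support:
  assumes "mass_tree \<Lambda>"
  shows "countable {w. \<Lambda> w \<noteq> 0}"
proof -
  note treeD = mass_treeD[OF assms]
  have "countable {w. length w = k \<and> \<Lambda> w \<noteq> 0}" for k
  proof (induction k)
    case 0
    have "{w. length w = 0 \<and> \<Lambda> w \<noteq> 0} \<subseteq> {[]}" by auto
    then show ?case by (rule countable_subset) simp
  next
    case (Suc k)
    have 0: "\<Lambda> w \<noteq> 0" if "\<Lambda> (a # w) \<noteq> 0" for a w
    proof
      assume "\<Lambda> w = 0"
      then have "\<Lambda> (a # w) = 0"
        using nonneg_has_sum_le_0D[OF treeD(3)[of w]] treeD(2) by auto
      then show False using that by simp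
    qed
    have "{w. length w = Suc k \<and> \<Lambda> w \<noteq> 0} \<subseteq>
        (\<Union>w\<in>{w. length w = k \<and> \<Lambda> w \<noteq> 0}. (\<lambda>a. a # w) ` {a \<in> UNIV. \<Lambda> (a # w) \<noteq> 0})"
      using 0 by (auto simp: length_Suc_conv)
    moreover have "countable {a \<in> UNIV. \<Lambda> (a # w) \<noteq> 0}" for w
      by (rule summable_countable_real) (rule treeD(4))
    ultimately show ?case using Suc by (meson countable_UN countable_image countable_subset)
  qed
  then have "countable (\<Union>k. {w. length w = k \<and> \<Lambda> w \<noteq> 0})" by (intro countable_UN) auto
  moreover have "(\<Union>k. {w. length w = k \<and> \<Lambda> w \<noteq> 0}) = {w. \<Lambda> w \<noteq> 0}" by auto
  ultimately show ?thesis by simp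
qed

lemma prob_space_unit_lebesgue: "prob_space unit_lebesgue"
  by (intro prob_space_restrict_space) auto

lemma AE_unit_lebesgue_iff: "(AE t in unit_lebesgue. P t) \<longleftrightarrow> (AE t in lborel. t \<in> {0..1} \<longrightarrow> P t)"
  by (simp add: AE_restrict_space_iff)

text \<open>The order fixes, once for all trees, in which order the intervals of the children are laid out;
  its linearity makes the intervals of different trees comparable. That it is a well-order is used
  for the partition of unity.\<close>

locale alphabet_well_order =
  fixes prec :: "'a \<Rightarrow> 'a \<Rightarrow> bool" (infix "\<sqsubset>" 50)
  assumes wf_prec: "wfp (\<sqsubset>)"
    and prec_trans: "a \<sqsubset> b \<Longrightarrow> b \<sqsubset> c \<Longrightarrow> a \<sqsubset> c"
    and prec_total: "a \<sqsubset> b \<or> a = b \<or> b \<sqsubset> a"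
begin

lemma prec_irrefl: "\<not> a \<sqsubset> a"
  using wf_prec by (simp add: wfp_imp_irreflp irreflpD)

primrec left_end :: "('a list \<Rightarrow> real) \<Rightarrow> 'a list \<Rightarrow> real" where
  "left_end \<Lambda> [] = 0"
| "left_end \<Lambda> (a # w) = left_end \<Lambda> w + (\<Sum>\<^sub>\<infinity>b\<in>{b. b \<sqsubset> a}. \<Lambda> (b # w))"

text \<open>The cells of the words of a given length are disjoint intervals with lengths \<open>\<Lambda> w\<close>, in
  lexicographic order, and each level refines the previous one. Thus almost every number in the unit
  interval spells out an infinite word, and the law of its prefixes is \<open>\<Lambda>\<close>.\<close>

definition cell :: "('a list \<Rightarrow> real) \<Rightarrow> 'a list \<Rightarrow> real set" where
  "cell \<Lambda> w = {left_end \<Lambda> w ..< left_end \<Lambda> w + \<Lambda> w}"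

context
  fixes \<Lambda> :: "'a list \<Rightarrow> real"
  assumes tree: "mass_tree \<Lambda>"
begin

lemmas treeD = mass_treeD[OF tree]

lemma infsum_prec_insert:
  "(\<Sum>\<^sub>\<infinity>b\<in>{b. b \<sqsubset> a}. \<Lambda> (b # w)) + \<Lambda> (a # w) = (\<Sum>\<^sub>\<infinity>b\<in>insert a {b. b \<sqsubset> a}. \<Lambda> (b # w))"
  using infsum_Un_disjoint[OF treeD(4)[of w "{b. b \<sqsubset> a}"] treeD(4)[of w "{a}"]] prec_irrefl by auto

lemma infsum_children_mono:
  "A \<subseteq> B \<Longrightarrow> (\<Sum>\<^sub>\<infinity>b\<in>A. \<Lambda> (b # w)) \<le> (\<Sum>\<^sub>\<infinity>b\<in>B. \<Lambda> (b # w))"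
  by (intro infsum_mono2 treeD) auto

lemma cell_Cons_subset: "cell \<Lambda> (a # w) \<subseteq> cell \<Lambda> w"
proof -
  have "0 \<le> (\<Sum>\<^sub>\<infinity>b\<in>{b. b \<sqsubset> a}. \<Lambda> (b # w))" by (intro infsum_nonneg treeD)
  moreover have "(\<Sum>\<^sub>\<infinity>b\<in>{b. b \<sqsubset> a}. \<Lambda> (b # w)) + \<Lambda> (a # w) \<le> \<Lambda> w"
    using infsum_prec_insert[where a = a and w = w] infsum_children_mono[of "insert a {b. b \<sqsubset> a}" UNIV, where w = w] infsumI[OF treeD(3)[of w]]
    by simp
  ultimately show ?thesis unfolding cell_def by auto
qed

lemma cell_append_subset: "cell \<Lambda> (u @ w) \<subseteq> cell \<Lambda> w"
  by (induction u) (use cell_Cons_subset in auto)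

lemma cell_subset_unit: "cell \<Lambda> w \<subseteq> {0..<1}"
  using cell_append_subset[of w "[]"] treeD(1) by (simp add: cell_def)

lemma cell_disjoint_prec: "a \<sqsubset> b \<Longrightarrow> cell \<Lambda> (a # w) \<inter> cell \<Lambda> (b # w) = {}"
proof -
  assume "a \<sqsubset> b"
  then have "insert a {c. c \<sqsubset> a} \<subseteq> {c. c \<sqsubset> b}" using prec_trans by auto
  from infsum_children_mono[OF this, where w = w] show ?thesis
    using infsum_prec_insert[where a = a and w = w] unfolding cell_def by auto
qed

lemma cell_disjoint: "a \<noteq> b \<Longrightarrow> cell \<Lambda> (a # w) \<inter> cell \<Lambda> (b # w) = {}"
  using cell_disjoint_prec prec_total by (metis inf_commute)

lemma cell_unique: "t \<in> cell \<Lambda> v \<Longrightarrow> t \<in> cell \<Lambda> w \<Longrightarrow> length v = length w \<Longrightarrow> v = w"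
proof (induction v arbitrary: w)
  case (Cons a v)
  then obtain b w' where w: "w = b # w'" by (cases w) auto
  have "v = w'" using Cons w cell_Cons_subset by (metis length_Cons nat.inject subsetD)
  then show ?case using cell_disjoint[of a b v] Cons.prems w by auto
qed simp

lemma cell_prefix:
  assumes "t \<in> cell \<Lambda> v" "t \<in> cell \<Lambda> w" "length w \<le> length v"
  shows "\<exists>u. v = u @ w"
proof -
  let ?n = "length v - length w"
  have "t \<in> cell \<Lambda> (drop ?n v)"
    using cell_append_subset[of "take ?n v" "drop ?n v"] assms(1) by auto
  then have "drop ?n v = w" using assms by (intro cell_unique[OF _ assms(2)]) auto
  then show ?thesis using append_take_drop_id[of ?n v] by metis
qed

lemma cell_nonempty_imp: "t \<in> cell \<Lambda> w \<Longrightarrow> \<Lambda> w \<noteq> 0"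
  by (auto simp: cell_def)

lemma emeasure_cell: "emeasure lborel (cell \<Lambda> w) = ennreal (\<Lambda> w)"
  using treeD(2)[of w] by (simp add: cell_def)

lemma cell_sets [measurable]: "cell \<Lambda> w \<in> sets lborel" "cell \<Lambda> w \<in> sets borel"
  by (simp_all add: cell_def)

lemma cell_sets_unit: "cell \<Lambda> w \<in> sets unit_lebesgue"
proof -
  have "cell \<Lambda> w \<subseteq> {0..1}" using cell_subset_unit[of w] by auto
  then show ?thesis by (simp add: sets_restrict_space_iff cell_sets)
qed

lemma emeasure_cell_unit: "emeasure unit_lebesgue (cell \<Lambda> w) = ennreal (\<Lambda> w)"
proof -
  have "cell \<Lambda> w \<subseteq> {0..1}" using cell_subset_unit[of w] by auto
  then show ?thesis by (simp add: emeasure_restrict_space emeasure_cell)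
qed

text \<open>The children of \<open>w\<close> may leave gaps in the cell of \<open>w\<close>, but finitely many of them already fill it
  up to an arbitrarily small length.\<close>

lemma AE_cell_subdivided:
  "AE t in lborel. t \<in> cell \<Lambda> w \<longrightarrow> (\<exists>a. t \<in> cell \<Lambda> (a # w))"
proof -
  define A where "A = {a \<in> UNIV. \<Lambda> (a # w) \<noteq> 0}"
  have A: "countable A" unfolding A_def by (rule summable_countable_real) (rule treeD(4))
  define Z where "Z = cell \<Lambda> w - (\<Union>a\<in>A. cell \<Lambda> (a # w))"
  have Z: "Z \<in> sets lborel" unfolding Z_def using A by (intro sets.Diff sets.countable_UN' cell_sets) auto
  have le: "emeasure lborel Z \<le> 0 + ennreal e" if e: "e > 0" for e
  proof -
    obtain F where F: "finite F" "dist (\<Sum>a\<in>F. \<Lambda> (a # w)) (\<Lambda> w) \<le> e"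
      using has_sum_finite_approximation[OF treeD(3)[of w] e] by auto
    let ?U = "\<Union>a\<in>F. cell \<Lambda> (a # w)"
    have disj: "disjoint_family_on (\<lambda>a. cell \<Lambda> (a # w)) F"
      using cell_disjoint by (auto simp: disjoint_family_on_def)
    have U: "emeasure lborel ?U = ennreal (\<Sum>a\<in>F. \<Lambda> (a # w))"
    proof -
      have "emeasure lborel ?U = (\<Sum>a\<in>F. emeasure lborel (cell \<Lambda> (a # w)))"
        by (rule sum_emeasure[OF _ disj F(1), symmetric]) (use cell_sets in blast)
      then show ?thesis by (simp add: emeasure_cell treeD(2))
    qed
    have sub: "?U \<subseteq> cell \<Lambda> w" using cell_Cons_subset by auto
    have "Z \<subseteq> cell \<Lambda> w - ?U" using cell_nonempty_imp by (fastforce simp: Z_def A_def)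
    then have "emeasure lborel Z \<le> emeasure lborel (cell \<Lambda> w - ?U)"
      using F(1) by (intro emeasure_mono sets.Diff sets.finite_UN cell_sets) auto
    also have "\<dots> = emeasure lborel (cell \<Lambda> w) - emeasure lborel ?U"
      using F(1) sub U by (intro emeasure_Diff sets.finite_UN cell_sets) auto
    also have "\<dots> = ennreal (\<Lambda> w - (\<Sum>a\<in>F. \<Lambda> (a # w)))"
      unfolding U emeasure_cell by (intro ennreal_minus sum_nonneg treeD)
    also have "\<dots> \<le> ennreal e"
      using F(2) by (intro ennreal_leI) (auto simp: dist_real_def abs_if split: if_splits)
    finally show ?thesis by simp
  qed
  have "emeasure lborel Z \<le> 0" by (rule ennreal_le_epsilon) (rule le)
  then have "Z \<in> null_sets lborel" using Z by (auto simp: null_sets_def)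
  from AE_not_in[OF this] show ?thesis by eventually_elim (auto simp: Z_def)
qed

lemma AE_all_levels: "AE t in unit_lebesgue. \<forall>k. \<exists>w. length w = k \<and> t \<in> cell \<Lambda> w"
proof -
  have "AE t in lborel. \<forall>w\<in>{w. \<Lambda> w \<noteq> 0}. t \<in> cell \<Lambda> w \<longrightarrow> (\<exists>a. t \<in> cell \<Lambda> (a # w))"
    using countable_mass_tree_support[OF tree] AE_cell_subdivided by (subst AE_ball_countable) auto
  moreover have "AE t in lborel. t \<noteq> (1::real)" by (rule AE_lborel_singleton)
  ultimately have "AE t in lborel. t \<in> {0..1} \<longrightarrow> (\<forall>k. \<exists>w. length w = k \<and> t \<in> cell \<Lambda> w)"
  proof eventually_elim
    case (elim t)
    show ?case
    proof (intro impI allI)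
      fix k assume t: "t \<in> {0..1}"
      show "\<exists>w. length w = k \<and> t \<in> cell \<Lambda> w"
      proof (induction k)
        case 0
        have "t \<in> cell \<Lambda> []" using t elim(2) treeD(1) by (auto simp: cell_def)
        then show ?case by auto
      next
        case (Suc k)
        then obtain w where w: "length w = k" "t \<in> cell \<Lambda> w" by blast
        then obtain a where "t \<in> cell \<Lambda> (a # w)" using elim(1) cell_nonempty_imp by blast
        then show ?case using w by (intro exI[of _ "a # w"]) auto
      qed
    qed
  qed
  then show ?thesis by (simp add: AE_unit_lebesgue_iff)
qed

text \<open>For a set of words that is closed under extension it suffices to bound the masses at a single
  level: finitely many words can be replaced, up to a null set, by their extensions of a common
  length.\<close>

lemma emeasure_cells_le:
  assumes ext: "\<And>a w. w \<in> P \<Longrightarrow> a # w \<in> P"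
    and bound: "\<And>k F. finite F \<Longrightarrow> F \<subseteq> P \<Longrightarrow> (\<And>w. w \<in> F \<Longrightarrow> length w = k) \<Longrightarrow> sum \<Lambda> F \<le> c"
  shows "(\<Union>w\<in>P. cell \<Lambda> w) \<in> sets unit_lebesgue"
    and "emeasure unit_lebesgue (\<Union>w\<in>P. cell \<Lambda> w) \<le> ennreal c"
proof -
  define P' where "P' = {w\<in>P. \<Lambda> w \<noteq> 0}"
  have P': "countable P'" unfolding P'_def
    by (rule countable_subset[OF _ countable_mass_tree_support[OF tree]]) auto
  have eq: "(\<Union>w\<in>P. cell \<Lambda> w) = (\<Union>w\<in>P'. cell \<Lambda> w)"
    by (auto simp: P'_def dest: cell_nonempty_imp)
  show "(\<Union>w\<in>P. cell \<Lambda> w) \<in> sets unit_lebesgue"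
    unfolding eq using P' cell_sets_unit by (intro sets.countable_UN') auto
  have ext': "u @ w \<in> P" if "w \<in> P" for u w using that by (induction u) (auto intro: ext)
  show "emeasure unit_lebesgue (\<Union>w\<in>P. cell \<Lambda> w) \<le> ennreal c"
    unfolding eq
  proof (rule emeasure_UN_le_finite[OF P' cell_sets_unit])
    fix F assume F: "finite F" "F \<subseteq> P'"
    obtain k where k: "\<forall>w\<in>F. length w \<le> k" using F(1) finite_nat_set_iff_bounded_le[of "length ` F"] by auto
    define L where "L = {w\<in>P'. length w = k}"
    have L: "countable L" unfolding L_def by (rule countable_subset[OF _ P']) auto
    have "emeasure unit_lebesgue (\<Union>w\<in>F. cell \<Lambda> w) \<le> emeasure unit_lebesgue (\<Union>w\<in>L. cell \<Lambda> w)"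
    proof (rule emeasure_mono_AE)
      show "(\<Union>w\<in>L. cell \<Lambda> w) \<in> sets unit_lebesgue"
        using L cell_sets_unit by (intro sets.countable_UN') auto
      show "AE t in unit_lebesgue. t \<in> (\<Union>w\<in>F. cell \<Lambda> w) \<longrightarrow> t \<in> (\<Union>w\<in>L. cell \<Lambda> w)"
        using AE_all_levels
      proof eventually_elim
        case (elim t)
        show ?case
        proof
          assume "t \<in> (\<Union>w\<in>F. cell \<Lambda> w)"
          then obtain w where w: "w \<in> F" "t \<in> cell \<Lambda> w" by blast
          obtain v where v: "length v = k" "t \<in> cell \<Lambda> v" using elim by blast
          obtain u where v_eq: "v = u @ w" using cell_prefix[OF v(2) w(2)] v(1) k w(1) by auto
          have "w \<in> P" using w(1) F(2) by (auto simp: P'_def)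
          then have "v \<in> P" by (subst v_eq) (rule ext')
          then have "v \<in> L" using v cell_nonempty_imp[OF v(2)] by (simp add: L_def P'_def)
          then show "t \<in> (\<Union>w\<in>L. cell \<Lambda> w)" using v by blast
        qed
      qed
    qed
    also have "\<dots> \<le> ennreal c"
    proof (rule emeasure_UN_le_finite[OF L cell_sets_unit])
      fix G assume G: "finite G" "G \<subseteq> L"
      have "emeasure unit_lebesgue (\<Union>w\<in>G. cell \<Lambda> w) \<le> (\<Sum>w\<in>G. emeasure unit_lebesgue (cell \<Lambda> w))"
        using G(1) cell_sets_unit by (intro emeasure_subadditive_finite) auto
      also have "\<dots> = ennreal (sum \<Lambda> G)" by (simp add: emeasure_cell_unit treeD(2))
      also have "\<dots> \<le> ennreal c"
        using bound[of G k] G unfolding L_def P'_def by (intro ennreal_leI) auto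
      finally show "emeasure unit_lebesgue (\<Union>w\<in>G. cell \<Lambda> w) \<le> ennreal c" .
    qed
    finally show "emeasure unit_lebesgue (\<Union>w\<in>F. cell \<Lambda> w) \<le> ennreal c" .
  qed
qed

end

lemma left_end_tendsto:
  assumes "\<And>n. mass_tree (\<Lambda> n)" "mass_tree \<Lambda>0" and lim: "\<And>w. (\<lambda>n. \<Lambda> n w) \<longlonglongrightarrow> \<Lambda>0 w"
  shows "(\<lambda>n. left_end (\<Lambda> n) w) \<longlonglongrightarrow> left_end \<Lambda>0 w"
proof (induction w)
  case (Cons a w)
  have "(\<lambda>n. \<Sum>\<^sub>\<infinity>b\<in>{b. b \<sqsubset> a}. \<Lambda> n (b # w)) \<longlonglongrightarrow> (\<Sum>\<^sub>\<infinity>b\<in>{b. b \<sqsubset> a}. \<Lambda>0 (b # w))"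
    by (rule tendsto_infsum_subset[where c = "\<lambda>n. \<Lambda> n w"])
      (rule mass_treeD[OF assms(1)] mass_treeD[OF assms(2)] lim)+
  then show ?case using Cons by (simp add: tendsto_add)
qed simp

text \<open>The reason for the almost sure convergence: the end points of each cell depend continuously on
  the tree, and only countably many numbers are end points.\<close>

lemma AE_eventually_in_cell:
  assumes "\<And>n. mass_tree (\<Lambda> n)" "mass_tree \<Lambda>0" and lim: "\<And>w. (\<lambda>n. \<Lambda> n w) \<longlonglongrightarrow> \<Lambda>0 w"
  shows "AE t in unit_lebesgue. \<forall>w. t \<in> cell \<Lambda>0 w \<longrightarrow> (\<forall>\<^sub>F n in sequentially. t \<in> cell (\<Lambda> n) w)"
proof -
  have "AE t in lborel. \<forall>w\<in>{w. \<Lambda>0 w \<noteq> 0}. t \<noteq> left_end \<Lambda>0 w"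
    using countable_mass_tree_support[OF assms(2)] AE_lborel_singleton by (subst AE_ball_countable) auto
  then have "AE t in lborel. \<forall>w. t \<in> cell \<Lambda>0 w \<longrightarrow> (\<forall>\<^sub>F n in sequentially. t \<in> cell (\<Lambda> n) w)"
  proof eventually_elim
    case (elim t)
    show ?case
    proof (intro allI impI)
      fix w assume t: "t \<in> cell \<Lambda>0 w"
      then have "left_end \<Lambda>0 w < t" "t < left_end \<Lambda>0 w + \<Lambda>0 w"
        using elim cell_nonempty_imp[OF assms(2) t] by (auto simp: cell_def less_le)
      moreover have "(\<lambda>n. left_end (\<Lambda> n) w) \<longlonglongrightarrow> left_end \<Lambda>0 w" by (rule left_end_tendsto[OF assms])
      moreover have "(\<lambda>n. left_end (\<Lambda> n) w + \<Lambda> n w) \<longlonglongrightarrow> left_end \<Lambda>0 w + \<Lambda>0 w"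
        by (intro tendsto_add left_end_tendsto[OF assms] lim)
      ultimately have "\<forall>\<^sub>F n in sequentially. left_end (\<Lambda> n) w < t" "\<forall>\<^sub>F n in sequentially. t < left_end (\<Lambda> n) w + \<Lambda> n w"
        by (metis order_tendstoD(2), metis order_tendstoD(1))
      then show "\<forall>\<^sub>F n in sequentially. t \<in> cell (\<Lambda> n) w"
        by eventually_elim (simp add: cell_def)
    qed
  qed
  then show ?thesis by (auto simp: AE_unit_lebesgue_iff)
qed

end

section \<open>Integrals of continuous functions in the limit\<close>

lemma count_thresholds_below:
  fixes x :: real
  assumes "0 \<le> x"
  shows "(x \<le> real N \<and> (\<Sum>i<N. of_bool (real (Suc i) < x)) \<le> x \<and> x \<le> (\<Sum>i<N. of_bool (real (Suc i) < x)) + 1)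
    \<or> (real N < x \<and> (\<Sum>i<N. of_bool (real (Suc i) < x)) = real N)"
  using assms by (induction N) (auto simp: of_bool_def)

lemma staircase_bounds:
  fixes y :: real
  assumes "0 \<le> y" "y \<le> 1" "N > 0"
  defines "S \<equiv> (\<Sum>i<N. of_bool (real (Suc i) / N < y) :: real) / N"
  shows "S \<le> y" "y \<le> S + 1 / N"
proof -
  have "y * N \<le> N" using assms by (simp add: mult_left_le_one_le)
  then have "(\<Sum>i<N. of_bool (real (Suc i) < y * N) :: real) \<le> y * N \<and>
      y * N \<le> (\<Sum>i<N. of_bool (real (Suc i) < y * N)) + 1"
    using count_thresholds_below[of "y * N" N] assms(1) by auto
  moreover have "real (Suc i) < y * N \<longleftrightarrow> real (Suc i) / N < y" for i
    using assms by (simp add: pos_divide_less_eq)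
  ultimately show "S \<le> y" "y \<le> S + 1 / N"
    unfolding S_def using assms by (auto simp: field_simps)
qed

text \<open>The portmanteau implication from open sets to functions: \<open>g\<close> is uniformly approximated by averages
  of indicators of the open sets \<open>{z. i / N < g z}\<close>, which gives the lower bound, and the same
  bound for \<open>1 - g\<close> is the upper bound for \<open>g\<close>.\<close>

lemma integral_tendsto_of_open_sets:
  fixes g :: "'a \<Rightarrow> real"
  assumes nu: "\<And>n. prob_space (\<nu> n)" "\<And>n. sets (\<nu> n) = sets (borel_of X)"
    and nu0: "prob_space \<nu>0" "sets \<nu>0 = sets (borel_of X)"
    and op: "\<And>U a. openin X U \<Longrightarrow> a < measure \<nu>0 U \<Longrightarrow> \<forall>\<^sub>F n in sequentially. a < measure (\<nu> n) U"
    and g: "continuous_map X euclideanreal g" "\<And>z. z \<in> topspace X \<Longrightarrow> 0 \<le> g z" "\<And>z. z \<in> topspace X \<Longrightarrow> g z \<le> 1"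
  shows "(\<lambda>n. \<integral>z. g z \<partial>\<nu> n) \<longlonglongrightarrow> (\<integral>z. g z \<partial>\<nu>0)"
proof -
  have int: "integrable \<mu> h"
    if "prob_space \<mu>" "sets \<mu> = sets (borel_of X)" "continuous_map X euclideanreal h"
      "\<And>z. z \<in> topspace X \<Longrightarrow> 0 \<le> h z \<and> h z \<le> 1" for \<mu> and h :: "'a \<Rightarrow> real"
  proof -
    interpret prob_space \<mu> by fact
    have "space \<mu> = topspace X" using sets_eq_imp_space_eq[OF that(2)] by simp
    then show ?thesis
      using that(4) measurable_cong_sets[OF that(2) refl] continuous_map_borel_measurable[OF that(3)]
      by (intro integrable_const_bound[where B = 1]) auto
  qed
  \<comment> \<open>lower semicontinuity, stated for every h in order to apply it to g and to 1 - g\<close>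
  have low: "\<forall>\<^sub>F n in sequentially. (\<integral>z. h z \<partial>\<nu>0) - e < (\<integral>z. h z \<partial>\<nu> n)"
    if h: "continuous_map X euclideanreal h" "\<And>z. z \<in> topspace X \<Longrightarrow> 0 \<le> h z \<and> h z \<le> 1" and e: "e > 0"
    for h :: "'a \<Rightarrow> real" and e
  proof -
    obtain N :: nat where N: "N > 0" "1 / N < e / 2"
      using e by (metis half_gt_zero nat_approx_posE of_nat_0_less_iff of_nat_Suc zero_less_Suc)
    define U where "U i = {z \<in> topspace X. real (Suc i) / N < h z}" for i
    have U: "openin X (U i)" for i
      using h(1) openin_continuous_map_preimage[of X euclideanreal h "{real (Suc i) / N<..}"] by (simp add: U_def)
    have bounds: "(\<Sum>i<N. measure \<mu> (U i)) / N \<le> (\<integral>z. h z \<partial>\<mu>) \<and>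
        (\<integral>z. h z \<partial>\<mu>) \<le> (\<Sum>i<N. measure \<mu> (U i)) / N + 1 / N"
      if mu: "prob_space \<mu>" "sets \<mu> = sets (borel_of X)" for \<mu>
    proof -
      interpret prob_space \<mu> by fact
      have sp: "space \<mu> = topspace X" using sets_eq_imp_space_eq[OF mu(2)] by simp
      have Us: "U i \<in> sets \<mu>" for i using U openin_borel_of mu(2) by blast
      define s where "s z = (\<Sum>i<N. indicator (U i) z :: real) / N" for z
      have s: "s z = (\<Sum>i<N. of_bool (real (Suc i) / N < h z) :: real) / N" if "z \<in> topspace X" for z
        unfolding s_def U_def using that by (simp add: indicator_def)
      have si: "integrable \<mu> s" unfolding s_def using Us by (auto simp: emeasure_eq_measure intro!: integrable_real_indicator)
      have hi: "integrable \<mu> h" by (rule int[OF mu h])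
      have sint: "(\<integral>z. s z \<partial>\<mu>) = (\<Sum>i<N. measure \<mu> (U i)) / N"
        unfolding s_def using Us by (simp add: Bochner_Integration.integral_sum emeasure_eq_measure)
      have "(\<integral>z. s z \<partial>\<mu>) \<le> (\<integral>z. h z \<partial>\<mu>)"
        using staircase_bounds(1)[of "h _" N] h(2) N(1) sp s by (intro integral_mono si hi) auto
      moreover have "(\<integral>z. h z \<partial>\<mu>) \<le> (\<integral>z. s z + 1 / N \<partial>\<mu>)"
        using staircase_bounds(2)[of "h _" N] h(2) N(1) sp s by (intro integral_mono hi) (auto intro: si)
      moreover have "(\<integral>z. s z + 1 / N \<partial>\<mu>) = (\<integral>z. s z \<partial>\<mu>) + 1 / N"
        using si by (simp add: prob_space)
      ultimately show ?thesis unfolding sint by simp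
    qed
    have "\<forall>\<^sub>F n in sequentially. \<forall>i\<in>{..<N}. measure \<nu>0 (U i) - e / 2 < measure (\<nu> n) (U i)"
      using e by (intro eventually_ball_finite ballI op U) auto
    then show ?thesis
    proof eventually_elim
      case (elim n)
      have "(\<Sum>i<N. measure \<nu>0 (U i) - e / 2) \<le> (\<Sum>i<N. measure (\<nu> n) (U i))"
        using elim by (intro sum_mono less_imp_le) auto
      then have "((\<Sum>i<N. measure \<nu>0 (U i)) - N * (e / 2)) / N \<le> (\<Sum>i<N. measure (\<nu> n) (U i)) / N"
        by (intro divide_right_mono) (auto simp: sum_subtractf)
      then have "(\<Sum>i<N. measure \<nu>0 (U i)) / N - e / 2 \<le> (\<Sum>i<N. measure (\<nu> n) (U i)) / N"
        using N(1) by (simp add: diff_divide_distrib)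
      then show ?case using bounds[OF nu0] bounds[OF nu, of n] N(2) by linarith
    qed
  qed
  have g': "continuous_map X euclideanreal (\<lambda>z. 1 - g z)" by (intro continuous_intros g)
  have flip: "(\<integral>z. 1 - g z \<partial>\<mu>) = 1 - (\<integral>z. g z \<partial>\<mu>)"
    if "prob_space \<mu>" "sets \<mu> = sets (borel_of X)" for \<mu>
  proof -
    interpret prob_space \<mu> by fact
    show ?thesis using int[OF that g(1)] g(2,3) by (simp add: prob_space)
  qed
  show ?thesis
  proof (rule LIMSEQ_I)
    fix e :: real assume e: "e > 0"
    have "\<forall>\<^sub>F n in sequentially. (\<integral>z. g z \<partial>\<nu>0) - e < (\<integral>z. g z \<partial>\<nu> n)"
      by (rule low) (use g e in auto)
    moreover have "\<forall>\<^sub>F n in sequentially. (\<integral>z. 1 - g z \<partial>\<nu>0) - e < (\<integral>z. 1 - g z \<partial>\<nu> n)"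
      by (rule low) (use g g' e in auto)
    ultimately have "\<forall>\<^sub>F n in sequentially. norm ((\<integral>z. g z \<partial>\<nu> n) - (\<integral>z. g z \<partial>\<nu>0)) < e"
      by eventually_elim (auto simp: flip[OF nu0] flip[OF nu] abs_less_iff)
    then show "\<exists>no. \<forall>n\<ge>no. norm ((\<integral>z. g z \<partial>\<nu> n) - (\<integral>z. g z \<partial>\<nu>0)) < e"
      unfolding eventually_sequentially .
  qed
qed

section \<open>A partition of unity from a well-ordering of the points\<close>

lemma has_sum_nonnegI:
  fixes f :: "'a \<Rightarrow> real"
  assumes nn: "\<And>a. a \<in> A \<Longrightarrow> 0 \<le> f a" and le: "\<And>F. finite F \<Longrightarrow> F \<subseteq> A \<Longrightarrow> sum f F \<le> S"
    and ge: "\<And>e. e > 0 \<Longrightarrow> \<exists>F. finite F \<and> F \<subseteq> A \<and> S - e \<le> sum f F"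
  shows "(f has_sum S) A"
proof -
  have sm: "f summable_on A"
    by (rule nonneg_bdd_above_summable_on) (use nn le in \<open>auto intro!: bdd_aboveI\<close>)
  have "infsum f A \<le> S" by (rule infsum_le_finite_sums[OF sm]) (use le in auto)
  moreover have "S \<le> infsum f A"
  proof (rule field_le_epsilon)
    fix e :: real assume "e > 0"
    then obtain F where F: "finite F" "F \<subseteq> A" "S - e \<le> sum f F" using ge by blast
    have "sum f F \<le> infsum f A" using nn by (intro finite_sum_le_infsum sm F) auto
    then show "S \<le> infsum f A + e" using F by simp
  qed
  ultimately show ?thesis using sm by (simp add: has_sum_iff)
qed

locale metric_coding = Metric_space M d + alphabet_well_order prec
  for M :: "'a set" and d and prec :: "'a \<Rightarrow> 'a \<Rightarrow> bool" (infix "\<sqsubset>" 50)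
begin

abbreviation radius :: "nat \<Rightarrow> real" where
  "radius j \<equiv> (1 / 2) ^ j"

text \<open>The supremum of the tent functions \<open>max 0 (radius j - d b z)\<close> with \<open>b \<in> B\<close>. It is Lipschitz with
  constant 1 however large \<open>B\<close> is; this uniformity is what replaces local finiteness.\<close>

definition height :: "nat \<Rightarrow> 'a set \<Rightarrow> 'a \<Rightarrow> real" where
  "height j B z = Sup (insert 0 ((\<lambda>b. radius j - d b z) ` (B \<inter> M)))"

lemma height_bdd: "bdd_above (insert 0 ((\<lambda>b. radius j - d b z) ` (B \<inter> M)))"
  by (rule bdd_aboveI[of _ "radius j"]) auto

lemma height_nonneg: "0 \<le> height j B z"
  unfolding height_def by (intro cSup_upper height_bdd) auto

lemma height_upper: "b \<in> B \<Longrightarrow> b \<in> M \<Longrightarrow> radius j - d b z \<le> height j B z"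
  unfolding height_def by (intro cSup_upper height_bdd) auto

lemma height_least: "(\<And>b. b \<in> B \<Longrightarrow> b \<in> M \<Longrightarrow> radius j - d b z \<le> c) \<Longrightarrow> 0 \<le> c \<Longrightarrow> height j B z \<le> c"
  unfolding height_def by (intro cSup_least) auto

lemma height_mono: "B \<subseteq> C \<Longrightarrow> height j B z \<le> height j C z"
  by (intro height_least height_upper height_nonneg) auto

lemma height_UNIV: "z \<in> M \<Longrightarrow> height j UNIV z = radius j"
  using height_upper[of z UNIV j z] height_least[of UNIV j z "radius j"] by (auto intro: antisym)

lemma height_insert: "a \<in> M \<Longrightarrow> height j (insert a B) z = max (height j B z) (radius j - d a z)"
proof (rule antisym)
  assume "a \<in> M"
  then show "height j (insert a B) z \<le> max (height j B z) (radius j - d a z)"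
    by (intro height_least) (auto intro: height_upper height_nonneg simp: le_max_iff_disj)
  show "max (height j B z) (radius j - d a z) \<le> height j (insert a B) z"
    using height_mono[of B "insert a B" j z] height_upper[of a "insert a B" j z] \<open>a \<in> M\<close> by auto
qed

lemma height_insert_outside: "a \<notin> M \<Longrightarrow> height j (insert a B) z = height j B z"
  unfolding height_def by simp

lemma height_lipschitz: "z \<in> M \<Longrightarrow> z' \<in> M \<Longrightarrow> height j B z \<le> height j B z' + d z z'"
proof (rule height_least)
  fix b assume "z \<in> M" "z' \<in> M" "b \<in> B" "b \<in> M"
  then show "radius j - d b z \<le> height j B z' + d z z'"
    using height_upper[of b B j z'] triangle[of b z z'] by simp
qed (use height_nonneg in auto)

lemma height_continuous: "continuous_map mtopology euclideanreal (height j B)"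
proof -
  have "continuous_map mtopology Met_TC.mtopology (height j B)"
    unfolding Met_TC.continuous_map_to_metric
  proof (intro ballI allI impI)
    fix z and e :: real assume "z \<in> topspace mtopology" "e > 0"
    then have z: "z \<in> M" by simp
    have "dist (height j B z) (height j B y) < e" if "y \<in> mball z e" for y
      using that height_lipschitz[of y z j B] height_lipschitz[of z y j B] commute[of y z]
      by (auto simp: dist_real_def)
    then show "\<exists>U. openin mtopology U \<and> z \<in> U \<and> (\<forall>y\<in>U. height j B y \<in> Met_TC.mball (height j B z) e)"
      using z \<open>e > 0\<close> by (intro exI[of _ "mball z e"]) auto
  qed
  then show ?thesis by simp
qed

text \<open>The weights are the normalized increments of the height as the points are added one after the
  other along the well-order. Equivalently, \<open>weight j a z\<close> is the probability that \<open>a\<close> is the first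
  point within distance \<open>s\<close> of \<open>z\<close> when \<open>s\<close> is uniform on the interval from 0 to \<open>radius j\<close>.\<close>

definition weight :: "nat \<Rightarrow> 'a \<Rightarrow> 'a \<Rightarrow> real" where
  "weight j a z = (height j (insert a {b. b \<sqsubset> a}) z - height j {b. b \<sqsubset> a} z) / radius j"

lemma weight_nonneg: "0 \<le> weight j a z"
  unfolding weight_def by (simp add: height_mono subset_insertI)

text \<open>The height increases only if the new tent at \<open>a\<close> exceeds 0 and all earlier ones.\<close>

lemma weight_pos: "0 < weight j a z \<Longrightarrow> a \<in> M \<and> d a z < radius j"
  using height_insert[of a j "{b. b \<sqsubset> a}" z] height_insert_outside[of a j "{b. b \<sqsubset> a}" z]
    height_nonneg[of j "{b. b \<sqsubset> a}" z]
  unfolding weight_def by (cases "a \<in> M") (auto simp: max_def zero_less_divide_iff split: if_splits)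

lemma weight_continuous: "continuous_map mtopology euclideanreal (weight j a)"
  unfolding weight_def by (intro continuous_intros height_continuous) auto

text \<open>Telescoping along the well-order. There are no jumps at limit stages, since the height of \<open>I\<close> is the
  supremum of the heights of the segments up to its elements.\<close>

lemma weight_has_sum_step:
  assumes init: "\<And>a b. b \<in> I \<Longrightarrow> a \<sqsubset> b \<Longrightarrow> a \<in> I"
    and sums: "\<And>b. b \<in> I \<Longrightarrow> ((\<lambda>a. weight j a z) has_sum height j {a. a \<sqsubset> b} z / radius j) {a. a \<sqsubset> b}"
  shows "((\<lambda>a. weight j a z) has_sum height j I z / radius j) I"
proof -
  let ?f = "\<lambda>a. weight j a z"
  have ins: "(?f has_sum height j (insert b {a. a \<sqsubset> b}) z / radius j) (insert b {a. a \<sqsubset> b})" if "b \<in> I" for b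
  proof -
    have "(?f has_sum ?f b + height j {a. a \<sqsubset> b} z / radius j) ({b} \<union> {a. a \<sqsubset> b})"
      using prec_irrefl by (intro has_sum_Un_disjoint sums that) (auto intro: has_sum_finiteI)
    then show ?thesis by (simp add: weight_def diff_divide_distrib)
  qed
  have sub: "insert b {a. a \<sqsubset> b} \<subseteq> I" if "b \<in> I" for b using that init by auto
  have fin: "sum ?f F \<le> height j I z / radius j" if F: "finite F" "F \<subseteq> I" for F
  proof (cases "F = {}")
    case False
    \<comment> \<open>the largest element of F; the part of the segment up to it is covered by the hypothesis\<close>
    have "\<exists>b\<in>F. F \<subseteq> insert b {a. a \<sqsubset> b}"
      using F(1) False
    proof (induction rule: finite_ne_induct)
      case (insert x F)
      then obtain b where b: "b \<in> F" "F \<subseteq> insert b {a. a \<sqsubset> b}" by blast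
      show ?case
      proof (cases "b \<sqsubset> x")
        case True
        then have "F \<subseteq> {a. a \<sqsubset> x}" using b(2) prec_trans[of _ b x] by auto
        then show ?thesis by blast
      next
        case False
        then have "x \<in> insert b {a. a \<sqsubset> b}" using prec_total[of x b] by auto
        then show ?thesis using b by auto
      qed
    qed auto
    then obtain b where b: "b \<in> F" "F \<subseteq> insert b {a. a \<sqsubset> b}" by blast
    have "b \<in> I" using b F by auto
    have "sum ?f F \<le> height j (insert b {a. a \<sqsubset> b}) z / radius j"
      using ins[OF \<open>b \<in> I\<close>] F(1) b(2) weight_nonneg by (intro finite_sum_le_has_sum) auto
    also have "\<dots> \<le> height j I z / radius j"
      by (intro divide_right_mono height_mono sub[OF \<open>b \<in> I\<close>]) auto
    finally show ?thesis .
  qed (simp add: height_nonneg)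
  have sm: "?f summable_on I"
    by (rule nonneg_bdd_above_summable_on) (use fin weight_nonneg in \<open>auto intro!: bdd_aboveI\<close>)
  have "infsum ?f I \<le> height j I z / radius j" by (rule infsum_le_finite_sums[OF sm]) (use fin in auto)
  moreover have "height j I z \<le> radius j * infsum ?f I"
  proof (rule height_least)
    fix b assume b: "b \<in> I" "b \<in> M"
    have "radius j - d b z \<le> height j (insert b {a. a \<sqsubset> b}) z" using b by (intro height_upper) auto
    also have "\<dots> = radius j * infsum ?f (insert b {a. a \<sqsubset> b})"
      using infsumI[OF ins[OF b(1)]] by simp
    also have "\<dots> \<le> radius j * infsum ?f I"
      using sub[OF b(1)] weight_nonneg has_sum_imp_summable[OF ins[OF b(1)]]
      by (intro mult_left_mono infsum_mono2 sm) auto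
    finally show "radius j - d b z \<le> radius j * infsum ?f I" .
  next
    show "0 \<le> radius j * infsum ?f I" by (intro mult_nonneg_nonneg infsum_nonneg weight_nonneg) auto
  qed
  then have "height j I z / radius j \<le> infsum ?f I" by (simp add: field_simps)
  ultimately have "infsum ?f I = height j I z / radius j" by simp
  then show ?thesis using sm by (simp add: has_sum_iff)
qed

lemma weight_has_sum: "z \<in> M \<Longrightarrow> ((\<lambda>a. weight j a z) has_sum 1) UNIV"
proof -
  assume z: "z \<in> M"
  have below: "((\<lambda>a. weight j a z) has_sum height j {a. a \<sqsubset> b} z / radius j) {a. a \<sqsubset> b}" for b
  proof (induction b rule: wfp_induct_rule[OF wf_prec])
    case (1 b)
    show ?case by (rule weight_has_sum_step) (use 1 prec_trans in auto)
  qed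
  have "((\<lambda>a. weight j a z) has_sum height j UNIV z / radius j) UNIV"
    by (rule weight_has_sum_step) (rule UNIV_I below)+
  then show ?thesis by (simp add: height_UNIV[OF z])
qed

text \<open>Dini's argument: the finite partial sums are continuous and increase to 1 pointwise. The same
  finite set of letters serves every measure that is concentrated near \<open>K\<close>; therefore mass cannot
  escape along a uniformly tight sequence.\<close>

lemma weight_sum_near_one_on_compact:
  assumes K: "compactin mtopology K" and e: "e > 0"
  shows "\<exists>F. finite F \<and> (\<forall>z\<in>K. 1 - e \<le> (\<Sum>a\<in>F. weight j a z))"
proof -
  have KM: "K \<subseteq> M" using K compactin_subset_topspace by fastforce
  have "\<exists>F. finite F \<and> 1 - e < (\<Sum>a\<in>F. weight j a z)" if z: "z \<in> M" for z
  proof -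
    obtain F where "finite F" "dist (\<Sum>a\<in>F. weight j a z) 1 \<le> e / 2"
      using has_sum_finite_approximation[OF weight_has_sum[OF z, where j = j], of "e / 2"] e by auto
    then show ?thesis using e by (intro exI[of _ F]) (auto simp: dist_real_def abs_if split: if_splits)
  qed
  then obtain F where F: "\<And>z. z \<in> M \<Longrightarrow> finite (F z)" "\<And>z. z \<in> M \<Longrightarrow> 1 - e < (\<Sum>a\<in>F z. weight j a z)"
    by metis
  define U where "U y = {z \<in> M. 1 - e < (\<Sum>a\<in>F y. weight j a z)}" for y
  have U: "openin mtopology (U y)" if "y \<in> M" for y
  proof -
    have "continuous_map mtopology euclideanreal (\<lambda>z. \<Sum>a\<in>F y. weight j a z)"
      using F(1)[OF that] by (intro continuous_map_sum weight_continuous) auto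
    from openin_continuous_map_preimage[OF this, of "{1 - e<..}"] show ?thesis by (simp add: U_def)
  qed
  have "K \<subseteq> \<Union>(U ` K)" using KM F(2) by (auto simp: U_def)
  then obtain \<F> where \<F>: "finite \<F>" "\<F> \<subseteq> U ` K" "K \<subseteq> \<Union>\<F>"
    using compactinD[OF K, of "U ` K"] U KM by auto
  obtain Y where Y: "finite Y" "Y \<subseteq> K" "\<F> = U ` Y" using finite_subset_image[OF \<F>(1,2)] by auto
  show ?thesis
  proof (intro exI conjI ballI)
    show fin: "finite (\<Union>y\<in>Y. F y)" using Y F(1) KM by auto
    fix z assume "z \<in> K"
    then obtain y where y: "y \<in> Y" "z \<in> U y" using \<F>(3) Y(3) by auto
    have "1 - e \<le> (\<Sum>a\<in>F y. weight j a z)" using y(2) by (simp add: U_def)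
    also have "\<dots> \<le> (\<Sum>a\<in>(\<Union>y\<in>Y. F y). weight j a z)"
      using fin y(1) by (intro sum_mono2) (auto intro: weight_nonneg)
    finally show "1 - e \<le> (\<Sum>a\<in>(\<Union>y\<in>Y. F y). weight j a z)" .
  qed
qed

end

section \<open>Coding a tight measure by a mass tree\<close>

context metric_coding
begin

text \<open>The partition of unity indexed by the words of length \<open>k\<close>: letters are drawn independently for a
  given point, the letter at position \<open>j\<close> from the partition at scale \<open>radius j\<close>. A point with positive
  weight for a word lies in the balls around all its letters.\<close>

primrec word_weight :: "'a list \<Rightarrow> 'a \<Rightarrow> real" where
  "word_weight [] z = 1"
| "word_weight (a # w) z = word_weight w z * weight (length w) a z"

lemma weight_le_1: "z \<in> M \<Longrightarrow> weight j a z \<le> 1"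
  using finite_sum_le_has_sum[OF weight_has_sum[of z j], of "{a}"] weight_nonneg by auto

lemma word_weight_nonneg: "0 \<le> word_weight w z"
  by (induction w) (auto simp: weight_nonneg)

lemma word_weight_le_1: "z \<in> M \<Longrightarrow> word_weight w z \<le> 1"
  by (induction w) (auto intro!: mult_le_one simp: weight_nonneg weight_le_1)

lemma word_weight_continuous: "continuous_map mtopology euclideanreal (word_weight w)"
proof (induction w)
  case Nil
  have "word_weight [] = (\<lambda>z. 1)" by (simp add: fun_eq_iff)
  then show ?case by simp
next
  case (Cons a w)
  have "word_weight (a # w) = (\<lambda>z. word_weight w z * weight (length w) a z)" by (simp add: fun_eq_iff)
  then show ?case using continuous_map_real_mult[OF Cons weight_continuous] by simp
qed

lemma word_weight_pos:
  assumes "word_weight (u @ a # w) z \<noteq> 0"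
  shows "a \<in> M \<and> d a z < radius (length w)"
proof -
  have "word_weight (a # w) z \<noteq> 0" using assms by (induction u) auto
  then have "0 < weight (length w) a z" using weight_nonneg[of "length w" a z] by (auto simp: less_le)
  then show ?thesis by (rule weight_pos)
qed

lemma word_weight_has_sum:
  "z \<in> M \<Longrightarrow> ((\<lambda>a. word_weight (a # w) z) has_sum word_weight w z) UNIV"
  using has_sum_cmult_right[OF weight_has_sum[of z "length w"], of "word_weight w z"] by simp

text \<open>For finite \<open>F\<close> only, by enlarging \<open>F\<close> to a product of sets of prefixes and letters; this
  avoids infinite sums over words.\<close>

lemma word_weight_sum_le_1:
  assumes "finite F" "\<And>w. w \<in> F \<Longrightarrow> length w = k" "z \<in> M"
  shows "(\<Sum>w\<in>F. word_weight w z) \<le> 1"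
  using assms(1,2)
proof (induction k arbitrary: F)
  case 0
  then have "F \<subseteq> {[]}" by auto
  then have "(\<Sum>w\<in>F. word_weight w z) \<le> (\<Sum>w\<in>{[]}. word_weight w z)"
    by (intro sum_mono2) (auto simp: word_weight_nonneg)
  then show ?case by simp
next
  case (Suc k)
  have "F \<subseteq> (\<lambda>(w, a). a # w) ` (tl ` F \<times> hd ` F)"
  proof
    fix v assume v: "v \<in> F"
    then have "v = hd v # tl v" using Suc.prems(2)[OF v] by (cases v) auto
    then show "v \<in> (\<lambda>(w, a). a # w) ` (tl ` F \<times> hd ` F)" using v by force
  qed
  then have "(\<Sum>w\<in>F. word_weight w z) \<le> (\<Sum>v\<in>(\<lambda>(w, a). a # w) ` (tl ` F \<times> hd ` F). word_weight v z)"
    using Suc.prems(1) by (intro sum_mono2) (auto simp: word_weight_nonneg)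
  also have "\<dots> = (\<Sum>(w, a)\<in>tl ` F \<times> hd ` F. word_weight (a # w) z)"
    by (subst sum.reindex) (auto simp: inj_on_def split_def)
  also have "\<dots> = (\<Sum>w\<in>tl ` F. \<Sum>a\<in>hd ` F. word_weight (a # w) z)"
    by (simp add: sum.cartesian_product)
  also have "\<dots> \<le> (\<Sum>w\<in>tl ` F. word_weight w z)"
    using Suc.prems(1) assms(3) word_weight_nonneg
    by (intro sum_mono finite_sum_le_has_sum[OF word_weight_has_sum]) (auto simp del: word_weight.simps)
  also have "\<dots> \<le> 1" using Suc.prems by (intro Suc.IH) auto
  finally show ?case .
qed

text \<open>The law of the random word of a point that is distributed according to \<open>\<nu>\<close>. As an integral
  of a continuous function it depends continuously on \<open>\<nu>\<close>.\<close>

definition mass :: "'a measure \<Rightarrow> 'a list \<Rightarrow> real" where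
  "mass \<nu> w = (\<integral>z. word_weight w z \<partial>\<nu>)"

context
  fixes \<nu> :: "'a measure"
  assumes prob: "prob_space \<nu>" and sets_nu: "sets \<nu> = sets (borel_of mtopology)"
begin

interpretation prob_space \<nu> by (rule prob)

lemma space_nu: "space \<nu> = M"
  using sets_eq_imp_space_eq[OF sets_nu] by simp

lemma integrable_word_weight: "integrable \<nu> (word_weight w)"
proof -
  have "word_weight w \<in> borel_measurable \<nu>"
    using continuous_map_borel_measurable[OF word_weight_continuous] measurable_cong_sets[OF sets_nu refl] by blast
  then show ?thesis
    using word_weight_nonneg word_weight_le_1 space_nu
    by (intro integrable_const_bound[where B = 1]) auto
qed

lemma compactin_sets_nu: "compactin mtopology K \<Longrightarrow> K \<in> sets \<nu>"
  using compactin_borel_of[OF Hausdorff_space_mtopology] sets_nu by simp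

lemma mass_Nil: "mass \<nu> [] = 1"
  by (simp add: mass_def prob_space)

lemma mass_nonneg: "0 \<le> mass \<nu> w"
  unfolding mass_def by (intro Bochner_Integration.integral_nonneg word_weight_nonneg)

lemma mass_le_1: "mass \<nu> w \<le> 1"
proof -
  have "mass \<nu> w \<le> (\<integral>z. 1 \<partial>\<nu>)"
    unfolding mass_def using word_weight_le_1 space_nu by (intro integral_mono integrable_word_weight) auto
  then show ?thesis by (simp add: prob_space)
qed

lemma mass_children_le:
  assumes "finite F"
  shows "(\<Sum>a\<in>F. mass \<nu> (a # w)) \<le> mass \<nu> w"
proof -
  have "(\<Sum>a\<in>F. mass \<nu> (a # w)) = (\<integral>z. (\<Sum>a\<in>F. word_weight (a # w) z) \<partial>\<nu>)"
    unfolding mass_def by (intro Bochner_Integration.integral_sum[symmetric] integrable_word_weight)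
  also have "\<dots> \<le> mass \<nu> w"
    unfolding mass_def using assms space_nu word_weight_nonneg
    by (intro integral_mono integrable_word_weight Bochner_Integration.integrable_sum
        finite_sum_le_has_sum[OF word_weight_has_sum]) (auto simp del: word_weight.simps)
  finally show ?thesis .
qed

lemma mass_children_ge:
  assumes F: "finite F" and K: "compactin mtopology K" and e: "0 \<le> e"
    and near: "\<And>z. z \<in> K \<Longrightarrow> 1 - e \<le> (\<Sum>a\<in>F. weight (length w) a z)"
  shows "mass \<nu> w - e - measure \<nu> (M - K) \<le> (\<Sum>a\<in>F. mass \<nu> (a # w))"
proof -
  have Ks: "M - K \<in> sets \<nu>" using compactin_sets_nu[OF K] sets.compl_sets[of K \<nu>] space_nu by simp
  have iK: "integrable \<nu> (indicator (M - K) :: 'a \<Rightarrow> real)"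
    using Ks by (intro integrable_real_indicator) (auto simp: emeasure_eq_measure)
  have pt: "word_weight w z - e - indicator (M - K) z \<le> (\<Sum>a\<in>F. word_weight (a # w) z)" if "z \<in> M" for z
  proof (cases "z \<in> K")
    case True
    have "word_weight w z * e \<le> e" using word_weight_le_1[OF that] word_weight_nonneg[of w z] e
      by (simp add: mult_left_le_one_le)
    then have "word_weight w z - e \<le> word_weight w z * (1 - e)" by (simp add: algebra_simps)
    also have "\<dots> \<le> word_weight w z * (\<Sum>a\<in>F. weight (length w) a z)"
      using near[OF True] word_weight_nonneg by (intro mult_left_mono) auto
    also have "\<dots> = (\<Sum>a\<in>F. word_weight (a # w) z)" by (simp add: sum_distrib_left)
    finally show ?thesis using True by simp
  next
    case False
    have "0 \<le> (\<Sum>a\<in>F. word_weight (a # w) z)" by (intro sum_nonneg word_weight_nonneg)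
    moreover have "word_weight w z \<le> 1" by (rule word_weight_le_1[OF that])
    ultimately show ?thesis using False that e by (simp del: word_weight.simps)
  qed
  have "mass \<nu> w - e - measure \<nu> (M - K) = (\<integral>z. word_weight w z - e - indicator (M - K) z \<partial>\<nu>)"
    unfolding mass_def using integrable_word_weight[of w] iK Ks by (simp add: prob_space)
  also have "\<dots> \<le> (\<integral>z. (\<Sum>a\<in>F. word_weight (a # w) z) \<partial>\<nu>)"
    using pt space_nu
    by (intro integral_mono Bochner_Integration.integrable_diff integrable_word_weight iK
        Bochner_Integration.integrable_sum) auto
  also have "\<dots> = (\<Sum>a\<in>F. mass \<nu> (a # w))"
    unfolding mass_def by (intro Bochner_Integration.integral_sum integrable_word_weight)
  finally show ?thesis .
qed

lemma mass_words_off_compact: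
  assumes K: "compactin mtopology K" and F: "finite F" "\<And>w. w \<in> F \<Longrightarrow> length w = k"
    and zero: "\<And>w z. w \<in> F \<Longrightarrow> z \<in> K \<Longrightarrow> word_weight w z = 0"
  shows "sum (mass \<nu>) F \<le> measure \<nu> (M - K)"
proof -
  have Ks: "M - K \<in> sets \<nu>" using compactin_sets_nu[OF K] sets.compl_sets[of K \<nu>] space_nu by simp
  have iK: "integrable \<nu> (indicator (M - K) :: 'a \<Rightarrow> real)"
    using Ks by (intro integrable_real_indicator) (auto simp: emeasure_eq_measure)
  have "sum (mass \<nu>) F = (\<integral>z. (\<Sum>w\<in>F. word_weight w z) \<partial>\<nu>)"
    unfolding mass_def by (intro Bochner_Integration.integral_sum[symmetric] integrable_word_weight)
  also have "\<dots> \<le> (\<integral>z. indicator (M - K) z \<partial>\<nu>)"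
  proof (intro integral_mono Bochner_Integration.integrable_sum integrable_word_weight iK)
    fix z assume "z \<in> space \<nu>"
    then show "(\<Sum>w\<in>F. word_weight w z) \<le> indicator (M - K) z"
      using word_weight_sum_le_1[OF F] zero space_nu by (cases "z \<in> K") auto
  qed
  also have "\<dots> = measure \<nu> (M - K)" using Ks by simp
  finally show ?thesis .
qed

lemma mass_nonzero_imp_letters: "mass \<nu> (a # w) \<noteq> 0 \<Longrightarrow> a \<in> M"
proof (rule ccontr)
  assume "a \<notin> M"
  then have zero: "word_weight (a # w) = (\<lambda>z. 0)"
    using word_weight_pos[of "[]" a w] by (intro ext) (metis append_Nil)
  assume "mass \<nu> (a # w) \<noteq> 0"
  then show False unfolding mass_def zero by simp
qed

end

text \<open>Uniform tightness keeps the mass of the limit: for a compact set that carries all but a small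
  part of every measure, a single finite set of letters carries almost all of the mass, and
  finite sums pass to the limit. The constant sequence shows that a tight measure yields a mass tree.\<close>

lemma mass_tree_limit:
  assumes nu: "\<And>n. prob_space (\<nu> n)" "\<And>n. sets (\<nu> n) = sets (borel_of mtopology)"
    and ut: "uniformly_tight mtopology (range \<nu>)"
    and lim: "\<And>w. (\<lambda>n::nat. mass (\<nu> n) w) \<longlonglongrightarrow> \<Lambda> w"
  shows "mass_tree \<Lambda>"
  unfolding mass_tree_def
proof (intro conjI allI)
  show "\<Lambda> [] = 1" using lim[of "[]"] mass_Nil[OF nu] by (simp add: LIMSEQ_const_iff)
  show nn: "0 \<le> \<Lambda> w" for w
    by (rule LIMSEQ_le_const[OF lim]) (use mass_nonneg[OF nu] in blast)
  fix w
  have slim: "(\<lambda>n. \<Sum>a\<in>F. mass (\<nu> n) (a # w)) \<longlonglongrightarrow> (\<Sum>a\<in>F. \<Lambda> (a # w))" for F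
    by (intro tendsto_sum lim)
  show "((\<lambda>a. \<Lambda> (a # w)) has_sum \<Lambda> w) UNIV"
  proof (rule has_sum_nonnegI)
    fix F :: "'a set" assume F: "finite F"
    show "(\<Sum>a\<in>F. \<Lambda> (a # w)) \<le> \<Lambda> w"
      by (rule LIMSEQ_le[OF slim lim]) (use mass_children_le[OF nu F] in blast)
  next
    fix e :: real assume "e > 0"
    then have e2: "e / 2 > 0" by simp
    then obtain K where K: "compactin mtopology K" "\<And>n. measure (\<nu> n) (M - K) < e / 2"
      using ut unfolding uniformly_tight_def by fastforce
    obtain F where F: "finite F" "\<And>z. z \<in> K \<Longrightarrow> 1 - e / 2 \<le> (\<Sum>a\<in>F. weight (length w) a z)"
      using weight_sum_near_one_on_compact[OF K(1) e2] by blast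
    have "mass (\<nu> n) w - e \<le> (\<Sum>a\<in>F. mass (\<nu> n) (a # w))" for n
      using mass_children_ge[OF nu F(1) K(1) less_imp_le[OF e2] F(2), of n] K(2)[of n] by linarith
    then have "\<Lambda> w - e \<le> (\<Sum>a\<in>F. \<Lambda> (a # w))"
      by (intro LIMSEQ_le[OF tendsto_diff[OF lim tendsto_const] slim]) blast
    then show "\<exists>F. finite F \<and> F \<subseteq> UNIV \<and> \<Lambda> w - e \<le> (\<Sum>a\<in>F. \<Lambda> (a # w))" using F(1) by blast
  qed (rule nn)
qed

lemma mass_tree_mass:
  assumes "\<nu> \<in> tight_probs mtopology"
  shows "mass_tree (mass \<nu>)"
proof (rule mass_tree_limit[where \<nu> = "\<lambda>n. \<nu>"])
  show "uniformly_tight mtopology (range (\<lambda>n. \<nu>))" using assms by (simp add: tight_probs_def)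
qed (use tight_probsD[OF assms] in auto)

abbreviation codes :: "'a measure \<Rightarrow> real \<Rightarrow> 'a \<Rightarrow> bool" where
  "codes \<nu> t x \<equiv> \<forall>a w. t \<in> cell (mass \<nu>) (a # w) \<longrightarrow> d a x \<le> radius (length w)"

context
  fixes \<nu> :: "'a measure"
  assumes tight: "\<nu> \<in> tight_probs mtopology"
begin

lemmas tree = mass_tree_mass[OF tight]
lemmas nuD = tight_probsD(1,2)[OF tight]

text \<open>The numbers whose word is incompatible with \<open>K\<close> from some level on. Their measure is at most the
  mass outside \<open>K\<close>, as the weights of such words vanish on \<open>K\<close>.\<close>

definition escape :: "'a set \<Rightarrow> real set" where
  "escape K = (\<Union>w\<in>{w. \<forall>z\<in>K. word_weight w z = 0}. cell (mass \<nu>) w)"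

lemma escape_sets_emeasure:
  assumes K: "compactin mtopology K"
  shows "escape K \<in> sets unit_lebesgue" "emeasure unit_lebesgue (escape K) \<le> ennreal (measure \<nu> (M - K))"
proof -
  let ?P = "{w. \<forall>z\<in>K. word_weight w z = 0}"
  have b: "sum (mass \<nu>) F \<le> measure \<nu> (M - K)"
    if "finite F" "F \<subseteq> ?P" "\<And>w. w \<in> F \<Longrightarrow> length w = k" for F k
    using mass_words_off_compact[OF nuD K that(1,3)] that(2) by auto
  have ext: "a # w \<in> ?P" if "w \<in> ?P" for a w
    using that by simp
  show "escape K \<in> sets unit_lebesgue"
    unfolding escape_def by (rule emeasure_cells_le(1)[OF tree ext b])
  show "emeasure unit_lebesgue (escape K) \<le> ennreal (measure \<nu> (M - K))"
    unfolding escape_def by (rule emeasure_cells_le(2)[OF tree ext b])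
qed

text \<open>Outside \<open>escape K\<close> every prefix is realized by a point of \<open>K\<close>, so the balls around the letters
  have a common point in \<open>K\<close>.\<close>

lemma coded_point_in_compact:
  assumes K: "compactin mtopology K" and lev: "\<And>k. \<exists>w. length w = k \<and> t \<in> cell (mass \<nu>) w"
    and t: "t \<notin> escape K"
  shows "\<exists>x\<in>K. codes \<nu> t x"
proof -
  obtain v where v: "\<And>k. length (v k) = k" "\<And>k. t \<in> cell (mass \<nu>) (v k)" using lev by metis
  define a where "a j = hd (v (Suc j))" for j
  have v_Suc: "v (Suc j) = a j # v j" for j
  proof -
    obtain u where "v (Suc j) = u @ v j"
      using cell_prefix[OF tree v(2)[of "Suc j"] v(2)[of j]] v(1) by auto
    moreover from this have "length u = 1" using v(1)[of "Suc j"] v(1)[of j] by simp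
    ultimately show ?thesis unfolding a_def by (auto simp: length_Suc_conv)
  qed
  have aM: "a j \<in> M" for j
  proof -
    have "mass \<nu> (a j # v j) \<noteq> 0" using cell_nonempty_imp[OF tree v(2)[of "Suc j"]] by (simp add: v_Suc)
    then show ?thesis by (rule mass_nonzero_imp_letters[OF nuD])
  qed
  have "\<exists>x\<in>K. \<forall>j::nat. d (a j) x \<le> radius j"
  proof (rule nested_balls_meet_compact[OF K aM])
    fix k
    obtain z where z: "z \<in> K" "word_weight (v k) z \<noteq> 0" using t v(2)[of k] unfolding escape_def by auto
    have "d (a j) z \<le> radius j" if jk: "j < k" for j
    proof -
      obtain u where "v k = u @ v (Suc j)"
        using cell_prefix[OF tree v(2)[of k] v(2)[of "Suc j"]] v(1) jk by auto
      then have "word_weight (u @ a j # v j) z \<noteq> 0" using z(2) v_Suc by simp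
      from word_weight_pos[OF this] v(1) show ?thesis by auto
    qed
    then show "\<exists>x\<in>K. \<forall>j<k. d (a j) x \<le> radius j" using z(1) by blast
  qed
  then obtain x where x: "x \<in> K" "\<And>j. d (a j) x \<le> radius j" by blast
  have "d b x \<le> radius (length w)" if "t \<in> cell (mass \<nu>) (b # w)" for b w
  proof -
    have "b # w = v (Suc (length w))" using cell_unique[OF tree that v(2)] v(1) by simp
    then show ?thesis using x(2)[of "length w"] v_Suc by simp
  qed
  then show ?thesis using x(1) by blast
qed

lemma measurable_code_exists:
  "\<exists>\<eta>\<in>measurable unit_lebesgue (borel_of mtopology).
    AE t in unit_lebesgue. codes \<nu> t (\<eta> t)"
proof -
  define I where "I = {v. v \<noteq> [] \<and> mass \<nu> v \<noteq> 0}"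
  have I: "countable I" unfolding I_def
    by (rule countable_subset[OF _ countable_mass_tree_support[OF tree]]) auto
  have hdM: "hd v \<in> M" if "v \<in> I" for v
    using that mass_nonzero_imp_letters[OF nuD] unfolding I_def by (cases v) auto
  have inI: "b # w \<in> I" if "t \<in> cell (mass \<nu>) (b # w)" for b w t
    using cell_nonempty_imp[OF tree that] unfolding I_def by simp
  interpret L: prob_space unit_lebesgue by (rule prob_space_unit_lebesgue)
  have ex: "AE t in unit_lebesgue. \<exists>x\<in>M. codes \<nu> t x"
  proof (rule AE_all_epsilonI)
    show "finite_measure unit_lebesgue" by unfold_locales
    fix e :: real assume "e > 0"
    then obtain K where K: "compactin mtopology K" "measure \<nu> (M - K) < e"
      using tight_probs_compact[OF tight] by (metis topspace_mtopology)
    let ?G = "space unit_lebesgue - escape K"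
    have esc: "escape K \<subseteq> space unit_lebesgue" by (rule sets.sets_into_space[OF escape_sets_emeasure(1)[OF K(1)]])
    have "measure unit_lebesgue (escape K) \<le> e"
      using escape_sets_emeasure(2)[OF K(1)] K(2) by (simp add: L.emeasure_eq_measure)
    moreover have "space unit_lebesgue - (?G) = escape K" using esc by blast
    moreover have "AE t in unit_lebesgue. t \<in> ?G \<longrightarrow>
        (\<exists>x\<in>M. codes \<nu> t x)"
      using AE_all_levels[OF tree]
    proof eventually_elim
      case (elim t)
      have "K \<subseteq> M" using K(1) compactin_subset_topspace by fastforce
      then show ?case using coded_point_in_compact[OF K(1), of t] elim by blast
    qed
    moreover have "?G \<in> sets unit_lebesgue"
      using escape_sets_emeasure(1)[OF K(1)] by (rule sets.compl_sets)
    ultimately show "\<exists>B\<in>sets unit_lebesgue. measure unit_lebesgue (space unit_lebesgue - B) \<le> e \<and>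
        (AE t in unit_lebesgue. t \<in> B \<longrightarrow> (\<exists>x\<in>M. codes \<nu> t x))"
      by (intro bexI[of _ ?G]) auto
  qed
  have "M \<noteq> {}" using prob_space.not_empty[OF nuD(1)] space_nu[OF nuD] by simp
  have "\<exists>\<eta>\<in>measurable unit_lebesgue (borel_of mtopology).
      AE t in unit_lebesgue. \<forall>v\<in>I. t \<in> cell (mass \<nu>) v \<longrightarrow> d (hd v) (\<eta> t) \<le> radius (length v - 1)"
  proof (rule measurable_coded_point[OF I])
    show "AE t in unit_lebesgue. (\<forall>\<epsilon>>0. \<exists>v\<in>I. t \<in> cell (mass \<nu>) v \<and> radius (length v - 1) < \<epsilon>) \<and>
        (\<exists>x\<in>M. \<forall>v\<in>I. t \<in> cell (mass \<nu>) v \<longrightarrow> d (hd v) x \<le> radius (length v - 1))"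
      using ex AE_all_levels[OF tree]
    proof eventually_elim
      case (elim t)
      have "\<exists>v\<in>I. t \<in> cell (mass \<nu>) v \<and> radius (length v - 1) < e" if "e > 0" for e :: real
      proof -
        obtain k where k: "(1/2)^k < e" using \<open>e > 0\<close> by (meson real_arch_pow_inv half_gt_zero_iff less_numeral_extra(1) one_less_numeral_iff semiring_norm(76) divide_less_eq_1_pos zero_less_numeral)
        obtain v where v: "length v = Suc k" "t \<in> cell (mass \<nu>) v" using elim(2) by blast
        then obtain b w where "v = b # w" by (cases v) auto
        then show ?thesis using inI v k by (intro bexI[of _ v]) auto
      qed
      moreover have "\<exists>x\<in>M. \<forall>v\<in>I. t \<in> cell (mass \<nu>) v \<longrightarrow> d (hd v) x \<le> radius (length v - 1)"
      proof -
        obtain x where x: "x \<in> M" "\<And>a w. t \<in> cell (mass \<nu>) (a # w) \<Longrightarrow> d a x \<le> radius (length w)"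
          using elim(1) by blast
        have "d (hd v) x \<le> radius (length v - 1)" if "v \<in> I" "t \<in> cell (mass \<nu>) v" for v
          using that x(2) unfolding I_def by (cases v) auto
        then show ?thesis using x(1) by blast
      qed
      ultimately show ?case by blast
    qed
  qed (use hdM cell_sets_unit[OF tree] \<open>M \<noteq> {}\<close> in auto)
  then obtain \<eta> where \<eta>: "\<eta> \<in> measurable unit_lebesgue (borel_of mtopology)"
    "AE t in unit_lebesgue. \<forall>v\<in>I. t \<in> cell (mass \<nu>) v \<longrightarrow> d (hd v) (\<eta> t) \<le> radius (length v - 1)" by blast
  have "AE t in unit_lebesgue. codes \<nu> t (\<eta> t)"
    using \<eta>(2)
  proof eventually_elim
    case (elim t)
    show ?case
    proof (intro allI impI)
      fix a w assume "t \<in> cell (mass \<nu>) (a # w)"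
      then show "d a (\<eta> t) \<le> radius (length w)" using elim inI by fastforce
    qed
  qed
  then show ?thesis using \<eta>(1) by blast
qed

end

text \<open>The point that the infinite word of \<open>t\<close> describes, for almost all \<open>t\<close>.\<close>

definition code :: "'a measure \<Rightarrow> real \<Rightarrow> 'a" where
  "code \<nu> = (SOME \<eta>. \<eta> \<in> measurable unit_lebesgue (borel_of mtopology) \<and>
    (AE t in unit_lebesgue. codes \<nu> t (\<eta> t)))"

lemma code:
  assumes "\<nu> \<in> tight_probs mtopology"
  shows measurable_code: "code \<nu> \<in> measurable unit_lebesgue (borel_of mtopology)"
    and AE_code: "AE t in unit_lebesgue. codes \<nu> t (code \<nu> t)"
proof -
  have ex: "\<exists>\<eta>. \<eta> \<in> measurable unit_lebesgue (borel_of mtopology) \<and>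
    (AE t in unit_lebesgue. codes \<nu> t (\<eta> t))"
    using measurable_code_exists[OF assms] by blast
  have "code \<nu> \<in> measurable unit_lebesgue (borel_of mtopology) \<and>
    (AE t in unit_lebesgue. codes \<nu> t (code \<nu> t))"
    unfolding code_def by (rule someI_ex[OF ex])
  then show "code \<nu> \<in> measurable unit_lebesgue (borel_of mtopology)"
    "AE t in unit_lebesgue. codes \<nu> t (code \<nu> t)" by auto
qed

end

section \<open>Law and convergence of the coded points\<close>

lemma measure_unit_lebesgue_le:
  assumes "A \<in> sets unit_lebesgue" "0 \<le> c" "emeasure unit_lebesgue A \<le> ennreal c"
  shows "measure unit_lebesgue A \<le> c"
proof -
  interpret prob_space unit_lebesgue by (rule prob_space_unit_lebesgue)
  show ?thesis using assms by (simp add: emeasure_eq_measure)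
qed

context metric_coding
begin

text \<open>For a Radon measure this inequality determines the law of the coded point, see \<open>radon_prob_eqI\<close>: numbers outside
  \<open>escape K\<close> have their coded point in \<open>K\<close>.\<close>

lemma code_in_compact:
  assumes nu: "\<nu> \<in> tight_probs mtopology" and K: "compactin mtopology K"
  shows "measure \<nu> K \<le> measure unit_lebesgue (code \<nu> -` K \<inter> space unit_lebesgue)"
proof -
  interpret L: prob_space unit_lebesgue by (rule prob_space_unit_lebesgue)
  note nuD = tight_probsD(1,2)[OF nu]
  interpret N: prob_space \<nu> by (rule nuD)
  note tree = mass_tree_mass[OF nu]
  have KM: "K \<subseteq> M" using K compactin_subset_topspace by fastforce
  have Ks: "K \<in> sets \<nu>" by (rule compactin_sets_nu[OF nuD K])
  let ?E = "escape \<nu> K"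
  have E: "?E \<in> sets unit_lebesgue" by (rule escape_sets_emeasure(1)[OF nu K])
  have mE: "measure unit_lebesgue ?E \<le> measure \<nu> (M - K)"
    using escape_sets_emeasure(2)[OF nu K] by (intro measure_unit_lebesgue_le E) auto
  have "AE t in unit_lebesgue. t \<in> space unit_lebesgue - ?E \<longrightarrow> t \<in> code \<nu> -` K \<inter> space unit_lebesgue"
    using AE_all_levels[OF tree] AE_code[OF nu] AE_space
  proof eventually_elim
    case (elim t)
    show ?case
    proof
      assume t: "t \<in> space unit_lebesgue - ?E"
      then obtain x where x: "x \<in> K" "\<And>a w. t \<in> cell (mass \<nu>) (a # w) \<Longrightarrow> d a x \<le> radius (length w)"
        using coded_point_in_compact[OF nu K] elim(1) by blast
      have "x = code \<nu> t"
      proof (rule points_equal_if_close)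
        show "x \<in> M" using x KM by blast
        show "code \<nu> t \<in> M" using measurable_space[OF measurable_code[OF nu] elim(3)] by simp
        fix e :: real assume "e > 0"
        then obtain k where k: "(1/2)^k < e" using real_arch_pow_inv[of e "1/2"] by auto
        obtain v where v: "length v = Suc k" "t \<in> cell (mass \<nu>) v" using elim(1) by blast
        then obtain a w where aw: "v = a # w" by (cases v) auto
        have "a \<in> M" using mass_nonzero_imp_letters[OF nuD] cell_nonempty_imp[OF tree] v(2) aw by blast
        then show "\<exists>c\<in>M. \<exists>e'<e. d c x \<le> e' \<and> d c (code \<nu> t) \<le> e'"
          using x(2) elim(2) v aw k by (intro bexI[of _ a] exI[of _ "radius k"]) auto
      qed
      then show "t \<in> code \<nu> -` K \<inter> space unit_lebesgue" using x(1) t by auto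
    qed
  qed
  then have "measure unit_lebesgue (space unit_lebesgue - ?E) \<le> measure unit_lebesgue (code \<nu> -` K \<inter> space unit_lebesgue)"
    using measurable_sets[OF measurable_code[OF nu] compactin_borel_of[OF Hausdorff_space_mtopology K]]
    by (intro L.finite_measure_mono_AE) auto
  moreover have "measure unit_lebesgue (space unit_lebesgue - ?E) = 1 - measure unit_lebesgue ?E"
    by (rule L.prob_compl[OF E])
  moreover have "measure \<nu> (M - K) = 1 - measure \<nu> K" using N.prob_compl[OF Ks] space_nu[OF nuD] by simp
  ultimately show ?thesis using mE by linarith
qed

text \<open>Common part of both convergence results. For subsequences no limit measure is at hand,
  only a limit tree. Eventually \<open>t\<close> spells the same prefix for \<open>\<nu> n\<close> as for the limit tree, hence the coded points
  are eventually close to each letter of the limit word.\<close>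

lemma code_limit_if_mass_limit:
  assumes nu: "\<And>n. \<nu> n \<in> tight_probs mtopology" and tree: "mass_tree \<Lambda>"
    and lim: "\<And>w. (\<lambda>n. mass (\<nu> n) w) \<longlonglongrightarrow> \<Lambda> w"
  shows "AE t in unit_lebesgue. \<exists>a::nat \<Rightarrow> 'a. (\<forall>k. a k \<in> M \<and>
      (\<exists>w. length w = k \<and> t \<in> cell \<Lambda> (a k # w)) \<and>
      (\<forall>\<^sub>F n in sequentially. d (a k) (code (\<nu> n) t) \<le> radius k))"
proof -
  have "AE t in unit_lebesgue. \<forall>n. codes (\<nu> n) t (code (\<nu> n) t)"
    by (rule AE_all_countable[THEN iffD2]) (use AE_code[OF nu] in blast)
  moreover have "AE t in unit_lebesgue. \<forall>w. t \<in> cell \<Lambda> w \<longrightarrow> (\<forall>\<^sub>F n in sequentially. t \<in> cell (mass (\<nu> n)) w)"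
    by (rule AE_eventually_in_cell[OF mass_tree_mass[OF nu] tree lim])
  moreover note AE_all_levels[OF tree]
  ultimately show ?thesis
  proof eventually_elim
    case (elim t)
    have "\<exists>a. a \<in> M \<and> (\<exists>w. length w = k \<and> t \<in> cell \<Lambda> (a # w)) \<and>
        (\<forall>\<^sub>F n in sequentially. d a (code (\<nu> n) t) \<le> radius k)" for k
    proof -
      obtain v where v: "length v = Suc k" "t \<in> cell \<Lambda> v" using elim(3) by blast
      then obtain a w where aw: "v = a # w" by (cases v) auto
      have ev: "\<forall>\<^sub>F n in sequentially. t \<in> cell (mass (\<nu> n)) (a # w)" using elim(2) v aw by blast
      then obtain n where "t \<in> cell (mass (\<nu> n)) (a # w)"
        using eventually_happens[OF ev] by auto
      then have "a \<in> M"
        using mass_nonzero_imp_letters[OF tight_probsD(1,2)[OF nu]] cell_nonempty_imp[OF mass_tree_mass[OF nu]] by blast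
      moreover have "\<forall>\<^sub>F n in sequentially. d a (code (\<nu> n) t) \<le> radius k"
        using ev by eventually_elim (use elim(1) v aw in auto)
      ultimately show ?thesis using v aw by auto
    qed
    then show ?case by metis
  qed
qed

lemma code_tendsto_if_weak_limit:
  assumes nu: "\<And>n. \<nu> n \<in> tight_probs mtopology" and nu0: "\<nu>0 \<in> tight_probs mtopology"
    and op: "\<And>U a. openin mtopology U \<Longrightarrow> a < measure \<nu>0 U \<Longrightarrow> \<forall>\<^sub>F n in sequentially. a < measure (\<nu> n) U"
  shows "AE t in unit_lebesgue. limitin mtopology (\<lambda>n. code (\<nu> n) t) (code \<nu>0 t) sequentially"
proof -
  have lim: "(\<lambda>n. mass (\<nu> n) w) \<longlonglongrightarrow> mass \<nu>0 w" for w
    unfolding mass_def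
    by (rule integral_tendsto_of_open_sets[where X = mtopology])
      (use tight_probsD[OF nu] tight_probsD[OF nu0] op word_weight_continuous word_weight_nonneg word_weight_le_1 in auto)
  show ?thesis
    using code_limit_if_mass_limit[OF nu mass_tree_mass[OF nu0] lim] AE_code[OF nu0] AE_space
  proof eventually_elim
    case (elim t)
    then obtain a where a: "\<And>k. a k \<in> M" "\<And>k. \<exists>w. length w = k \<and> t \<in> cell (mass \<nu>0) (a k # w)"
      "\<And>k. \<forall>\<^sub>F n in sequentially. d (a k) (code (\<nu> n) t) \<le> radius k" by blast
    have codeM: "code (\<nu> n) t \<in> M" "code \<nu>0 t \<in> M" for n
      using measurable_space[OF measurable_code[OF nu] elim(3)] measurable_space[OF measurable_code[OF nu0] elim(3)]
      by simp_all
    show ?case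
      unfolding limitin_metric
    proof (intro conjI allI impI)
      fix e :: real assume "e > 0"
      then obtain k where k: "(1/2)^k < e / 2" using real_arch_pow_inv[of "e / 2" "1/2"] by auto
      have near0: "d (a k) (code \<nu>0 t) \<le> radius k" using a(2)[of k] elim(2) by auto
      show "\<forall>\<^sub>F n in sequentially. code (\<nu> n) t \<in> M \<and> d (code (\<nu> n) t) (code \<nu>0 t) < e"
        using a(3)[of k]
      proof eventually_elim
        case (elim n)
        then show ?case using triangle''[of "code (\<nu> n) t" "a k" "code \<nu>0 t"] codeM a(1)[of k] k near0 by auto
      qed
    qed (rule codeM)
  qed
qed

text \<open>A diagonal argument makes all masses converge along a subsequence, and uniform tightness makes
  the limits a mass tree. The coded points then approach the letters of the limit word. They
  converge to a point of \<open>M\<close>, because by Fatou's lemma for sets almost every \<open>t\<close> has its coded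
  points infinitely often in one compact set.\<close>

lemma code_convergent_subsequence:
  assumes nu: "\<And>n. \<nu> n \<in> tight_probs mtopology" and ut: "uniformly_tight mtopology (range \<nu>)"
  shows "\<exists>r :: nat \<Rightarrow> nat. strict_mono r \<and>
    (AE t in unit_lebesgue. \<exists>x. limitin mtopology (\<lambda>k. code (\<nu> (r k)) t) x sequentially)"
proof -
  interpret L: prob_space unit_lebesgue by (rule prob_space_unit_lebesgue)
  define W where "W = (\<Union>n. {w. mass (\<nu> n) w \<noteq> 0})"
  have "countable W" unfolding W_def
    by (intro countable_UN countable_mass_tree_support mass_tree_mass nu) auto
  then obtain r :: "nat \<Rightarrow> nat" where r: "strict_mono r"
    and conv: "\<And>w. w \<in> W \<Longrightarrow> \<exists>l. (\<lambda>n. mass (\<nu> (r n)) w) \<longlonglongrightarrow> l"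
    using function_convergent_subsequence[of W "\<lambda>n. mass (\<nu> n)" 1]
      mass_le_1[OF tight_probsD(1,2)[OF nu]] mass_nonneg[OF tight_probsD(1,2)[OF nu]] by auto
  have "\<exists>l. (\<lambda>n. mass (\<nu> (r n)) w) \<longlonglongrightarrow> l" for w
  proof (cases "w \<in> W")
    case False
    then have "(\<lambda>n. mass (\<nu> (r n)) w) = (\<lambda>n. 0)" by (auto simp: W_def)
    then show ?thesis by auto
  qed (rule conv)
  then obtain \<Lambda> where lim: "\<And>w. (\<lambda>n. mass (\<nu> (r n)) w) \<longlonglongrightarrow> \<Lambda> w" by metis
  have ut': "uniformly_tight mtopology (range (\<lambda>n. \<nu> (r n)))"
    using ut unfolding uniformly_tight_def by fastforce
  have tree: "mass_tree \<Lambda>"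
    by (rule mass_tree_limit[OF tight_probsD(1,2)[OF nu] ut' lim])
  \<comment> \<open>each coded point lies in K with probability at least 1 - e, so with this probability infinitely many do\<close>
  have freq: "AE t in unit_lebesgue. \<exists>K. compactin mtopology K \<and> (\<exists>\<^sub>F n in sequentially. code (\<nu> (r n)) t \<in> K)"
  proof (rule AE_all_epsilonI)
    show "finite_measure unit_lebesgue" by unfold_locales
    fix e :: real assume e: "e > 0"
    then obtain K where K: "compactin mtopology K" "\<And>n. measure (\<nu> (r n)) (M - K) < e"
      using ut' unfolding uniformly_tight_def by fastforce
    define C where "C n = code (\<nu> (r n)) -` K \<inter> space unit_lebesgue" for n
    have C: "C n \<in> sets unit_lebesgue" for n
      unfolding C_def
      by (rule measurable_sets[OF measurable_code[OF nu] compactin_borel_of[OF Hausdorff_space_mtopology K(1)]])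
    have Ce: "measure unit_lebesgue (space unit_lebesgue - C n) \<le> e" for n
    proof -
      interpret N: prob_space "\<nu> (r n)" by (rule tight_probsD[OF nu])
      have Ks: "K \<in> sets (\<nu> (r n))" by (rule compactin_sets_nu[OF tight_probsD(1,2)[OF nu] K(1)])
      have "1 - measure (\<nu> (r n)) K < e"
        using K(2)[of n] N.prob_compl[OF Ks] space_nu[OF tight_probsD(1,2)[OF nu]] by simp
      moreover have "measure (\<nu> (r n)) K \<le> measure unit_lebesgue (C n)"
        unfolding C_def by (rule code_in_compact[OF nu K(1)])
      ultimately show ?thesis using L.prob_compl[OF C, of n] by linarith
    qed
    define T where "T m = (\<Inter>n\<in>{m..}. space unit_lebesgue - C n)" for m :: nat
    have T: "T m \<in> sets unit_lebesgue" for m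
      unfolding T_def using sets.compl_sets[OF C] by (intro sets.countable_INT') auto
    have T_le: "emeasure unit_lebesgue (T m) \<le> ennreal e" for m
    proof -
      have "measure unit_lebesgue (T m) \<le> measure unit_lebesgue (space unit_lebesgue - C m)"
        using sets.compl_sets[OF C, of m] by (intro L.finite_measure_mono) (auto simp: T_def)
      then show ?thesis using Ce[of m] by (simp add: L.emeasure_eq_measure ennreal_leI)
    qed
    have incT: "incseq T" unfolding T_def by (intro incseq_SucI INF_superset_mono) auto
    have "(SUP m. emeasure unit_lebesgue (T m)) = emeasure unit_lebesgue (\<Union>m. T m)"
      using T incT by (intro SUP_emeasure_incseq) auto
    then have "emeasure unit_lebesgue (\<Union>m. T m) \<le> ennreal e" using T_le by (metis SUP_least)
    then have small: "measure unit_lebesgue (\<Union>m. T m) \<le> e"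
      using T e by (intro measure_unit_lebesgue_le sets.countable_UN) auto
    let ?G = "space unit_lebesgue - (\<Union>m. T m)"
    have "(\<Union>m. T m) \<subseteq> space unit_lebesgue" using T sets.sets_into_space by blast
    then have "space unit_lebesgue - (?G) = (\<Union>m. T m)" by blast
    moreover have "\<exists>\<^sub>F n in sequentially. code (\<nu> (r n)) t \<in> K" if "t \<in> ?G" for t
      unfolding frequently_sequentially
    proof
      fix m
      have "t \<notin> T m" "t \<in> space unit_lebesgue" using that by auto
      then show "\<exists>n\<ge>m. code (\<nu> (r n)) t \<in> K" unfolding T_def C_def by auto
    qed
    then have "AE t in unit_lebesgue. t \<in> ?G \<longrightarrow>
        (\<exists>K. compactin mtopology K \<and> (\<exists>\<^sub>F n in sequentially. code (\<nu> (r n)) t \<in> K))"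
      using K(1) by (intro AE_I2 impI exI[of _ K] conjI)
    moreover have "?G \<in> sets unit_lebesgue"
      using T by (intro sets.compl_sets sets.countable_UN) auto
    ultimately show "\<exists>B\<in>sets unit_lebesgue. measure unit_lebesgue (space unit_lebesgue - B) \<le> e \<and>
        (AE t in unit_lebesgue. t \<in> B \<longrightarrow> (\<exists>K. compactin mtopology K \<and> (\<exists>\<^sub>F n in sequentially. code (\<nu> (r n)) t \<in> K)))"
      by (intro bexI[of _ ?G] conjI) (simp_all add: small)
  qed
  have "AE t in unit_lebesgue. \<exists>x. limitin mtopology (\<lambda>k. code (\<nu> (r k)) t) x sequentially"
    using code_limit_if_mass_limit[OF nu tree lim] freq AE_space
  proof eventually_elim
    case (elim t)
    obtain a where a: "\<And>k. a k \<in> M" "\<And>k. \<forall>\<^sub>F n in sequentially. d (a k) (code (\<nu> (r n)) t) \<le> radius k"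
      using elim(1) by blast
    obtain K where K: "compactin mtopology K" "\<exists>\<^sub>F n in sequentially. code (\<nu> (r n)) t \<in> K" using elim(2) by blast
    have KM: "K \<subseteq> M" using K compactin_subset_topspace by fastforce
    have codeM: "code (\<nu> n) t \<in> M" for n
      using measurable_space[OF measurable_code[OF nu] elim(3)] by simp
    have "\<exists>x\<in>K. \<forall>j::nat. d (a j) x \<le> radius j"
    proof (rule nested_balls_meet_compact[OF K(1) a(1)])
      fix k
      have "\<forall>\<^sub>F n in sequentially. \<forall>j\<in>{..<k}. d (a j) (code (\<nu> (r n)) t) \<le> radius j"
        using a(2) by (intro eventually_ball_finite) auto
      then have "\<exists>\<^sub>F n in sequentially. code (\<nu> (r n)) t \<in> K \<and> (\<forall>j\<in>{..<k}. d (a j) (code (\<nu> (r n)) t) \<le> radius j)"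
        by (rule frequently_eventually_frequently[OF K(2)])
      from frequently_ex[OF this] show "\<exists>x\<in>K. \<forall>j<k. d (a j) x \<le> radius j" by auto
    qed
    then obtain x where x: "x \<in> K" "\<And>j. d (a j) x \<le> radius j" by blast
    have "limitin mtopology (\<lambda>n. code (\<nu> (r n)) t) x sequentially"
      unfolding limitin_metric
    proof (intro conjI allI impI)
      show "x \<in> M" using x KM by blast
      fix e :: real assume "e > 0"
      then obtain k where k: "(1/2)^k < e / 2" using real_arch_pow_inv[of "e / 2" "1/2"] by auto
      show "\<forall>\<^sub>F n in sequentially. code (\<nu> (r n)) t \<in> M \<and> d (code (\<nu> (r n)) t) x < e"
        using a(2)[of k]
      proof eventually_elim
        case (elim n)
        then show ?case
          using triangle''[of "code (\<nu> (r n)) t" "a k" x] codeM a(1)[of k] k x(2)[of k] \<open>x \<in> M\<close> by auto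
      qed
    qed
    then show ?case by blast
  qed
  then show ?thesis using r by blast
qed

end

text \<open>What the applications need, without reference to the well-order and the trees.\<close>

locale skorohod_code = Metric_space M d for M :: "'a set" and d +
  fixes code :: "'a measure \<Rightarrow> real \<Rightarrow> 'a"
  assumes measurable_code:
      "\<nu> \<in> tight_probs mtopology \<Longrightarrow> code \<nu> \<in> measurable unit_lebesgue (borel_of mtopology)"
    and code_in_compact: "\<nu> \<in> tight_probs mtopology \<Longrightarrow> compactin mtopology K \<Longrightarrow>
      measure \<nu> K \<le> measure unit_lebesgue (code \<nu> -` K \<inter> space unit_lebesgue)"
    and code_tendsto: "(\<And>n. \<kappa> n \<in> tight_probs mtopology) \<Longrightarrow> \<nu> \<in> tight_probs mtopology \<Longrightarrow>
      (\<And>U a. openin mtopology U \<Longrightarrow> a < measure \<nu> U \<Longrightarrow> \<forall>\<^sub>F n in sequentially. a < measure (\<kappa> n) U) \<Longrightarrow>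
      AE t in unit_lebesgue. limitin mtopology (\<lambda>n. code (\<kappa> n) t) (code \<nu> t) sequentially"
    and code_subsequence: "(\<And>n. \<kappa> n \<in> tight_probs mtopology) \<Longrightarrow> uniformly_tight mtopology (range \<kappa>) \<Longrightarrow>
      \<exists>r :: nat \<Rightarrow> nat. strict_mono r \<and>
        (AE t in unit_lebesgue. \<exists>x. limitin mtopology (\<lambda>k. code (\<kappa> (r k)) t) x sequentially)"

lemma (in Metric_space) skorohod_code_exists: "\<exists>code. skorohod_code M d code"
proof -
  obtain R :: "'a rel" where R: "well_order_on UNIV R" using well_order_on by blast
  have lin: "linear_order_on UNIV R" "wf (R - Id)" using R by (auto simp: well_order_on_def)
  have tr: "trans R" and as: "antisym R" and tot: "total_on UNIV R"
    using lin(1) by (auto simp: linear_order_on_def partial_order_on_def preorder_on_def)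
  interpret C: metric_coding M d "\<lambda>a b. (a, b) \<in> R - Id"
  proof unfold_locales
    have "{(a, b). (a, b) \<in> R - Id} = R - Id" by auto
    then show "wfp (\<lambda>a b. (a, b) \<in> R - Id)" using lin(2) by (simp only: wfp_def)
    show "(a, c) \<in> R - Id" if "(a, b) \<in> R - Id" "(b, c) \<in> R - Id" for a b c
      using that tr as by (auto dest: transD antisymD)
    show "(a, b) \<in> R - Id \<or> a = b \<or> (b, a) \<in> R - Id" for a b
      using tot by (auto simp: total_on_def)
  qed
  have "skorohod_code M d C.code"
    by unfold_locales
      (fact C.measurable_code C.code_in_compact C.code_tendsto_if_weak_limit C.code_convergent_subsequence)+
  then show ?thesis by blast
qed

section \<open>A metric on a proper image of a metric space\<close>

text \<open>The metrization lemma for a countable base of entourages. The quasi-distance \<open>q\<close> of two points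
  is the infimum of the powers of 1/2 whose entourages contain the pair, and \<open>D\<close> is the infimum of the lengths
  of chains. The point is that \<open>D\<close> does not collapse, that is, \<open>q \<le> 2 * D\<close>.\<close>

lemma metric_from_entourages:
  fixes S :: "'a set" and E :: "nat \<Rightarrow> 'a \<Rightarrow> 'a \<Rightarrow> bool"
  assumes refl: "\<And>k x. x \<in> S \<Longrightarrow> E k x x" and sym: "\<And>k x y. E k x y \<Longrightarrow> E k y x"
    and top: "\<And>x y. x \<in> S \<Longrightarrow> y \<in> S \<Longrightarrow> E 0 x y"
    and comp: "\<And>k x y z w. x \<in> S \<Longrightarrow> y \<in> S \<Longrightarrow> z \<in> S \<Longrightarrow> w \<in> S \<Longrightarrow>
      E (Suc k) x y \<Longrightarrow> E (Suc k) y z \<Longrightarrow> E (Suc k) z w \<Longrightarrow> E k x w"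
    and sep: "\<And>x y. x \<in> S \<Longrightarrow> y \<in> S \<Longrightarrow> (\<And>k. E k x y) \<Longrightarrow> x = y"
  obtains D where "Metric_space S D"
    "\<And>x y k. x \<in> S \<Longrightarrow> y \<in> S \<Longrightarrow> E k x y \<Longrightarrow> D x y \<le> (1 / 2) ^ k"
    "\<And>x y k. x \<in> S \<Longrightarrow> y \<in> S \<Longrightarrow> D x y < (1 / 2) ^ Suc k \<Longrightarrow> E k x y"
proof -
  have E_Suc: "E k x y" if "x \<in> S" "y \<in> S" "E (Suc k) x y" for k x y
    using comp[of x x x y k] refl that by blast
  have E_mono: "E j x y" if "x \<in> S" "y \<in> S" "E k x y" "j \<le> k" for j k x y
    using that(4,3) by (induction k rule: dec_induct) (use E_Suc that in blast)+
  define q where "q x y = Inf {(1 / 2 :: real) ^ k | k. E k x y}" for x y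
  have bdd: "bdd_below {(1 / 2 :: real) ^ k | k. E k x y}" for x y
    by (rule bdd_belowI[of _ 0]) auto
  have q_le: "q x y \<le> (1 / 2) ^ k" if "E k x y" for x y k
    unfolding q_def using that by (intro cInf_lower bdd) auto
  have q_nonneg: "0 \<le> q x y" if "x \<in> S" "y \<in> S" for x y
    unfolding q_def using top[OF that] by (intro cInf_greatest) auto
  have q_less: "E k x y" if xy: "x \<in> S" "y \<in> S" and less: "q x y < 2 * (1 / 2) ^ k" for x y k
  proof -
    have "{(1 / 2 :: real) ^ k | k. E k x y} \<noteq> {}" using top[OF xy] by blast
    then obtain j where j: "E j x y" "(1 / 2 :: real) ^ j < 2 * (1 / 2) ^ k"
      using cInf_lessD[of "{(1 / 2 :: real) ^ k | k. E k x y}"] less unfolding q_def by blast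
    have "k \<le> j"
    proof (rule ccontr)
      assume "\<not> k \<le> j"
      then have "(1 / 2 :: real) ^ k \<le> (1 / 2) ^ Suc j" by (intro power_decreasing) auto
      then show False using j(2) by simp
    qed
    then show ?thesis using E_mono[OF xy j(1)] by blast
  qed
  have q_sym: "q x y = q y x" for x y
    unfolding q_def using sym by (metis (no_types, lifting))
  have small: "r \<le> 0" if "\<And>k. r \<le> (1 / 2) ^ k" for r :: real
  proof (rule ccontr)
    assume "\<not> r \<le> 0"
    then obtain k where "(1 / 2) ^ k < r" using real_arch_pow_inv[of r "1 / 2"] by auto
    then show False using that[of k] by simp
  qed
  have q_refl: "q x x \<le> 0" if "x \<in> S" for x
    by (rule small) (use q_le refl that in blast)
  \<comment> \<open>Induction on the number of links: cut the chain at the link that contains its midpoint. Both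
    remaining chains have at most half of the total length, so by induction the quasi-distance
    of their end points is at most the total length, as is that of the cut link, and one triple
    composition costs a factor 2.\<close>
  have chain: "q (c m) (c n) \<le> 2 * (\<Sum>i = m..<n. q (c i) (c (Suc i)))"
    if "m \<le> n" and cS: "\<And>i. c i \<in> S" for c :: "nat \<Rightarrow> 'a" and m n
    using that(1)
  proof (induction "n - m" arbitrary: m n rule: less_induct)
    case less
    let ?s = "\<lambda>m n. \<Sum>i = m..<n. q (c i) (c (Suc i))"
    have s_nonneg: "0 \<le> ?s m n" for m n by (intro sum_nonneg q_nonneg cS)
    show ?case
    proof (cases "m = n")
      case True
      then show ?thesis using q_refl[OF cS] by simp
    next
      case False
      then have mn: "m < n" using less.prems by simp
      define J where "J = {j\<in>{m..<n}. ?s m j \<le> ?s m n / 2}"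
      have J: "finite J" "m \<in> J" using mn s_nonneg[of m n] unfolding J_def by auto
      \<comment> \<open>the chain is cut at the link from c j to c (Suc j)\<close>
      define j where "j = Max J"
      have j: "m \<le> j" "j < n" "?s m j \<le> ?s m n / 2"
      proof -
        have "j \<in> J" unfolding j_def by (rule Max_in) (use J in auto)
        then show "m \<le> j" "j < n" "?s m j \<le> ?s m n / 2" by (simp_all add: J_def)
      qed
      have split: "?s m n = ?s m (Suc j) + ?s (Suc j) n"
        using j by (intro sum.atLeastLessThan_concat[symmetric]) auto
      have right: "?s (Suc j) n \<le> ?s m n / 2"
      proof (cases "Suc j = n")
        case True
        then show ?thesis using s_nonneg[of m n] by simp
      next
        case False
        have "Suc j \<notin> J"
        proof
          assume "Suc j \<in> J"
          then have "Suc j \<le> j" unfolding j_def using J(1) by (rule Max_ge[rotated])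
          then show False by simp
        qed
        then have "?s m (Suc j) > ?s m n / 2" using False j unfolding J_def by auto
        then show ?thesis using split by simp
      qed
      have mid: "q (c j) (c (Suc j)) \<le> ?s m n"
      proof -
        have "?s m (Suc j) = ?s m j + q (c j) (c (Suc j))" using j by simp
        then show ?thesis using split s_nonneg[of m j] s_nonneg[of "Suc j" n] by simp
      qed
      have q1: "q (c m) (c j) \<le> ?s m n" using less.hyps[of j m] j mn by (simp add: diff_less_mono)
      have q2: "q (c (Suc j)) (c n) \<le> ?s m n" using less.hyps[of n "Suc j"] j right by (simp add: diff_less_mono2)
      have step: "q (c m) (c n) \<le> (1 / 2) ^ k" if "?s m n < (1 / 2) ^ k" for k
      proof -
        have "E (Suc k) (c m) (c j)" "E (Suc k) (c j) (c (Suc j))" "E (Suc k) (c (Suc j)) (c n)"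
          using q1 q2 mid that by (auto intro!: q_less cS)
        then have "E k (c m) (c n)" using comp cS by blast
        then show ?thesis by (rule q_le)
      qed
      show ?thesis
      proof (cases "?s m n > 0")
        case False
        then have s0: "?s m n = 0" using s_nonneg[of m n] by linarith
        have "q (c m) (c n) \<le> 0" by (rule small, rule step) (simp add: s0)
        then show ?thesis using s0 by simp
      next
        case True
        then obtain k0 where "(1 / 2) ^ k0 < ?s m n" using real_arch_pow_inv[of "?s m n" "1 / 2"] by auto
        then have ex: "\<exists>k. (1 / 2) ^ k \<le> ?s m n" by (intro exI[of _ k0]) simp
        define k where "k = (LEAST k. (1 / 2) ^ k \<le> ?s m n)"
        have k: "(1 / 2) ^ k \<le> ?s m n" unfolding k_def by (rule LeastI_ex[OF ex])
        show ?thesis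
        proof (cases k)
          case 0
          have "q (c m) (c n) \<le> 1" using q_le[OF top[OF cS cS, of m n]] by simp
          then show ?thesis using k 0 by simp
        next
          case (Suc l)
          have "\<not> (1 / 2) ^ l \<le> ?s m n" using not_less_Least[of l "\<lambda>k. (1 / 2) ^ k \<le> ?s m n"] Suc unfolding k_def by simp
          then have "q (c m) (c n) \<le> (1 / 2) ^ l" by (intro step) simp
          then show ?thesis using k Suc by simp
        qed
      qed
    qed
  qed
  define len where "len c n = (\<Sum>i = 0..<n. q (c i) (c (Suc i)))" for c :: "nat \<Rightarrow> 'a" and n
  define L where "L x y = {len c n | c n. c 0 = x \<and> c n = y \<and> (\<forall>i. c i \<in> S)}" for x y
  define D where "D x y = (if x \<in> S \<and> y \<in> S then Inf (L x y) else 0)" for x y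
  have len_nonneg: "0 \<le> len c n" if "\<forall>i. c i \<in> S" for c n
    unfolding len_def using that by (intro sum_nonneg q_nonneg) auto
  have qL: "q x y \<in> L x y" if "x \<in> S" "y \<in> S" for x y
    unfolding L_def len_def using that
    by (intro CollectI exI[of _ "\<lambda>i. if i = 0 then x else y"] exI[of _ "1::nat"]) auto
  have L_bdd: "bdd_below (L x y)" for x y
    by (rule bdd_belowI[of _ 0]) (auto simp: L_def len_nonneg)
  have D_le: "D x y \<le> l" if "l \<in> L x y" "x \<in> S" "y \<in> S" for l x y
    unfolding D_def using that by (auto intro: cInf_lower L_bdd)
  have D_ge: "b \<le> D x y" if "x \<in> S" "y \<in> S" "\<And>l. l \<in> L x y \<Longrightarrow> b \<le> l" for b x y
  proof -
    have "b \<le> Inf (L x y)" using qL[OF that(1,2)] that(3) by (intro cInf_greatest) auto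
    then show ?thesis using that by (simp add: D_def)
  qed
  have qD: "q x y \<le> 2 * D x y" if "x \<in> S" "y \<in> S" for x y
  proof -
    have "q x y / 2 \<le> D x y"
    proof (rule D_ge[OF that])
      fix l assume "l \<in> L x y"
      then obtain c n where c: "l = len c n" "c 0 = x" "c n = y" "\<forall>i. c i \<in> S" unfolding L_def by blast
      then show "q x y / 2 \<le> l" using chain[of 0 n c] unfolding len_def by simp
    qed
    then show ?thesis by simp
  qed
  have L_rev: "L x y \<subseteq> L y x" for x y
  proof
    fix l assume "l \<in> L x y"
    then obtain c n where c: "l = len c n" "c 0 = x" "c n = y" "\<forall>i. c i \<in> S" unfolding L_def by blast
    have "len (\<lambda>i. c (n - i)) n = (\<Sum>i<n. q (c (Suc (n - Suc i))) (c (n - Suc i)))"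
      unfolding len_def by (auto simp: atLeast0LessThan Suc_diff_Suc intro!: sum.cong)
    also have "\<dots> = (\<Sum>i<n. q (c (Suc i)) (c i))" by (rule sum.nat_diff_reindex)
    also have "\<dots> = l" unfolding c(1) len_def by (simp add: atLeast0LessThan q_sym)
    finally have "l = len (\<lambda>i. c (n - i)) n" by simp
    then show "l \<in> L y x" unfolding L_def using c
      by (intro CollectI exI[of _ "\<lambda>i. c (n - i)"] exI[of _ n]) auto
  qed
  have L_concat: "l + l' \<in> L x z" if "l \<in> L x y" "l' \<in> L y z" for l l' x y z
  proof -
    obtain c n where c: "l = len c n" "c 0 = x" "c n = y" "\<forall>i. c i \<in> S" using \<open>l \<in> L x y\<close> unfolding L_def by blast
    obtain c' n' where c': "l' = len c' n'" "c' 0 = y" "c' n' = z" "\<forall>i. c' i \<in> S" using \<open>l' \<in> L y z\<close> unfolding L_def by blast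
    define e where "e i = (if i \<le> n then c i else c' (i - n))" for i
    have e_right: "e (i + n) = c' i" for i using c(3) c'(2) by (cases i) (auto simp: e_def)
    have "len e (n' + n) = (\<Sum>i = 0..<n. q (e i) (e (Suc i))) + (\<Sum>i = n..<n' + n. q (e i) (e (Suc i)))"
      unfolding len_def by (intro sum.atLeastLessThan_concat[symmetric]) auto
    also have "(\<Sum>i = n..<n' + n. q (e i) (e (Suc i))) = (\<Sum>i = 0..<n'. q (e (i + n)) (e (Suc (i + n))))"
      using sum.shift_bounds_nat_ivl[of "\<lambda>i. q (e i) (e (Suc i))" 0 n n'] by simp
    also have "\<dots> = l'" unfolding c'(1) len_def using e_right by (metis add_Suc)
    also have "(\<Sum>i = 0..<n. q (e i) (e (Suc i))) = l"
      unfolding c(1) len_def by (intro sum.cong) (auto simp: e_def)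
    finally have "len e (n' + n) = l + l'" .
    moreover have "e 0 = x" "e (n' + n) = z" "\<forall>i. e i \<in> S"
      using c c' e_right by (auto simp: e_def)
    ultimately show ?thesis unfolding L_def by (intro CollectI exI[of _ e] exI[of _ "n' + n"]) auto
  qed
  have D_nonneg: "0 \<le> D x y" for x y
  proof (cases "x \<in> S \<and> y \<in> S")
    case True
    then show ?thesis using len_nonneg by (intro D_ge) (auto simp: L_def)
  qed (auto simp: D_def)
  have "Metric_space S D"
  proof
    show "0 \<le> D x y" for x y by (rule D_nonneg)
    show "D x y = D y x" for x y
      using L_rev[of x y] L_rev[of y x] unfolding D_def by (metis subset_antisym)
    show "D x y = 0 \<longleftrightarrow> x = y" if xy: "x \<in> S" "y \<in> S" for x y
    proof
      assume "D x y = 0"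
      then have "q x y \<le> 0" using qD[OF xy] by simp
      then have "q x y < 2 * (1 / 2) ^ k" for k using zero_less_power[of "1 / 2 :: real" k] by linarith
      then show "x = y" using sep[OF xy] q_less[OF xy] by blast
    next
      assume "x = y"
      then show "D x y = 0" using D_le[OF qL[OF xy] xy] q_refl[OF xy(1)] D_nonneg[of x y] by simp
    qed
    show "D x z \<le> D x y + D y z" if xyz: "x \<in> S" "y \<in> S" "z \<in> S" for x y z
    proof -
      have "D x z - D y z \<le> D x y"
      proof (rule D_ge[OF xyz(1,2)])
        fix l assume l: "l \<in> L x y"
        have "D x z - l \<le> D y z"
        proof (rule D_ge[OF xyz(2,3)])
          fix l' assume "l' \<in> L y z"
          then show "D x z - l \<le> l'" using D_le[OF L_concat[OF l] xyz(1,3)] by fastforce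
        qed
        then show "D x z - D y z \<le> l" by simp
      qed
      then show ?thesis by simp
    qed
  qed
  moreover have "D x y \<le> (1 / 2) ^ k" if "x \<in> S" "y \<in> S" "E k x y" for x y k
    using D_le[OF qL that(1,2)] q_le[OF that(3)] that by fastforce
  moreover have "E k x y" if "x \<in> S" "y \<in> S" "D x y < (1 / 2) ^ Suc k" for x y k
  proof (rule q_less[OF that(1,2)])
    show "q x y < 2 * (1 / 2) ^ k"
      using qD[OF that(1,2)] that(3) zero_less_power[of "1 / 2 :: real" k] unfolding power_Suc by linarith
  qed
  ultimately show thesis using that by blast
qed

text \<open>The topology of \<open>X\<close> need not be metrizable, but the quotient topology of \<open>f\<close> is, it refines the
  topology of \<open>X\<close>, and both have the same compact sets. The first claim is the theorem of
  Hanai, Morita and Stone on perfect images of metric spaces, proved here with Frink's neighbourhoods: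
  \<open>W k y\<close> consists of the points whose fibre is contained in the neighbourhood of radius
  \<open>(1 / 2) ^ k\<close> of the fibre of \<open>y\<close>. Everything rests on \<open>fibre_close\<close>: a fibre that comes near the
  fibre of \<open>y\<close> at one point is near it everywhere.\<close>

lemma (in Metric_space) metric_of_proper_image:
  assumes H: "Hausdorff_space X" and cont: "continuous_map mtopology X f" and surj: "f ` M = topspace X"
    and proper: "\<And>K. compactin X K \<Longrightarrow> compactin mtopology (M \<inter> f -` K)"
  obtains D where "Metric_space (topspace X) D"
    "\<And>U. openin X U \<Longrightarrow> openin (Metric_space.mtopology (topspace X) D) U"
    "\<And>K. compactin X K \<Longrightarrow> compactin (Metric_space.mtopology (topspace X) D) K"
proof -
  let ?Y = "topspace X"
  define F where "F y = M \<inter> f -` {y}" for y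
  have F_compact: "compactin mtopology (F y)" if "y \<in> ?Y" for y
    unfolding F_def using that by (intro proper) simp
  have F_ne: "F y \<noteq> {}" if y: "y \<in> ?Y" for y
  proof -
    obtain x where "x \<in> M" "f x = y" using y unfolding surj[symmetric] by blast
    then show ?thesis unfolding F_def by auto
  qed
  have F_M: "x \<in> M" "f x = y" if "x \<in> F y" for x y using that unfolding F_def by auto
  have fY: "f x \<in> ?Y" if "x \<in> M" for x using that surj by auto
  have in_F: "x \<in> F (f x)" if "x \<in> M" for x using that unfolding F_def by auto
  define W where "W k y v \<longleftrightarrow> v \<in> ?Y \<and> (\<forall>x\<in>F v. \<exists>a\<in>F y. d a x < (1 / 2) ^ k)" for k :: nat and y v
  \<comment> \<open>points that approach a compact fibre subconverge to a point of it\<close>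
  have shadow: "\<exists>l r. l \<in> F y \<and> strict_mono (r::nat\<Rightarrow>nat) \<and> limitin mtopology (x \<circ> r) l sequentially \<and> limitin X (f \<circ> x \<circ> r) y sequentially"
    if y: "y \<in> ?Y" and a: "\<And>k. a k \<in> F y" and x: "\<And>k. x k \<in> M" and ax: "\<And>k. d (a k) (x k) < (1 / 2) ^ k" for y and a x :: "nat \<Rightarrow> 'a"
  proof -
    obtain l r where lr: "l \<in> F y" "strict_mono r" "limitin mtopology (a \<circ> r) l sequentially"
      using F_compact[OF y] a unfolding compactin_sequentially by (metis image_subsetI)
    have "limitin mtopology (x \<circ> r) l sequentially"
      unfolding limitin_metric
    proof (intro conjI allI impI)
      show "l \<in> M" using lr F_M by blast
      fix e :: real assume "e > 0"
      then obtain k where k: "(1 / 2) ^ k < e / 2" using real_arch_pow_inv[of "e / 2" "1 / 2"] by auto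
      have "\<forall>\<^sub>F n in sequentially. d ((a \<circ> r) n) l < e / 2"
        using lr(3) \<open>e > 0\<close> unfolding limitin_metric by (auto elim!: allE[of _ "e / 2"] eventually_mono)
      then show "\<forall>\<^sub>F n in sequentially. (x \<circ> r) n \<in> M \<and> d ((x \<circ> r) n) l < e"
        using eventually_ge_at_top[of k]
      proof eventually_elim
        case (elim n)
        have "k \<le> r n" using elim(2) seq_suble[OF lr(2), of n] by simp
        then have "(1 / 2 :: real) ^ r n \<le> (1 / 2) ^ k" by (intro power_decreasing) auto
        then have "d (a (r n)) (x (r n)) < e / 2" using ax[of "r n"] k by linarith
        then show ?case using triangle''[of "x (r n)" "a (r n)" l] elim(1) x F_M[OF a] F_M[OF lr(1)] by (simp add: commute)
      qed
    qed
    moreover from continuous_map_limit[OF cont this] have "limitin X (f \<circ> x \<circ> r) y sequentially"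
      using F_M[OF lr(1)] by (simp add: comp_assoc)
    ultimately show ?thesis using lr by blast
  qed
  have fibre_close: "\<exists>k::nat. \<forall>v\<in>?Y. (\<exists>x\<in>F v. \<exists>a\<in>F y. d a x < (1 / 2) ^ k) \<longrightarrow> (\<forall>z\<in>F v. \<exists>a\<in>F y. d a z < e)"
    if y: "y \<in> ?Y" and e: "e > 0" for y and e :: real
  proof (rule ccontr)
    assume "\<not> ?thesis"
    then have "\<forall>k::nat. \<exists>x a z. x \<in> M \<and> z \<in> F (f x) \<and> a \<in> F y \<and> d a x < (1 / 2) ^ k \<and> (\<forall>b\<in>F y. \<not> d b z < e)"
      using F_M by metis
    then obtain x a z where xz: "\<And>k. x k \<in> M" "\<And>k. z k \<in> F (f (x k))" "\<And>k. a k \<in> F y"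
      "\<And>k::nat. d (a k) (x k) < (1 / 2) ^ k" "\<And>k b. b \<in> F y \<Longrightarrow> \<not> d b (z k) < e" by metis
    obtain l r where lr: "l \<in> F y" "strict_mono (r::nat\<Rightarrow>nat)" "limitin X (f \<circ> x \<circ> r) y sequentially"
      using shadow[OF y xz(3,1,4)] by blast
    \<comment> \<open>a convergent sequence with its limit is compact, so properness applies and the fibre points z subconverge\<close>
    have "compactin X (insert y (range (f \<circ> x \<circ> r)))"
      using fY xz(1) by (intro compactin_sequence_with_limit[OF lr(3)]) auto
    then have "compactin mtopology (M \<inter> f -` insert y (range (f \<circ> x \<circ> r)))" by (rule proper)
    moreover have "range (z \<circ> r) \<subseteq> M \<inter> f -` insert y (range (f \<circ> x \<circ> r))"
      using F_M[OF xz(2)] by auto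
    ultimately obtain z0 r' where z0: "z0 \<in> M" "strict_mono r'" "limitin mtopology (z \<circ> r \<circ> r') z0 sequentially"
      unfolding compactin_sequentially by blast
    have "limitin X (f \<circ> (z \<circ> r \<circ> r')) (f z0) sequentially" by (rule continuous_map_limit[OF cont z0(3)])
    moreover have "f \<circ> (z \<circ> r \<circ> r') = (f \<circ> x \<circ> r) \<circ> r'" using F_M[OF xz(2)] by (simp add: fun_eq_iff)
    moreover have "limitin X ((f \<circ> x \<circ> r) \<circ> r') y sequentially" by (rule limitin_subsequence[OF z0(2) lr(3)])
    ultimately have "f z0 = y" using limitin_Hausdorff_unique[OF _ _ _ H] by (metis trivial_limit_sequentially)
    then have z0F: "z0 \<in> F y" using z0(1) unfolding F_def by auto
    have "\<forall>\<^sub>F n in sequentially. d ((z \<circ> r \<circ> r') n) z0 < e"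
      using z0(3) e unfolding limitin_metric by (auto elim!: allE[of _ e] eventually_mono)
    then obtain n where "d (z (r (r' n))) z0 < e" by (auto dest!: eventually_happens)
    then show False using xz(5)[OF z0F, of "r (r' n)"] by (simp add: commute)
  qed
  have W_open: "\<exists>k. \<forall>v. W k y v \<longrightarrow> v \<in> U" if U: "openin X U" "y \<in> U" for U y
  proof (rule ccontr)
    assume "\<not> ?thesis"
    then have "\<forall>k. \<exists>x a. x \<in> M \<and> f x \<notin> U \<and> a \<in> F y \<and> d a x < (1 / 2) ^ k"
      unfolding W_def using F_ne F_M by (metis ex_in_conv)
    then obtain x a where xa: "\<And>k. x k \<in> M" "\<And>k. f (x k) \<notin> U" "\<And>k. a k \<in> F y" "\<And>k::nat. d (a k) (x k) < (1 / 2) ^ k" by metis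
    have "y \<in> ?Y" using U openin_subset by blast
    from shadow[OF this xa(3,1,4)] obtain r :: "nat \<Rightarrow> nat" where "limitin X (f \<circ> x \<circ> r) y sequentially" by blast
    then have "\<forall>\<^sub>F n in sequentially. (f \<circ> x \<circ> r) n \<in> U" using U unfolding limitin_def by blast
    then show False using xa(2) by (auto dest!: eventually_happens)
  qed
  have W_mono: "W j y v" if "W k y v" "j \<le> k" for j k y v
  proof -
    have "(1 / 2 :: real) ^ k \<le> (1 / 2) ^ j" using that(2) by (intro power_decreasing) auto
    then show ?thesis using that(1) unfolding W_def by (meson less_le_trans)
  qed
  have W_refl: "W k y y" if "y \<in> ?Y" for k y
    using that F_M unfolding W_def by (intro conjI ballI bexI) auto
  have W_Y: "v \<in> ?Y" if "W k y v" for k y v using that unfolding W_def by blast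
  \<comment> \<open>Frink's condition, which lets the radius depend on the point y\<close>
  have frink: "\<exists>m>k. \<forall>y'\<in>?Y. (\<exists>z. W m y z \<and> W m y' z) \<longrightarrow> (\<forall>v. W m y' v \<longrightarrow> W k y v)" if y: "y \<in> ?Y" for y k
  proof -
    have "(1 / 2 :: real) ^ Suc k > 0" by simp
    from fibre_close[OF y this] obtain m0 :: nat where m0: "\<And>v x a z. v \<in> ?Y \<Longrightarrow> x \<in> F v \<Longrightarrow> a \<in> F y \<Longrightarrow> d a x < (1 / 2) ^ m0 \<Longrightarrow>
        z \<in> F v \<Longrightarrow> \<exists>a\<in>F y. d a z < (1 / 2) ^ Suc k" by blast
    define m where "m = max (Suc m0) (Suc k)"
    have pm: "(1 / 2 :: real) ^ m \<le> (1 / 2) ^ Suc m0" "(1 / 2 :: real) ^ m \<le> (1 / 2) ^ Suc k"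
      unfolding m_def by (intro power_decreasing; simp)+
    have "W k y v" if y': "y' \<in> ?Y" and z: "W m y z" "W m y' z" and v: "W m y' v" for y' z v
    proof -
      obtain x where x: "x \<in> F z" using F_ne[OF W_Y[OF z(1)]] by blast
      obtain a where a: "a \<in> F y" "d a x < (1 / 2) ^ m" using z(1) x unfolding W_def by blast
      obtain b where b: "b \<in> F y'" "d b x < (1 / 2) ^ m" using z(2) x unfolding W_def by blast
      have "d a b < (1 / 2) ^ m0"
        using triangle'[OF F_M(1)[OF a(1)] F_M(1)[OF x] F_M(1)[OF b(1)]] a(2) b(2) pm(1)[unfolded power_Suc]
        by linarith
      then have near: "\<exists>a\<in>F y. d a w < (1 / 2) ^ Suc k" if "w \<in> F y'" for w
        using m0[OF y' b(1) a(1)] that by blast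
      have "\<exists>a\<in>F y. d a u < (1 / 2) ^ k" if u: "u \<in> F v" for u
      proof -
        obtain w where w: "w \<in> F y'" "d w u < (1 / 2) ^ m" using v u unfolding W_def by blast
        obtain a' where a': "a' \<in> F y" "d a' w < (1 / 2) ^ Suc k" using near[OF w(1)] by blast
        have "d a' u \<le> d a' w + d w u" using triangle F_M(1)[OF a'(1)] F_M(1)[OF w(1)] F_M(1)[OF u] by blast
        then have "d a' u < (1 / 2) ^ k"
          using a'(2) w(2) pm(2)[unfolded power_Suc] unfolding power_Suc by linarith
        then show ?thesis using a'(1) by blast
      qed
      then show ?thesis using W_Y[OF v] unfolding W_def by blast
    qed
    moreover have "m > k" unfolding m_def by simp
    ultimately show ?thesis by blast
  qed
  then obtain m where m: "\<And>y k. y \<in> ?Y \<Longrightarrow> m y k > k"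
    "\<And>y k y' z v. y \<in> ?Y \<Longrightarrow> y' \<in> ?Y \<Longrightarrow> W (m y k) y z \<Longrightarrow> W (m y k) y' z \<Longrightarrow> W (m y k) y' v \<Longrightarrow> W k y v"
    by metis
  \<comment> \<open>Shrinking along m makes the cover at level Suc k refine the one at level k in such a way that the union of two intersecting members lies in one member.\<close>
  define n where "n y k = (m y ^^ k) 0" for y k
  have n_Suc: "n y (Suc k) = m y (n y k)" for y k by (simp add: n_def)
  have n_ge: "k \<le> n y k" if "y \<in> ?Y" for y k
  proof (induction k)
    case (Suc k)
    then show ?case using m(1)[OF that, of "n y k"] by (simp add: n_Suc)
  qed simp
  define E where "E k u v \<longleftrightarrow> (\<exists>y\<in>?Y. W (n y k) y u \<and> W (n y k) y v)" for k u v
  have E_comp: "E k u w" if "E (Suc k) u v" "E (Suc k) v w" for k u v w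
  proof -
    obtain y where y: "y \<in> ?Y" "W (n y (Suc k)) y u" "W (n y (Suc k)) y v" using \<open>E (Suc k) u v\<close> unfolding E_def by blast
    obtain y' where y': "y' \<in> ?Y" "W (n y' (Suc k)) y' v" "W (n y' (Suc k)) y' w" using \<open>E (Suc k) v w\<close> unfolding E_def by blast
    have absorb: "W (n p k) p c"
      if "p \<in> ?Y" "p' \<in> ?Y" "n p (Suc k) \<le> n p' (Suc k)" "W (n p (Suc k)) p b" "W (n p' (Suc k)) p' b" "W (n p' (Suc k)) p' c" for p p' b c
      using m(2)[OF that(1,2), of "n p k" b c] that(4) W_mono[OF that(5,3)] W_mono[OF that(6,3)] by (simp add: n_Suc)
    have keep: "W (n p k) p b" if "p \<in> ?Y" "W (n p (Suc k)) p b" for p b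
      using W_mono[OF that(2)] m(1)[OF that(1), of "n p k"] by (simp add: n_Suc)
    show ?thesis
    proof (cases "n y (Suc k) \<le> n y' (Suc k)")
      case True
      then show ?thesis using absorb[OF y(1) y'(1) True y(3) y'(2,3)] keep[OF y(1,2)] y(1) unfolding E_def by blast
    next
      case False
      then have "n y' (Suc k) \<le> n y (Suc k)" by simp
      then show ?thesis using absorb[OF y'(1) y(1) _ y'(2) y(3,2)] keep[OF y'(1,3)] y'(1) unfolding E_def by blast
    qed
  qed
  have E_refl: "E k u u" if "u \<in> ?Y" for k u using that W_refl unfolding E_def by blast
  have E_sym: "E k v u" if "E k u v" for k u v using that unfolding E_def by blast
  have E_Y: "u \<in> ?Y" "v \<in> ?Y" if "E k u v" for k u v using that W_Y unfolding E_def by blast+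
  have E_Suc: "E k u v" if "E (Suc k) u v" for k u v
    using E_comp[OF that E_refl] E_Y[OF that] by blast
  have E_mono: "E j u v" if "E k u v" "j \<le> k" for j k u v
    using that(2,1) by (induction k rule: dec_induct) (use E_Suc in blast)+
  have E_W: "W k y v" if y: "y \<in> ?Y" and E: "E (m y k) y v" for y k v
  proof -
    obtain p where p: "p \<in> ?Y" "W (n p (m y k)) p y" "W (n p (m y k)) p v" using E unfolding E_def by blast
    have "W (m y k) p y" "W (m y k) p v" using W_mono p n_ge[OF p(1)] by blast+
    then show ?thesis using m(2)[OF y p(1) W_refl[OF y]] by blast
  qed
  have E_open: "\<exists>j. \<forall>v. E j y v \<longrightarrow> v \<in> U" if U: "openin X U" "y \<in> U" for U y
  proof -
    have "y \<in> ?Y" using U openin_subset by blast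
    then show ?thesis using W_open[OF U] E_W by meson
  qed
  \<comment> \<open>every second level, since the metrization lemma composes three entourages\<close>
  define E' where "E' k u v \<longleftrightarrow> k = 0 \<or> E (2 * k) u v" for k u v
  have E'_mono: "E j u v" if "E' k u v" "j \<le> k" "0 < k" for j k u v
    using that E_mono[of "2 * k" u v j] unfolding E'_def by simp
  obtain D where D: "Metric_space ?Y D"
    "\<And>x y k. x \<in> ?Y \<Longrightarrow> y \<in> ?Y \<Longrightarrow> E' k x y \<Longrightarrow> D x y \<le> (1 / 2) ^ k"
    "\<And>x y k. x \<in> ?Y \<Longrightarrow> y \<in> ?Y \<Longrightarrow> D x y < (1 / 2) ^ Suc k \<Longrightarrow> E' k x y"
  proof (rule metric_from_entourages[of ?Y E'])
    show "E' k x x" if "x \<in> ?Y" for k x using E_refl[OF that] unfolding E'_def by blast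
    show "E' k y x" if "E' k x y" for k x y using that E_sym unfolding E'_def by blast
    show "E' 0 x y" for x y unfolding E'_def by simp
    show "E' k x w" if "E' (Suc k) x y" "E' (Suc k) y z" "E' (Suc k) z w" for k x y z w
    proof -
      have "E (Suc (Suc (2 * k))) x y" "E (Suc (Suc (2 * k))) y z" "E (Suc (Suc (2 * k))) z w"
        using that unfolding E'_def by auto
      then have "E (2 * k) x w" using E_comp E_Suc by blast
      then show ?thesis unfolding E'_def by blast
    qed
    show "x = y" if xy: "x \<in> ?Y" "y \<in> ?Y" and E: "\<And>k. E' k x y" for x y
    proof (rule ccontr)
      assume "x \<noteq> y"
      then obtain U where U: "openin X U" "x \<in> U" "y \<notin> U"
        using H xy unfolding Hausdorff_space_def disjnt_iff by metis
      then obtain j where j: "\<And>v. E j x v \<Longrightarrow> v \<in> U" using E_open by blast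
      have "E j x y" using E'_mono[OF E[of "Suc j"], of j] by simp
      then show False using j U(3) by blast
    qed
  qed (use that in blast)
  interpret D: Metric_space ?Y D by (rule D)
  have fine: "openin D.mtopology U" if U: "openin X U" for U
    unfolding D.openin_mtopology
  proof (intro conjI allI impI)
    show "U \<subseteq> ?Y" by (rule openin_subset[OF U])
    fix y assume y: "y \<in> U"
    then obtain j where j: "\<And>v. E j y v \<Longrightarrow> v \<in> U" using E_open[OF U] by blast
    have "D.mball y ((1 / 2) ^ Suc (Suc j)) \<subseteq> U"
    proof
      fix v assume "v \<in> D.mball y ((1 / 2) ^ Suc (Suc j))"
      then have "E' (Suc j) y v" using D(3)[of y v "Suc j"] by auto
      then show "v \<in> U" using E'_mono[of "Suc j" y v j] j by simp
    qed
    then show "\<exists>r>0. D.mball y r \<subseteq> U" by (intro exI[of _ "(1 / 2) ^ Suc (Suc j)"]) auto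
  qed
  have cont_D: "continuous_map mtopology D.mtopology f"
    unfolding D.continuous_map_to_metric
  proof (intro ballI allI impI)
    fix x and e :: real assume "x \<in> topspace mtopology" and e: "e > 0"
    then have x: "x \<in> M" by simp
    note y = fY[OF x]
    obtain k where k: "(1 / 2) ^ k < e" using real_arch_pow_inv[of e "1 / 2"] e by auto
    have "(1 / 2 :: real) ^ n (f x) (2 * k) > 0" by simp
    from fibre_close[OF y this] obtain j :: nat where j: "\<And>v x' a z. v \<in> ?Y \<Longrightarrow> x' \<in> F v \<Longrightarrow> a \<in> F (f x) \<Longrightarrow>
        d a x' < (1 / 2) ^ j \<Longrightarrow> z \<in> F v \<Longrightarrow> \<exists>a\<in>F (f x). d a z < (1 / 2) ^ n (f x) (2 * k)" by blast
    have "f x' \<in> D.mball (f x) e" if x': "x' \<in> mball x ((1 / 2) ^ j)" for x'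
    proof -
      have x'M: "x' \<in> M" using x' by simp
      have "W (n (f x) (2 * k)) (f x) (f x')"
        using j[OF fY[OF x'M] in_F[OF x'M] in_F[OF x]] x' fY[OF x'M] unfolding W_def by auto
      then have "E' k (f x) (f x')" using W_refl[OF y] y unfolding E'_def E_def by blast
      then show ?thesis using D(2)[OF y fY[OF x'M]] k y fY[OF x'M] by fastforce
    qed
    then show "\<exists>U. openin mtopology U \<and> x \<in> U \<and> (\<forall>y\<in>U. f y \<in> D.mball (f x) e)"
      using x by (intro exI[of _ "mball x ((1 / 2) ^ j)"]) auto
  qed
  have "compactin D.mtopology K" if K: "compactin X K" for K
  proof -
    have "f ` (M \<inter> f -` K) = K"
    proof -
      have "K \<subseteq> f ` M" using compactin_subset_topspace[OF K] surj by simp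
      then show ?thesis by blast
    qed
    then show ?thesis using image_compactin[OF proper[OF K] cont_D] by simp
  qed
  then show thesis using that[OF D(1)] fine by blast
qed

section \<open>Measurable shadows of arbitrary functions\<close>

text \<open>The last property says that \<open>A\<close> has full outer measure in \<open>H\<close>: each non-negligible measurable part of
  \<open>H\<close> meets \<open>A\<close>.\<close>

lemma measurable_hull_exists:
  assumes "prob_space \<mu>" and A: "A \<subseteq> space \<mu>"
  obtains H where "H \<in> sets \<mu>" "A \<subseteq> H"
    "\<And>C. C \<in> sets \<mu> \<Longrightarrow> C \<subseteq> H \<Longrightarrow> C \<inter> A = {} \<Longrightarrow> measure \<mu> C = 0"
proof -
  interpret prob_space \<mu> by fact
  obtain H where H: "H \<in> sets \<mu>" "A \<subseteq> H" "outer_measure_of \<mu> A = emeasure \<mu> H"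
    using outer_measure_of_attain[OF A] by blast
  have "measure \<mu> C = 0" if C: "C \<in> sets \<mu>" "C \<subseteq> H" "C \<inter> A = {}" for C
  proof -
    have "emeasure \<mu> H \<le> emeasure \<mu> (H - C)"
    proof -
      have "A \<subseteq> H - C" using H(2) C(3) by blast
      then have "outer_measure_of \<mu> A \<le> outer_measure_of \<mu> (H - C)" by (rule outer_measure_of_mono)
      then show ?thesis using H(1,3) C(1) by simp
    qed
    then have "measure \<mu> H \<le> measure \<mu> (H - C)" by (simp add: emeasure_eq_measure)
    also have "\<dots> = measure \<mu> H - measure \<mu> C" by (rule finite_measure_Diff[OF H(1) C(1,2)])
    finally show ?thesis using measure_nonneg[of \<mu> C] by linarith
  qed
  then show thesis using that H by blast
qed

text \<open>The integer sequence \<open>h j y\<close> need not depend measurably on \<open>y\<close>. The sets \<open>Q w\<close> belong to a measurable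
  sequence that imitates it: \<open>Q w\<close> is contained in a measurable hull of the set \<open>A w\<close> where \<open>h\<close> has
  the prefix \<open>w\<close>. Consequently, in any measurable \<open>B\<close>, almost every point with new prefix \<open>w\<close> shares
  it with a point of \<open>B\<close> whose original prefix is \<open>w\<close>. It is essential that a single choice
  of \<open>Q\<close> serves all \<open>B\<close>.\<close>

lemma measurable_codes:
  fixes h :: "nat \<Rightarrow> 'a \<Rightarrow> nat"
  assumes "prob_space \<mu>"
  defines "A \<equiv> \<lambda>w. {y \<in> space \<mu>. \<forall>j<length w. h j y = rev w ! j}"
  obtains Q :: "nat list \<Rightarrow> 'a set" where "\<And>w. Q w \<in> sets \<mu>"
    "AE y in \<mu>. \<forall>k. \<exists>w. length w = k \<and> y \<in> Q w"
    "\<And>B. B \<in> sets \<mu> \<Longrightarrow> AE y in \<mu>. y \<in> B \<longrightarrow> (\<forall>w. y \<in> Q w \<longrightarrow> B \<inter> A w \<noteq> {})"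
    "\<And>i w. Q (i # w) \<subseteq> Q w" "\<And>v w y. y \<in> Q v \<Longrightarrow> y \<in> Q w \<Longrightarrow> length v = length w \<Longrightarrow> v = w"
proof -
  interpret prob_space \<mu> by fact
  have "\<exists>H. H \<in> sets \<mu> \<and> A w \<subseteq> H \<and> (\<forall>C\<in>sets \<mu>. C \<subseteq> H \<longrightarrow> C \<inter> A w = {} \<longrightarrow> measure \<mu> C = 0)" for w
  proof -
    have sub: "A w \<subseteq> space \<mu>" unfolding A_def by blast
    show ?thesis
      by (rule measurable_hull_exists[OF assms(1) sub]) blast
  qed
  then obtain H where H: "\<And>w. H w \<in> sets \<mu>" "\<And>w. A w \<subseteq> H w"
    and hull: "\<And>w C. C \<in> sets \<mu> \<Longrightarrow> C \<subseteq> H w \<Longrightarrow> C \<inter> A w = {} \<Longrightarrow> measure \<mu> C = 0"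
    by metis
  \<comment> \<open>among the hulls of the extensions of w, the point goes to the one with the least index\<close>
  define Q where "Q = rec_list (space \<mu>) (\<lambda>i w Qw. Qw \<inter> H (i # w) - (\<Union>i'<i. H (i' # w)))"
  have Q_simps: "Q [] = space \<mu>" "Q (i # w) = Q w \<inter> H (i # w) - (\<Union>i'<i. H (i' # w))" for i w
    unfolding Q_def by simp_all
  have Q_sets: "Q w \<in> sets \<mu>" for w
    by (induction w) (auto simp: Q_simps intro!: sets.Diff sets.Int sets.finite_UN H)
  have A_Cons: "A w = (\<Union>i. A (i # w))" for w
    unfolding A_def by (auto simp: nth_append less_Suc_eq)
  have Q_H: "Q w \<subseteq> H w" for w
  proof (cases w)
    case Nil
    have "A [] = space \<mu>" unfolding A_def by simp
    then show ?thesis using H(2)[of "[]"] Nil by (simp add: Q_simps)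
  qed (auto simp: Q_simps)
  have Q_unique: "v = w" if "y \<in> Q v" "y \<in> Q w" "length v = length w" for v w y
    using that
  proof (induction v arbitrary: w)
    case (Cons i v)
    then obtain i' w' where w: "w = i' # w'" by (cases w) auto
    have "v = w'" using Cons w by (auto simp: Q_simps)
    moreover have "\<not> i < i'" "\<not> i' < i" using Cons.prems(1,2) w \<open>v = w'\<close> by (auto simp: Q_simps)
    ultimately show ?case using w by simp
  qed simp
  have cover: "AE y in \<mu>. y \<in> H w \<longrightarrow> (\<exists>i. y \<in> H (i # w))" for w
  proof -
    let ?N = "H w - (\<Union>i. H (i # w))"
    have N: "?N \<in> sets \<mu>" using H(1) by (intro sets.Diff sets.countable_UN) auto
    have "?N \<inter> A w = {}" using A_Cons[of w] H(2) by blast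
    then have "measure \<mu> ?N = 0" by (intro hull[OF N]) auto
    then have "?N \<in> null_sets \<mu>" using N by (auto simp: null_sets_def emeasure_eq_measure)
    from AE_not_in[OF this] show ?thesis by eventually_elim auto
  qed
  then have "AE y in \<mu>. \<forall>w. y \<in> H w \<longrightarrow> (\<exists>i. y \<in> H (i # w))" by (intro AE_all_countable[THEN iffD2]) blast
  then have levels: "AE y in \<mu>. \<forall>k. \<exists>w. length w = k \<and> y \<in> Q w"
    using AE_space
  proof eventually_elim
    case (elim y)
    show ?case
    proof
      fix k
      show "\<exists>w. length w = k \<and> y \<in> Q w"
      proof (induction k)
        case 0
        show ?case using elim(2) by (intro exI[of _ "[]"]) (simp add: Q_simps)
      next
        case (Suc k)
        then obtain w where w: "length w = k" "y \<in> Q w" by blast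
        then have ex: "\<exists>i. y \<in> H (i # w)" using elim(1) Q_H by blast
        define i where "i = (LEAST i. y \<in> H (i # w))"
        have "y \<in> H (i # w)" unfolding i_def by (rule LeastI_ex[OF ex])
        moreover have "y \<notin> H (i' # w)" if "i' < i" for i' using not_less_Least[of i' "\<lambda>i. y \<in> H (i # w)"] that
          unfolding i_def by simp
        ultimately have "y \<in> Q (i # w)" using w(2) by (auto simp: Q_simps)
        then show ?case using w(1) by (intro exI[of _ "i # w"]) simp
      qed
    qed
  qed
  have meets: "AE y in \<mu>. y \<in> B \<longrightarrow> (\<forall>w. y \<in> Q w \<longrightarrow> B \<inter> A w \<noteq> {})" if B: "B \<in> sets \<mu>" for B
  proof -
    have "AE y in \<mu>. y \<in> B \<longrightarrow> y \<in> Q w \<longrightarrow> B \<inter> A w \<noteq> {}" for w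
    proof (cases "B \<inter> A w = {}")
      case True
      have BQ: "B \<inter> Q w \<in> sets \<mu>" using B Q_sets by auto
      have "measure \<mu> (B \<inter> Q w) = 0" using True Q_H by (intro hull[OF BQ]) auto
      then have "B \<inter> Q w \<in> null_sets \<mu>" using BQ by (auto simp: null_sets_def emeasure_eq_measure)
      from AE_not_in[OF this] show ?thesis by eventually_elim auto
    qed simp
    then have "AE y in \<mu>. \<forall>w. y \<in> B \<longrightarrow> y \<in> Q w \<longrightarrow> B \<inter> A w \<noteq> {}" by (intro AE_all_countable[THEN iffD2]) blast
    then show ?thesis by eventually_elim blast
  qed
  show thesis
    by (rule that[of Q]) (use Q_sets levels meets Q_unique in \<open>auto simp: Q_simps\<close>)
qed

lemma (in Metric_space) compactin_imp_countable_dense: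
  assumes "compactin mtopology K"
  obtains D where "countable D" "D \<subseteq> M" "\<And>x \<epsilon>. x \<in> K \<Longrightarrow> \<epsilon> > 0 \<Longrightarrow> \<exists>c\<in>D. d c x < \<epsilon>"
proof -
  have KM: "K \<subseteq> M" using assms compactin_subset_topspace by fastforce
  have "\<exists>F. finite F \<and> F \<subseteq> K \<and> K \<subseteq> (\<Union>x\<in>F. mball x (1 / Suc n))" for n
    using compactin_imp_mtotally_bounded[OF assms] unfolding mtotally_bounded_def by simp
  then obtain F where F: "\<And>n::nat. finite (F n)" "\<And>n. F n \<subseteq> K" "\<And>n. K \<subseteq> (\<Union>x\<in>F n. mball x (1 / Suc n))"
    by metis
  show thesis
  proof (rule that[of "\<Union>n. F n"])
    show "countable (\<Union>n. F n)" using F(1) by (auto intro: countable_finite)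
    show "(\<Union>n. F n) \<subseteq> M" using F(2) KM by blast
    fix x and e :: real assume x: "x \<in> K" "e > 0"
    then obtain n where n: "1 / Suc n < e" using nat_approx_posE by blast
    obtain c where "c \<in> F n" "d c x < 1 / Suc n" using F(3)[of n] x(1) by auto
    then show "\<exists>c\<in>(\<Union>n. F n). d c x < e" using n by (intro bexI[of _ c]) auto
  qed
qed

text \<open>A substitute for a measurable selection: \<open>s\<close> is replaced by a measurable \<open>\<sigma>\<close> whose values on a
  measurable set \<open>B\<close> remain in the closure of \<open>s ` B\<close>. The values of \<open>s\<close> are coded by the indices of nearby
  members of a countable dense set, the codes are made measurable, and the new codes are
  decoded.\<close>

lemma (in Metric_space) measurable_shadow:
  assumes mu: "prob_space \<mu>" and sM: "\<And>y. y \<in> space \<mu> \<Longrightarrow> s y \<in> M"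
    and tight: "\<And>\<epsilon>. \<epsilon> > 0 \<Longrightarrow> \<exists>B\<in>sets \<mu>. measure \<mu> (space \<mu> - B) < \<epsilon> \<and> compactin mtopology (mtopology closure_of (s ` B))"
  obtains \<sigma> where "\<sigma> \<in> measurable \<mu> (borel_of mtopology)"
    "\<And>B. B \<in> sets \<mu> \<Longrightarrow> compactin mtopology (mtopology closure_of (s ` B)) \<Longrightarrow>
      AE y in \<mu>. y \<in> B \<longrightarrow> \<sigma> y \<in> mtopology closure_of (s ` B)"
proof -
  interpret prob_space \<mu> by fact
  have "\<exists>B\<in>sets \<mu>. measure \<mu> (space \<mu> - B) < 1 / Suc n \<and> compactin mtopology (mtopology closure_of (s ` B))" for n :: nat
    by (rule tight) simp
  then obtain B where B: "\<And>n. B n \<in> sets \<mu>" "\<And>n::nat. measure \<mu> (space \<mu> - B n) < 1 / Suc n"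
    "\<And>n. compactin mtopology (mtopology closure_of (s ` B n))" by metis
  have "\<exists>D. countable D \<and> D \<subseteq> M \<and> (\<forall>x\<in>mtopology closure_of (s ` B n). \<forall>\<epsilon>>0. \<exists>c\<in>D. d c x < \<epsilon>)" for n
    using compactin_imp_countable_dense[OF B(3)[of n]] by metis
  then obtain D where D: "\<And>n. countable (D n)" "\<And>n. D n \<subseteq> M"
    "\<And>n x \<epsilon>. x \<in> mtopology closure_of (s ` B n) \<Longrightarrow> \<epsilon> > 0 \<Longrightarrow> \<exists>c\<in>D n. d c x < \<epsilon>" by metis
  have in_closure: "s y \<in> mtopology closure_of (s ` C)" if "C \<in> sets \<mu>" "y \<in> C" for y C
  proof -
    have "s ` C \<subseteq> topspace mtopology" using sM sets.sets_into_space[OF that(1)] by auto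
    from closure_of_subset[OF this] show ?thesis using that(2) by blast
  qed
  obtain y0 where y0: "y0 \<in> space \<mu>" using not_empty by blast
  define D' where "D' = insert (s y0) (\<Union>n. D n)"
  have D': "countable D'" "D' \<noteq> {}" "D' \<subseteq> M" unfolding D'_def using D sM[OF y0] by auto
  define c where "c = from_nat_into D'"
  have cM: "c i \<in> M" for i unfolding c_def using from_nat_into[OF D'(2)] D'(3) by blast
  define Y where "Y = (\<Union>n. B n)"
  have Y: "Y \<in> sets \<mu>" unfolding Y_def using B(1) by auto
  have dense: "\<exists>i. d (c i) (s y) < e" if y: "y \<in> Y" and e: "e > 0" for y e
  proof -
    obtain n where n: "y \<in> B n" using y unfolding Y_def by blast
    from in_closure[OF B(1) n] obtain b where b: "b \<in> D n" "d b (s y) < e" using D(3) e by blast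
    have "b \<in> range c" unfolding c_def range_from_nat_into[OF D'(2,1)] using b(1) unfolding D'_def by blast
    then show ?thesis using b(2) by blast
  qed
  define h where "h j y = (LEAST i. d (c i) (s y) < (1 / 2) ^ j)" for j y
  have h: "d (c (h j y)) (s y) < (1 / 2) ^ j" if "y \<in> Y" for j y
    unfolding h_def by (rule LeastI_ex) (use dense[OF that] in simp)
  define A where "A w = {y \<in> space \<mu>. \<forall>j<length w. h j y = rev w ! j}" for w
  obtain Q :: "nat list \<Rightarrow> 'b set" where Q: "\<And>w. Q w \<in> sets \<mu>"
    "AE y in \<mu>. \<forall>k. \<exists>w. length w = k \<and> y \<in> Q w"
    "\<And>B. B \<in> sets \<mu> \<Longrightarrow> AE y in \<mu>. y \<in> B \<longrightarrow> (\<forall>w. y \<in> Q w \<longrightarrow> B \<inter> A w \<noteq> {})"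
    "\<And>i w. Q (i # w) \<subseteq> Q w" "\<And>v w y. y \<in> Q v \<Longrightarrow> y \<in> Q w \<Longrightarrow> length v = length w \<Longrightarrow> v = w"
    by (rule measurable_codes[OF mu, where h = h, folded A_def]) (rule that)
  let ?codes = "\<lambda>y x. \<forall>i w. y \<in> Q (i # w) \<longrightarrow> d (c i) x \<le> (1 / 2) ^ length w"
  have Y_full: "AE y in \<mu>. y \<in> Y"
  proof (rule AE_all_epsilonI)
    show "finite_measure \<mu>" by unfold_locales
    fix e :: real assume "e > 0"
    then obtain n where "1 / Suc n < e" using nat_approx_posE by blast
    then show "\<exists>B\<in>sets \<mu>. measure \<mu> (space \<mu> - B) \<le> e \<and> (AE y in \<mu>. y \<in> B \<longrightarrow> y \<in> Y)"
      using B(1,2)[of n] unfolding Y_def by (intro bexI[of _ "B n"] conjI) auto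
  qed
  \<comment> \<open>every prefix of the new code is realized by a value of s on C, so the code converges in the closure\<close>
  have lim: "AE y in \<mu>. y \<in> C \<longrightarrow> (\<exists>x\<in>mtopology closure_of (s ` C). ?codes y x)"
    if C: "C \<in> sets \<mu>" "compactin mtopology (mtopology closure_of (s ` C))" for C
  proof -
    have CY: "C \<inter> Y \<in> sets \<mu>" using C(1) Y by blast
    show ?thesis
      using Q(3)[OF CY] Q(2) Y_full
    proof eventually_elim
      case (elim y)
      show ?case
      proof
        assume "y \<in> C"
        then have meet: "\<And>w. y \<in> Q w \<Longrightarrow> C \<inter> Y \<inter> A w \<noteq> {}" using elim(1,3) by blast
        obtain v where v: "\<And>k. length (v k) = k" "\<And>k. y \<in> Q (v k)" using elim(2) by metis
        define a where "a j = hd (v (Suc j))" for j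
        have v_Suc: "v (Suc j) = a j # v j" for j
        proof -
          obtain i w where iw: "v (Suc j) = i # w" using v(1)[of "Suc j"] by (cases "v (Suc j)") auto
          have "y \<in> Q w" using v(2)[of "Suc j"] Q(4)[of i w] iw by auto
          then have "w = v j" using v(1)[of "Suc j"] v(1)[of j] iw by (intro Q(5)[OF _ v(2)]) auto
          then show ?thesis using iw by (simp add: a_def)
        qed
        have v_rev: "rev (v k) = map a [0..<k]" for k
          by (induction k) (use v(1)[of 0] v_Suc in auto)
        have "\<exists>x\<in>mtopology closure_of (s ` C). \<forall>j::nat. d (c (a j)) x \<le> (1 / 2) ^ j"
        proof (rule nested_balls_meet_compact[OF C(2) cM])
          fix k
          obtain z where z: "z \<in> C" "z \<in> Y" "z \<in> A (v k)" using meet[OF v(2)[of k]] by blast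
          have "d (c (a j)) (s z) \<le> (1 / 2) ^ j" if "j < k" for j
          proof -
            have "h j z = a j" using z(3) that v(1)[of k] unfolding A_def v_rev by auto
            then show ?thesis using h[OF z(2), of j] by simp
          qed
          moreover have "s z \<in> mtopology closure_of (s ` C)" by (rule in_closure[OF C(1) z(1)])
          ultimately show "\<exists>x\<in>mtopology closure_of (s ` C). \<forall>j<k. d (c (a j)) x \<le> (1 / 2) ^ j" by blast
        qed
        then obtain x where x: "x \<in> mtopology closure_of (s ` C)" "\<And>j::nat. d (c (a j)) x \<le> (1 / 2) ^ j" by blast
        have "d (c i) x \<le> (1 / 2) ^ length w" if "y \<in> Q (i # w)" for i w
        proof -
          have "i # w = v (Suc (length w))" using v by (intro Q(5)[OF that]) auto
          then show ?thesis using x(2)[of "length w"] v_Suc by simp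
        qed
        then show "\<exists>x\<in>mtopology closure_of (s ` C). ?codes y x"
          using x(1) by blast
      qed
    qed
  qed
  have clM: "mtopology closure_of T \<subseteq> M" for T using closure_of_subset_topspace by force
  have exM: "AE y in \<mu>. \<exists>x\<in>M. ?codes y x"
  proof (rule AE_all_epsilonI)
    show "finite_measure \<mu>" by unfold_locales
    fix e :: real assume "e > 0"
    then obtain n where n: "1 / Suc n < e" using nat_approx_posE by blast
    have "AE y in \<mu>. y \<in> B n \<longrightarrow> (\<exists>x\<in>M. ?codes y x)"
      using lim[OF B(1,3)[of n]] by eventually_elim (use clM in blast)
    then show "\<exists>B\<in>sets \<mu>. measure \<mu> (space \<mu> - B) \<le> e \<and>
        (AE y in \<mu>. y \<in> B \<longrightarrow> (\<exists>x\<in>M. ?codes y x))"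
      using B(1,2)[of n] n by (intro bexI[of _ "B n"] conjI) auto
  qed
  have fine: "\<exists>i w. y \<in> Q (i # w) \<and> (1 / 2) ^ length w < e"
    if lev: "\<forall>k. \<exists>w. length w = k \<and> y \<in> Q w" and "e > 0" for y and e :: real
  proof -
    obtain k where k: "(1 / 2) ^ k < e" using real_arch_pow_inv[of e "1 / 2"] \<open>e > 0\<close> by auto
    obtain v where v: "length v = Suc k" "y \<in> Q v" using lev by blast
    then obtain i w where "v = i # w" by (cases v) auto
    then show ?thesis using v k by auto
  qed
  have "M \<noteq> {}" using sM[OF y0] by blast
  have "\<exists>\<sigma>\<in>measurable \<mu> (borel_of mtopology).
      AE y in \<mu>. \<forall>v\<in>{v. v \<noteq> []}. y \<in> Q v \<longrightarrow> d (c (hd v)) (\<sigma> y) \<le> (1 / 2) ^ (length v - 1)"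
  proof (rule measurable_coded_point)
    show "AE y in \<mu>. (\<forall>\<epsilon>>0. \<exists>v\<in>{v. v \<noteq> []}. y \<in> Q v \<and> (1 / 2 :: real) ^ (length v - 1) < \<epsilon>) \<and>
        (\<exists>x\<in>M. \<forall>v\<in>{v. v \<noteq> []}. y \<in> Q v \<longrightarrow> d (c (hd v)) x \<le> (1 / 2) ^ (length v - 1))"
      using exM Q(2)
    proof eventually_elim
      case (elim y)
      have f1: "\<exists>v\<in>{v. v \<noteq> []}. y \<in> Q v \<and> (1 / 2) ^ (length v - 1) < e" if "e > 0" for e :: real
        using fine[OF elim(2) that] by force
      obtain x where x: "x \<in> M" "\<And>i w. y \<in> Q (i # w) \<Longrightarrow> d (c i) x \<le> (1 / 2) ^ length w"
        using elim(1) by blast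
      have f2: "d (c (hd v)) x \<le> (1 / 2) ^ (length v - 1)" if "v \<noteq> []" "y \<in> Q v" for v
        using x(2)[of "hd v" "tl v"] that by simp
      show ?case by (intro conjI allI impI f1 bexI[OF _ x(1)] ballI f2; simp)
    qed
  qed (use Q(1) cM \<open>M \<noteq> {}\<close> in auto)
  then obtain \<sigma> where \<sigma>: "\<sigma> \<in> measurable \<mu> (borel_of mtopology)"
    "AE y in \<mu>. \<forall>v\<in>{v. v \<noteq> []}. y \<in> Q v \<longrightarrow> d (c (hd v)) (\<sigma> y) \<le> (1 / 2) ^ (length v - 1)" by blast
  have "AE y in \<mu>. y \<in> C \<longrightarrow> \<sigma> y \<in> mtopology closure_of (s ` C)"
    if C: "C \<in> sets \<mu>" "compactin mtopology (mtopology closure_of (s ` C))" for C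
    using lim[OF C] \<sigma>(2) Q(2) AE_space
  proof eventually_elim
    case (elim y)
    show ?case
    proof
      assume "y \<in> C"
      then obtain x where x: "x \<in> mtopology closure_of (s ` C)" "\<And>i w. y \<in> Q (i # w) \<Longrightarrow> d (c i) x \<le> (1 / 2) ^ length w"
        using elim(1) by blast
      have "x = \<sigma> y"
      proof (rule points_equal_if_close)
        show "x \<in> M" using x(1) clM by blast
        show "\<sigma> y \<in> M" using measurable_space[OF \<sigma>(1) elim(4)] by simp
        fix e :: real assume "e > 0"
        then obtain i w where iw: "y \<in> Q (i # w)" "(1 / 2) ^ length w < e" using fine[OF elim(3)] by blast
        have "d (c i) (\<sigma> y) \<le> (1 / 2) ^ length w" using elim(2) iw(1) by force
        then show "\<exists>b\<in>M. \<exists>e'<e. d b x \<le> e' \<and> d b (\<sigma> y) \<le> e'"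
          using x(2)[OF iw(1)] iw(2) cM by blast
      qed
      then show "\<sigma> y \<in> mtopology closure_of (s ` C)" using x(1) by simp
    qed
  qed
  then show thesis using that \<sigma>(1) by blast
qed

section \<open>The three Skorohod properties\<close>

lemma limitin_radon_topologyD:
  assumes "limitin (radon_topology X) \<mu> \<mu>0 F"
  shows "\<mu>0 \<in> radon_probs X"
    and "openin X U \<Longrightarrow> a < measure \<mu>0 U \<Longrightarrow> \<forall>\<^sub>F n in F. a < measure (\<mu> n) U"
proof -
  show mu0: "\<mu>0 \<in> radon_probs X" using assms by (simp add: limitin_def topspace_radon_topology)
  assume U: "openin X U" "a < measure \<mu>0 U"
  have "openin (radon_topology X) {\<mu> \<in> radon_probs X. a < measure \<mu> U}"
    unfolding radon_topology_def by (rule topology_generated_by_Basis) (use U(1) in blast)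
  then have "\<forall>\<^sub>F n in F. \<mu> n \<in> {\<mu> \<in> radon_probs X. a < measure \<mu> U}"
    using assms U(2) mu0 unfolding limitin_def by blast
  then show "\<forall>\<^sub>F n in F. a < measure (\<mu> n) U" by eventually_elim simp
qed

lemma distr_unit_lebesgue_eq_radonI:
  assumes H: "Hausdorff_space X" and mu: "\<mu> \<in> radon_probs X" and \<xi>: "\<xi> \<in> measurable unit_lebesgue (borel_of X)"
    and le: "\<And>K. compactin X K \<Longrightarrow> measure \<mu> K \<le> measure unit_lebesgue (\<xi> -` K \<inter> space unit_lebesgue)"
  shows "distr unit_lebesgue (borel_of X) \<xi> = \<mu>"
proof (rule radon_prob_eqI[OF H mu])
  interpret L: prob_space unit_lebesgue by (rule prob_space_unit_lebesgue)
  show "prob_space (distr unit_lebesgue (borel_of X) \<xi>)" by (rule L.prob_space_distr[OF \<xi>])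
  show "sets (distr unit_lebesgue (borel_of X) \<xi>) = sets (borel_of X)" by simp
  show "measure \<mu> K \<le> measure (distr unit_lebesgue (borel_of X) \<xi>) K" if "compactin X K" for K
    using le[OF that] by (simp add: measure_distr[OF \<xi> compactin_borel_of[OF H that]])
qed

lemma metrizable_strong_skorohod:
  assumes "metrizable_space X"
  shows "strong_skorohod X"
proof -
  obtain M d where M: "Metric_space M d" and X: "X = Metric_space.mtopology M d"
    using assms unfolding metrizable_space_def by blast
  interpret Metric_space M d by (rule M)
  obtain code where "skorohod_code M d code" using skorohod_code_exists by blast
  then interpret skorohod_code M d code .
  have tight: "\<mu> \<in> tight_probs mtopology" if "\<mu> \<in> radon_probs mtopology" for \<mu>
    using that radon_probs_subset_tight_probs by blast
  have "skorohod_parametrization mtopology code"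
    unfolding skorohod_parametrization_def
    by (intro ballI conjI measurable_code distr_unit_lebesgue_eq_radonI Hausdorff_space_mtopology code_in_compact tight)
  moreover have "AE t in unit_lebesgue. limitin mtopology (\<lambda>n. code (\<mu> n) t) (code \<mu>0 t) sequentially"
    if "range \<mu> \<subseteq> radon_probs mtopology" "limitin (radon_topology mtopology) \<mu> \<mu>0 sequentially" for \<mu> \<mu>0
    using that(1) by (intro code_tendsto tight limitin_radon_topologyD[OF that(2)]) auto
  ultimately show ?thesis unfolding strong_skorohod_def X by blast
qed

lemma compactin_imp_precompactin:
  "Hausdorff_space X \<Longrightarrow> compactin X K \<Longrightarrow> precompactin X K"
  unfolding precompactin_def
  by (simp add: closure_of_closedin compactin_imp_closedin compactin_subset_topspace)

locale metric_refinement = Metric_space "topspace X" D for X :: "'a topology" and D +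
  assumes H: "Hausdorff_space X"
    and fine: "openin X U \<Longrightarrow> openin mtopology U"
    and compact_fine: "compactin X K \<Longrightarrow> compactin mtopology K"
begin

lemma continuous_id: "continuous_map mtopology X (\<lambda>x. x)"
proof -
  have "{x \<in> topspace X. x \<in> U} = U" if "openin X U" for U using openin_subset[OF that] by auto
  then show ?thesis using fine by (auto simp: continuous_map_def)
qed

lemma compactin_iff: "compactin mtopology K \<longleftrightarrow> compactin X K"
  using image_compactin[OF _ continuous_id, of K] compact_fine by auto

lemma compactin_Diff_open: "compactin X K \<Longrightarrow> openin mtopology U \<Longrightarrow> compactin X (K - U)"
proof -
  assume K: "compactin X K" and U: "openin mtopology U"
  have "closedin mtopology (topspace X - U)" using U by (simp add: openin_closedin_eq)
  then have "compactin mtopology (K \<inter> (topspace X - U))"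
    using compact_fine[OF K] by (metis compact_Int_closedin)
  moreover have "K \<inter> (topspace X - U) = K - U" using compactin_subset_topspace[OF K] by auto
  ultimately show ?thesis using compactin_iff by simp
qed

text \<open>The finer topology may have more Borel sets. The measure extends to them because up to
  null sets they are Borel sets of \<open>X\<close>: on a compact set both topologies agree, and countably many compact sets
  carry the measure. The completion takes care of the rest.\<close>

definition refine :: "'a measure \<Rightarrow> 'a measure" where
  "refine \<mu> = distr (completion \<mu>) (borel_of mtopology) (\<lambda>x. x)"

lemma measurable_refine:
  assumes mu: "\<mu> \<in> tight_probs X"
  shows "(\<lambda>x. x) \<in> measurable (completion \<mu>) (borel_of mtopology)"
proof (rule measurable_borel_ofI)
  show "x \<in> topspace mtopology" if "x \<in> space (completion \<mu>)" for x
    using that tight_probsD(3)[OF mu] by simp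
  fix U assume U: "openin mtopology U"
  interpret prob_space \<mu> by (rule tight_probsD[OF mu])
  have "\<exists>K. compactin X K \<and> measure \<mu> (topspace X - K) < 1 / Suc n" for n :: nat
    by (rule tight_probs_compact[OF mu, of "1 / Suc n"]) auto
  then obtain K where K: "\<And>n. compactin X (K n)" "\<And>n::nat. measure \<mu> (topspace X - K n) < 1 / Suc n" by metis
  have Ks: "K n \<in> sets \<mu>" "K n - U \<in> sets \<mu>" for n
    using compactin_borel_of[OF H] K(1) compactin_Diff_open[OF K(1) U] tight_probsD(2)[OF mu] by simp_all
  have "AE x in \<mu>. x \<in> (\<Union>n. K n)"
  proof (rule AE_all_epsilonI)
    show "finite_measure \<mu>" by unfold_locales
    fix e :: real assume "e > 0"
    then obtain n where "1 / Suc n < e" using nat_approx_posE by blast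
    then show "\<exists>B\<in>sets \<mu>. measure \<mu> (space \<mu> - B) \<le> e \<and> (AE x in \<mu>. x \<in> B \<longrightarrow> x \<in> (\<Union>n. K n))"
      using K(2)[of n] Ks tight_probsD(3)[OF mu] by (intro bexI[of _ "K n"] conjI) auto
  qed
  then obtain N where N: "{x \<in> space \<mu>. x \<notin> (\<Union>n. K n)} \<subseteq> N" "N \<in> null_sets \<mu>"
    unfolding eventually_ae_filter by blast
  have "U - (\<Union>n. K n) \<in> null_sets (completion \<mu>)"
  proof (rule null_sets_completion_subset)
    show "N \<in> null_sets (completion \<mu>)" using N(2) by (rule null_sets_completionI)
    show "U - (\<Union>n. K n) \<subseteq> N" using N(1) openin_subset[OF U] tight_probsD(3)[OF mu] by auto
  qed
  moreover have "(\<Union>n. K n - (K n - U)) \<in> sets (completion \<mu>)" using Ks by (intro sets_completionI_sets sets.countable_UN) auto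
  ultimately have "(U - (\<Union>n. K n)) \<union> (\<Union>n. K n - (K n - U)) \<in> sets (completion \<mu>)"
    by (intro sets.Un) (auto simp: null_sets_def)
  moreover have "(\<lambda>x. x) -` U \<inter> space (completion \<mu>) = (U - (\<Union>n. K n)) \<union> (\<Union>n. K n - (K n - U))"
    using openin_subset[OF U] tight_probsD(3)[OF mu] by auto
  ultimately show "(\<lambda>x. x) -` U \<inter> space (completion \<mu>) \<in> sets (completion \<mu>)" by simp
qed

lemma measure_refine:
  assumes mu: "\<mu> \<in> tight_probs X" and B: "B \<in> sets \<mu>" "B \<in> sets (borel_of mtopology)"
  shows "measure (refine \<mu>) B = measure \<mu> B"
proof -
  have "(\<lambda>x. x) -` B \<inter> space (completion \<mu>) = B" using sets.sets_into_space[OF B(1)] by auto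
  then show ?thesis
    using measure_distr[OF measurable_refine[OF mu] B(2)] measure_completion[OF B(1)] by (simp add: refine_def)
qed

lemma measure_refine_compact:
  assumes mu: "\<mu> \<in> tight_probs X" and K: "compactin X K"
  shows "measure (refine \<mu>) K = measure \<mu> K" "measure (refine \<mu>) (topspace X - K) = measure \<mu> (topspace X - K)"
proof -
  have Ks: "K \<in> sets \<mu>" using compactin_borel_of[OF H K] tight_probsD(2)[OF mu] by simp
  have Kt: "K \<in> sets (borel_of mtopology)"
    by (rule compactin_borel_of[OF Hausdorff_space_mtopology compact_fine[OF K]])
  show "measure (refine \<mu>) K = measure \<mu> K" by (rule measure_refine[OF mu Ks Kt])
  show "measure (refine \<mu>) (topspace X - K) = measure \<mu> (topspace X - K)"
    using sets.compl_sets[OF Ks] sets.compl_sets[OF Kt] tight_probsD(3)[OF mu] by (intro measure_refine[OF mu]) simp_all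
qed

lemma uniformly_tight_refine:
  assumes "\<M> \<subseteq> tight_probs X" "uniformly_tight X \<M>"
  shows "uniformly_tight mtopology (refine ` \<M>)"
  unfolding uniformly_tight_def
proof (intro allI impI)
  fix e :: real assume "e > 0"
  then obtain K where K: "compactin X K" "\<And>\<mu>. \<mu> \<in> \<M> \<Longrightarrow> measure \<mu> (topspace X - K) < e"
    using assms(2) unfolding uniformly_tight_def by blast
  show "\<exists>K. compactin mtopology K \<and> (\<forall>\<nu>\<in>refine ` \<M>. measure \<nu> (topspace mtopology - K) < e)"
    using compact_fine[OF K(1)] K(2) measure_refine_compact(2)[OF subsetD[OF assms(1)] K(1)]
    by (intro exI[of _ K]) auto
qed

lemma refine_tight:
  assumes "\<mu> \<in> tight_probs X"
  shows "refine \<mu> \<in> tight_probs mtopology"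
proof -
  interpret prob_space \<mu> by (rule tight_probsD[OF assms])
  interpret C: prob_space "completion \<mu>" by (rule prob_space_completion)
  have "uniformly_tight X {\<mu>}" using assms unfolding tight_probs_def by blast
  then have "uniformly_tight mtopology {refine \<mu>}" using uniformly_tight_refine[of "{\<mu>}"] assms by simp
  moreover have "prob_space (refine \<mu>)" unfolding refine_def by (rule C.prob_space_distr[OF measurable_refine[OF assms]])
  ultimately show ?thesis unfolding tight_probs_def by (simp add: refine_def)
qed

text \<open>On a compact \<open>K\<close> that carries almost all of every \<open>\<mu> n\<close> the open set \<open>U\<close> of the finer topology
  coincides with an open set \<open>V\<close> of \<open>X\<close>.\<close>

lemma refine_weak_limit:
  assumes mu: "\<And>n. \<mu> n \<in> tight_probs X" and mu0: "\<mu>0 \<in> tight_probs X"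
    and ut: "uniformly_tight X (range \<mu>)"
    and op: "\<And>U a. openin X U \<Longrightarrow> a < measure \<mu>0 U \<Longrightarrow> \<forall>\<^sub>F n in sequentially. a < measure (\<mu> n) U"
    and U: "openin mtopology U" "a < measure (refine \<mu>0) U"
  shows "\<forall>\<^sub>F n in sequentially. a < measure (refine (\<mu> n)) U"
proof -
  define e where "e = (measure (refine \<mu>0) U - a) / 3"
  have "e > 0" using U(2) by (simp add: e_def)
  then obtain K where K: "compactin X K" "\<And>n. measure (\<mu> n) (topspace X - K) < e"
    using ut unfolding uniformly_tight_def by fastforce
  have tail0: "measure \<mu>0 (topspace X - K) \<le> e"
  proof (rule ccontr)
    assume "\<not> ?thesis"
    then have "\<forall>\<^sub>F n in sequentially. e < measure (\<mu> n) (topspace X - K)"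
      using compactin_imp_closedin[OF H K(1)] by (intro op) auto
    then show False using K(2) by (auto dest!: eventually_happens intro: less_asym)
  qed
  define V where "V = topspace X - (K - U)"
  have KU: "compactin X (K - U)" by (rule compactin_Diff_open[OF K(1) U(1)])
  have V: "openin X V" unfolding V_def using compactin_imp_closedin[OF H KU] by blast
  have KX: "K \<subseteq> topspace X" by (rule compactin_subset_topspace[OF K(1)])
  have UX: "U \<subseteq> topspace X" using openin_subset[OF U(1)] by simp
  have compare: "measure (refine \<nu>) U \<le> measure \<nu> V + measure \<nu> (topspace X - K)"
    "measure \<nu> V \<le> measure (refine \<nu>) U + measure \<nu> (topspace X - K)" if nu: "\<nu> \<in> tight_probs X" for \<nu>
  proof -
    interpret R: prob_space "refine \<nu>" by (rule tight_probsD[OF refine_tight[OF nu]])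
    have VT: "openin mtopology V" by (rule fine[OF V])
    have VB: "V \<in> sets \<nu>" "V \<in> sets (borel_of mtopology)"
      using openin_borel_of[OF V] openin_borel_of[OF VT] tight_probsD(2)[OF nu] by simp_all
    have sR: "sets (refine \<nu>) = sets (borel_of mtopology)" by (simp add: refine_def)
    have TK: "topspace X - K \<in> sets (refine \<nu>)" "U \<in> sets (refine \<nu>)" "V \<in> sets (refine \<nu>)"
      using VB openin_borel_of[OF U(1)] sets.compl_sets[OF compactin_borel_of[OF Hausdorff_space_mtopology compact_fine[OF K(1)]]]
      by (simp_all add: sR)
    have "measure (refine \<nu>) U \<le> measure (refine \<nu>) (V \<union> (topspace X - K))"
      by (rule R.finite_measure_mono[OF _ sets.Un[OF TK(3,1)]]) (use UX in \<open>auto simp: V_def\<close>)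
    also have "\<dots> \<le> measure (refine \<nu>) V + measure (refine \<nu>) (topspace X - K)"
      by (rule measure_Un_le[OF TK(3,1)])
    finally show "measure (refine \<nu>) U \<le> measure \<nu> V + measure \<nu> (topspace X - K)"
      by (simp add: measure_refine[OF nu VB] measure_refine_compact(2)[OF nu K(1)])
    have "measure (refine \<nu>) V \<le> measure (refine \<nu>) (U \<union> (topspace X - K))"
      by (rule R.finite_measure_mono[OF _ sets.Un[OF TK(2,1)]]) (auto simp: V_def)
    also have "\<dots> \<le> measure (refine \<nu>) U + measure (refine \<nu>) (topspace X - K)"
      by (rule measure_Un_le[OF TK(2,1)])
    finally show "measure \<nu> V \<le> measure (refine \<nu>) U + measure \<nu> (topspace X - K)"
      by (simp add: measure_refine[OF nu VB] measure_refine_compact(2)[OF nu K(1)])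
  qed
  have "\<forall>\<^sub>F n in sequentially. measure \<mu>0 V - e < measure (\<mu> n) V" using \<open>e > 0\<close> by (intro op V) auto
  then show ?thesis
  proof eventually_elim
    case (elim n)
    have "3 * e = measure (refine \<mu>0) U - a" by (simp add: e_def)
    then show ?case using compare(1)[OF mu0] compare(2)[OF mu, of n] elim tail0 K(2)[of n] by linarith
  qed
qed

lemma uniformly_tight_strong_skorohod: "uniformly_tight_strong_skorohod X"
proof -
  obtain code where "skorohod_code (topspace X) D code" using skorohod_code_exists by blast
  then interpret skorohod_code "topspace X" D code .
  define \<xi> where "\<xi> \<mu> = code (refine \<mu>)" for \<mu>
  have tight: "\<mu> \<in> tight_probs X" if "\<mu> \<in> radon_probs X" for \<mu>
    using that radon_probs_subset_tight_probs by blast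
  have meas: "\<xi> \<mu> \<in> measurable unit_lebesgue (borel_of X)" if "\<mu> \<in> radon_probs X" for \<mu>
    using measurable_compose[OF measurable_code[OF refine_tight[OF tight[OF that]]] continuous_map_borel_of[OF continuous_id]]
    by (simp add: \<xi>_def)
  have law: "distr unit_lebesgue (borel_of X) (\<xi> \<mu>) = \<mu>" if mu: "\<mu> \<in> radon_probs X" for \<mu>
  proof (rule distr_unit_lebesgue_eq_radonI[OF H mu meas[OF mu]])
    fix K assume K: "compactin X K"
    show "measure \<mu> K \<le> measure unit_lebesgue (\<xi> \<mu> -` K \<inter> space unit_lebesgue)"
      using code_in_compact[OF refine_tight[OF tight[OF mu]] compact_fine[OF K]] measure_refine_compact(1)[OF tight[OF mu] K]
      by (simp add: \<xi>_def)
  qed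
  have conv: "AE t in unit_lebesgue. limitin X (\<lambda>n. \<xi> (\<mu> n) t) (\<xi> \<mu>0 t) sequentially"
    if mu: "range \<mu> \<subseteq> radon_probs X" and ut: "uniformly_tight X (range \<mu>)"
      and lim: "limitin (radon_topology X) \<mu> \<mu>0 sequentially" for \<mu> \<mu>0
  proof -
    have t: "\<mu> n \<in> tight_probs X" for n using mu tight by blast
    have t0: "\<mu>0 \<in> tight_probs X" by (rule tight[OF limitin_radon_topologyD(1)[OF lim]])
    have "AE t in unit_lebesgue. limitin mtopology (\<lambda>n. \<xi> (\<mu> n) t) (\<xi> \<mu>0 t) sequentially"
      unfolding \<xi>_def
      by (rule code_tendsto) (use refine_tight t t0 refine_weak_limit[OF t t0 ut limitin_radon_topologyD(2)[OF lim]] in blast)+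
    then show ?thesis
    proof eventually_elim
      case (elim t)
      then show ?case using continuous_map_limit[OF continuous_id elim] by (simp add: o_def)
    qed
  qed
  show ?thesis
    unfolding uniformly_tight_strong_skorohod_def skorohod_parametrization_def using meas law conv by blast
qed

end

lemma k_metrizable_uniformly_tight_strong_skorohod:
  fixes X :: "'a topology"
  assumes H: "Hausdorff_space X" and k: "k_metrizable TYPE('m) X"
  shows "uniformly_tight_strong_skorohod X"
proof -
  obtain T :: "'m topology" and f where T: "metrizable_space T" "pc_proper_map T X f" "f ` topspace T = topspace X"
    using k unfolding k_metrizable_def by blast
  obtain M d where M: "Metric_space M d" and T_eq: "T = Metric_space.mtopology M d"
    using T(1) unfolding metrizable_space_def by blast
  interpret M: Metric_space M d by (rule M)
  have cont: "continuous_map M.mtopology X f" using T(2) unfolding pc_proper_map_def T_eq by blast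
  have surj: "f ` M = topspace X" using T(3) unfolding T_eq by simp
  have proper: "compactin M.mtopology (M \<inter> f -` K)" if K: "compactin X K" for K
  proof -
    have "{x \<in> topspace M.mtopology. f x \<in> K} = M \<inter> f -` K" by auto
    then have "closedin M.mtopology (M \<inter> f -` K)"
      using closedin_continuous_map_preimage[OF cont compactin_imp_closedin[OF H K]] by simp
    moreover have "precompactin M.mtopology (M \<inter> f -` K)"
      using T(2) compactin_imp_precompactin[OF H K] unfolding pc_proper_map_def T_eq by simp
    ultimately show ?thesis by (simp add: precompactin_def closure_of_closedin)
  qed
  obtain D where D: "Metric_space (topspace X) D"
    "\<And>U. openin X U \<Longrightarrow> openin (Metric_space.mtopology (topspace X) D) U"
    "\<And>K. compactin X K \<Longrightarrow> compactin (Metric_space.mtopology (topspace X) D) K"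
    by (rule M.metric_of_proper_image[OF H cont surj]) (erule proper, rule that)
  interpret D: Metric_space "topspace X" D by (rule D)
  interpret metric_refinement X D
    by unfold_locales (use H D(2,3) in auto)
  show ?thesis by (rule uniformly_tight_strong_skorohod)
qed

text \<open>A section \<open>s\<close> of \<open>f\<close> with values in \<open>Z\<close> maps compact sets into sets with compact closure, but it need
  not be measurable. Its measurable shadow \<open>\<sigma>\<close> maps almost every point of a compact \<open>K\<close> into \<open>L K\<close>, the closure of
  \<open>s ` K\<close>, for all \<open>K\<close> at once. Hence the lifted measures of a uniformly tight family are uniformly
  tight, and since \<open>f\<close> maps \<open>L K\<close> into \<open>K\<close>, the image of the coded point has the right law.\<close>

lemma k_star_metrizable_weak_skorohod:
  fixes X :: "'a topology"
  assumes H: "Hausdorff_space X" and k: "k_star_metrizable TYPE('m) X"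
  shows "weak_skorohod X"
proof -
  obtain T :: "'m topology" and f where T: "metrizable_space T" "pc_subproper_map T X f"
    using k unfolding k_star_metrizable_def by blast
  obtain M d where M: "Metric_space M d" and T_eq: "T = Metric_space.mtopology M d"
    using T(1) unfolding metrizable_space_def by blast
  interpret Metric_space M d by (rule M)
  obtain Z where cont: "continuous_map mtopology X f" and Z: "Z \<subseteq> M" "f ` Z = topspace X"
    and pre: "\<And>K. precompactin X K \<Longrightarrow> precompactin mtopology (Z \<inter> f -` K)"
    using T(2) unfolding pc_subproper_map_def T_eq topspace_mtopology by blast
  define s where "s y = (SOME z. z \<in> Z \<and> f z = y)" for y
  have s: "s y \<in> Z \<and> f (s y) = y" if "y \<in> topspace X" for y
    unfolding s_def by (rule someI_ex) (use that Z(2) in \<open>force simp: image_iff\<close>)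
  define L where "L K = mtopology closure_of (s ` K)" for K
  have L_compact: "compactin mtopology (L K)" if K: "compactin X K" for K
  proof -
    have KX: "K \<subseteq> topspace X" by (rule compactin_subset_topspace[OF K])
    have "compactin mtopology (mtopology closure_of (Z \<inter> f -` K))"
      using pre[OF compactin_imp_precompactin[OF H K]] unfolding precompactin_def by blast
    moreover have "s ` K \<subseteq> Z \<inter> f -` K" using s KX by auto
    ultimately show ?thesis unfolding L_def by (meson closed_compactin closedin_closure_of closure_of_mono)
  qed
  have f_L: "f x \<in> K" if K: "compactin X K" and x: "x \<in> L K" for x K
  proof -
    have KX: "K \<subseteq> topspace X" by (rule compactin_subset_topspace[OF K])
    have "f ` s ` K = (\<lambda>y. y) ` K" unfolding image_image using s KX by (intro image_cong) auto
    moreover have "f ` L K \<subseteq> X closure_of (f ` s ` K)"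
      unfolding L_def by (rule continuous_map_image_closure_subset[OF cont])
    ultimately show ?thesis using x closure_of_closedin[OF compactin_imp_closedin[OF H K]] by auto
  qed
  have L_sets: "L K \<in> sets (borel_of mtopology)" if "compactin X K" for K
    by (rule compactin_borel_of[OF Hausdorff_space_mtopology L_compact[OF that]])
  have "\<exists>\<sigma>. \<sigma> \<in> measurable \<mu> (borel_of mtopology) \<and> (\<forall>K. compactin X K \<longrightarrow> (AE y in \<mu>. y \<in> K \<longrightarrow> \<sigma> y \<in> L K))"
    if mu: "\<mu> \<in> radon_probs X" for \<mu>
  proof -
    note muD = radon_probsD[OF mu]
    have Ks: "K \<in> sets \<mu>" if "compactin X K" for K using compactin_borel_of[OF H that] muD(2) by simp
    have s_M: "s y \<in> M" if "y \<in> space \<mu>" for y using s Z(1) that muD(3) by auto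
    have s_tight: "\<exists>B\<in>sets \<mu>. measure \<mu> (space \<mu> - B) < \<epsilon> \<and> compactin mtopology (mtopology closure_of (s ` B))"
      if "\<epsilon> > 0" for \<epsilon>
    proof -
      obtain K where K: "compactin X K" "measure \<mu> (topspace X - K) < \<epsilon>"
        using tight_probs_compact[OF subsetD[OF radon_probs_subset_tight_probs mu] \<open>\<epsilon> > 0\<close>] by blast
      then show ?thesis using Ks L_compact muD(3) unfolding L_def by (intro bexI[of _ K]) auto
    qed
    obtain \<sigma> where "\<sigma> \<in> measurable \<mu> (borel_of mtopology)"
      "\<And>B. B \<in> sets \<mu> \<Longrightarrow> compactin mtopology (mtopology closure_of (s ` B)) \<Longrightarrow>
        AE y in \<mu>. y \<in> B \<longrightarrow> \<sigma> y \<in> mtopology closure_of (s ` B)"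
      by (rule measurable_shadow[OF muD(1) s_M s_tight]) (assumption, assumption, rule that)
    then show ?thesis using Ks L_compact unfolding L_def by blast
  qed
  then obtain \<sigma> where \<sigma>: "\<And>\<mu>. \<mu> \<in> radon_probs X \<Longrightarrow> \<sigma> \<mu> \<in> measurable \<mu> (borel_of mtopology)"
    "\<And>\<mu> K. \<mu> \<in> radon_probs X \<Longrightarrow> compactin X K \<Longrightarrow> AE y in \<mu>. y \<in> K \<longrightarrow> \<sigma> \<mu> y \<in> L K" by metis
  define lift where "lift \<mu> = distr \<mu> (borel_of mtopology) (\<sigma> \<mu>)" for \<mu>
  have lift_prob: "prob_space (lift \<mu>)" "sets (lift \<mu>) = sets (borel_of mtopology)" if mu: "\<mu> \<in> radon_probs X" for \<mu>
    using prob_space.prob_space_distr[OF radon_probsD(1)[OF mu] \<sigma>(1)[OF mu]] by (simp_all add: lift_def)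
  have lift_ge: "measure \<mu> K \<le> measure (lift \<mu>) (L K)" if mu: "\<mu> \<in> radon_probs X" and K: "compactin X K" for \<mu> K
  proof -
    interpret prob_space \<mu> by (rule radon_probsD[OF mu])
    have "measure \<mu> K \<le> measure \<mu> (\<sigma> \<mu> -` L K \<inter> space \<mu>)"
    proof (rule finite_measure_mono_AE)
      show "AE y in \<mu>. y \<in> K \<longrightarrow> y \<in> \<sigma> \<mu> -` L K \<inter> space \<mu>"
        using \<sigma>(2)[OF mu K] AE_space by eventually_elim auto
      show "\<sigma> \<mu> -` L K \<inter> space \<mu> \<in> sets \<mu>" by (rule measurable_sets[OF \<sigma>(1)[OF mu] L_sets[OF K]])
    qed
    then show ?thesis by (simp add: lift_def measure_distr[OF \<sigma>(1)[OF mu] L_sets[OF K]])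
  qed
  have lift_tail: "measure (lift \<mu>) (M - L K) \<le> measure \<mu> (topspace X - K)"
    if mu: "\<mu> \<in> radon_probs X" and K: "compactin X K" for \<mu> K
  proof -
    interpret P: prob_space \<mu> by (rule radon_probsD[OF mu])
    interpret Q: prob_space "lift \<mu>" by (rule lift_prob[OF mu])
    have Ks: "K \<in> sets \<mu>" using compactin_borel_of[OF H K] radon_probsD(2)[OF mu] by simp
    have Ls: "L K \<in> sets (lift \<mu>)" using L_sets[OF K] lift_prob(2)[OF mu] by simp
    have "space (lift \<mu>) = M" by (simp add: lift_def)
    then show ?thesis
      using P.prob_compl[OF Ks] Q.prob_compl[OF Ls] lift_ge[OF mu K] radon_probsD(3)[OF mu] by simp
  qed
  have lift_ut: "uniformly_tight mtopology (lift ` \<M>)" if M: "\<M> \<subseteq> radon_probs X" and ut: "uniformly_tight X \<M>" for \<M>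
    unfolding uniformly_tight_def
  proof (intro allI impI)
    fix e :: real assume "e > 0"
    then obtain K where K: "compactin X K" "\<And>\<mu>. \<mu> \<in> \<M> \<Longrightarrow> measure \<mu> (topspace X - K) < e"
      using ut unfolding uniformly_tight_def by blast
    have "measure (lift \<mu>) (M - L K) < e" if "\<mu> \<in> \<M>" for \<mu>
      using lift_tail[OF subsetD[OF M that] K(1)] K(2)[OF that] by simp
    then show "\<exists>K. compactin mtopology K \<and> (\<forall>\<nu>\<in>lift ` \<M>. measure \<nu> (topspace mtopology - K) < e)"
      using L_compact[OF K(1)] by (intro exI[of _ "L K"]) auto
  qed
  have lift_tight: "lift \<mu> \<in> tight_probs mtopology" if mu: "\<mu> \<in> radon_probs X" for \<mu>
  proof -
    have "uniformly_tight X {\<mu>}" using subsetD[OF radon_probs_subset_tight_probs mu] unfolding tight_probs_def by blast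
    then have "uniformly_tight mtopology {lift \<mu>}" using lift_ut[of "{\<mu>}"] mu by simp
    then show ?thesis using lift_prob[OF mu] unfolding tight_probs_def by simp
  qed
  obtain code where "skorohod_code M d code" using skorohod_code_exists by blast
  then interpret skorohod_code M d code .
  define \<xi> where "\<xi> \<mu> t = f (code (lift \<mu>) t)" for \<mu> t
  have meas: "\<xi> \<mu> \<in> measurable unit_lebesgue (borel_of X)" if "\<mu> \<in> radon_probs X" for \<mu>
    unfolding \<xi>_def by (rule measurable_compose[OF measurable_code[OF lift_tight[OF that]] continuous_map_borel_of[OF cont]])
  have law: "distr unit_lebesgue (borel_of X) (\<xi> \<mu>) = \<mu>" if mu: "\<mu> \<in> radon_probs X" for \<mu>
  proof (rule distr_unit_lebesgue_eq_radonI[OF H mu meas[OF mu]])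
    fix K assume K: "compactin X K"
    interpret U: prob_space unit_lebesgue by (rule prob_space_unit_lebesgue)
    have "measure \<mu> K \<le> measure unit_lebesgue (code (lift \<mu>) -` L K \<inter> space unit_lebesgue)"
      using lift_ge[OF mu K] code_in_compact[OF lift_tight[OF mu] L_compact[OF K]] by linarith
    also have "\<dots> \<le> measure unit_lebesgue (\<xi> \<mu> -` K \<inter> space unit_lebesgue)"
    proof (rule U.finite_measure_mono)
      show "code (lift \<mu>) -` L K \<inter> space unit_lebesgue \<subseteq> \<xi> \<mu> -` K \<inter> space unit_lebesgue"
        unfolding \<xi>_def using f_L[OF K] by blast
      show "\<xi> \<mu> -` K \<inter> space unit_lebesgue \<in> sets unit_lebesgue"
        by (rule measurable_sets[OF meas[OF mu] compactin_borel_of[OF H K]])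
    qed
    finally show "measure \<mu> K \<le> measure unit_lebesgue (\<xi> \<mu> -` K \<inter> space unit_lebesgue)" .
  qed
  have conv: "\<exists>r :: nat \<Rightarrow> nat. strict_mono r \<and> (AE t in unit_lebesgue. \<exists>x. limitin X (\<lambda>k. \<xi> (\<mu> (r k)) t) x sequentially)"
    if mu: "range \<mu> \<subseteq> radon_probs X" and ut: "uniformly_tight X (range \<mu>)" for \<mu> :: "nat \<Rightarrow> 'a measure"
  proof -
    have "uniformly_tight mtopology (range (\<lambda>n. lift (\<mu> n)))" using lift_ut[OF mu ut] by (simp add: image_image)
    moreover have "lift (\<mu> n) \<in> tight_probs mtopology" for n using mu by (intro lift_tight) auto
    ultimately obtain r :: "nat \<Rightarrow> nat" where r: "strict_mono r"
      "AE t in unit_lebesgue. \<exists>x. limitin mtopology (\<lambda>k. code (lift (\<mu> (r k))) t) x sequentially"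
      using code_subsequence[of "\<lambda>n. lift (\<mu> n)"] by blast
    have "AE t in unit_lebesgue. \<exists>x. limitin X (\<lambda>k. \<xi> (\<mu> (r k)) t) x sequentially"
      using r(2)
    proof eventually_elim
      case (elim t)
      then obtain x where "limitin mtopology (\<lambda>k. code (lift (\<mu> (r k))) t) x sequentially" by blast
      from continuous_map_limit[OF cont this] show ?case by (auto simp: \<xi>_def o_def)
    qed
    then show ?thesis using r(1) by blast
  qed
  show ?thesis
    unfolding weak_skorohod_def skorohod_parametrization_def using meas law conv by blast
qed

theorem theorem10p2:
  fixes X :: "'a topology"
  assumes "tychonoff_space X"
  shows "(metrizable_space X \<longrightarrow> strong_skorohod X) \<and>
    (k_metrizable TYPE('m) X \<longrightarrow> uniformly_tight_strong_skorohod X) \<and>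
    (k_star_metrizable TYPE('m) X \<longrightarrow> weak_skorohod X)"
proof -
  have "Hausdorff_space X" using assms by (simp add: tychonoff_space_def)
  then show ?thesis
    using metrizable_strong_skorohod k_metrizable_uniformly_tight_strong_skorohod k_star_metrizable_weak_skorohod
    by blast
qed

end
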